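(* Consider the open circular billiard with one hole, an arc of length $\Delta$ (i.e., with two holes of the same length $\Delta$ placed on top of each other). Let $P_1(t,\Delta)$ denote the probability that a particle will not escape till time $t$. Then, assuming that the Riemann hypothesis is correct, for any $\alpha>0$ $$\lim_{\Delta\to0}\lim_{t\to\infty}\Delta^{\alpha-1/2}\left[tP_1(t,\Delta)-2/\Delta\right]=0.$$
   Context: Circular billiard: a point particle moves with unit speed in the unit disk $D$ with elastic reflections at $\partial D$. Boundary points are parametrized by the angle $\beta$ modulo $2\pi$. The phase space is $M=\{(\beta,\psi):-\pi<\beta\le\pi,\ -\frac\pi2\le\psi\le\frac\pi2\}$, where $\psi$ is the angle between the outgoing trajectory and the inner normal at $\beta$. The billiard map is $T(\beta,\psi)=(\beta+\pi-2\psi,\psi)$ (first coordinate mod $2\pi$). It preserves the probability measure $d\mu=\frac{\cos\psi}{4\pi}\,d\psi\,d\beta$ on $M$. Open billiard with the hole $H=\{\beta:0<\beta<\Delta\}$: write $T^n(\beta_0,\psi_0)=(\beta_n,\psi_0)$. Let $N(\beta_0,\psi_0)$ be the smallest integer $n\ge 0$ with $\beta_n\in H$, and $N=\infty$ if there is none. The escape time is $\tau(\beta_0,\psi_0)=2\cos\psi_0\,N(\beta_0,\psi_0)$, with $\tau=\infty$ if $N=\infty$. The probability of not escaping till time $t$ is $P_1(t,\Delta)=\mu(\{x\in M:\tau(x)>t\})$. *)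

theory Defs
  imports
    "HOL-Probability.Probability"
    "HOL-Complex_Analysis.Complex_Analysis"
    "HOL-Library.Real_Mod"
begin

section \<open>The circular billiard\<close>

definition angle_repr :: "real \<Rightarrow> real" where
  \<comment> \<open>the representative of an angle modulo \<open>2 * pi\<close> in the interval \<open>{- pi <.. pi}\<close>\<close>
  "angle_repr b = pi - (pi - b) rmod (2 * pi)"

definition phase_space :: "(real \<times> real) set" where
  "phase_space = {- pi <.. pi} \<times> {- pi / 2 .. pi / 2}"

definition billiard_map :: "real \<times> real \<Rightarrow> real \<times> real" where
  "billiard_map = (\<lambda>(b, p). (angle_repr (b + pi - 2 * p), p))"

definition billiard_measure :: "(real \<times> real) measure" where
  "billiard_measure =
     density (restrict_space lborel phase_space) (\<lambda>(b, p). ennreal (cos p / (4 * pi)))"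

section \<open>One hole of length \<open>d\<close>\<close>

definition hole :: "real \<Rightarrow> real set" where
  \<comment> \<open>the arc is taken modulo \<open>2 * pi\<close>, so that it is also correct for \<open>d > pi\<close>\<close>
  "hole d = {b. \<exists>b'. 0 < b' \<and> b' < d \<and> [b = b'] (rmod 2 * pi)}"

definition escapes :: "real \<Rightarrow> real \<times> real \<Rightarrow> bool" where
  "escapes d x \<longleftrightarrow> (\<exists>n. fst ((billiard_map ^^ n) x) \<in> hole d)"

definition collisions_before_escape :: "real \<Rightarrow> real \<times> real \<Rightarrow> enat" where
  "collisions_before_escape d x =
     (if escapes d x then enat (LEAST n. fst ((billiard_map ^^ n) x) \<in> hole d) else \<infinity>)"

definition escape_time :: "real \<Rightarrow> real \<times> real \<Rightarrow> ereal" where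
  \<comment> \<open>the case distinction matters at grazing angles, as \<open>0 * \<infinity> = 0\<close> in \<^typ>\<open>ereal\<close>\<close>
  "escape_time d x =
     (case collisions_before_escape d x of
        enat n \<Rightarrow> ereal (2 * cos (snd x) * real n)
      | \<infinity> \<Rightarrow> \<infinity>)"

definition survival_prob :: "real \<Rightarrow> real \<Rightarrow> real" where
  "survival_prob t d = measure billiard_measure {x \<in> phase_space. escape_time d x > ereal t}"

section \<open>The Riemann hypothesis\<close>

definition riemann_zeta :: "complex \<Rightarrow> complex" where
  \<comment> \<open>the analytic continuation of the Dirichlet series to the plane without the pole at 1,
    where it is given the dummy value 0\<close>
  "riemann_zeta = (THE f. f holomorphic_on (- {1}) \<and> f 1 = 0 \<and>
     (\<forall>s. Re s > 1 \<longrightarrow> (\<lambda>n. 1 / of_nat (Suc n) powr s) sums f s))"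

definition riemann_hypothesis :: bool where
  "riemann_hypothesis \<longleftrightarrow>
     (\<forall>s. 0 < Re s \<and> Re s < 1 \<and> riemann_zeta s = 0 \<longrightarrow> Re s = 1 / 2)"

end

theory Submission
  imports Defs "HOL-Computational_Algebra.Squarefree" "HOL-Number_Theory.Cong"
begin

text \<open>Let \<open>x = 1 / 2 - \<psi> / pi\<close>, so that each collision advances the particle by the
fraction \<open>x\<close> of the boundary circle, and let
\<open>h = \<Delta> / (2 * pi) = 1 / X\<close> be the fraction covered by the hole. If a particle
survives for a long time \<open>t\<close>, then \<open>x\<close> is close to a fraction
\<open>m / n\<close> in lowest terms whose periodic orbits can avoid the hole, which means
\<open>n < X\<close>. Near such a fraction, \<open>n\<close> collisions move the particle by the
small amount \<open>n * \<bar>x - m / n\<bar>\<close>, and the surviving fraction of starting points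
is, up to a bounded change of the number \<open>\<tau> = t / (2 * sin (pi * x))\<close> of
collisions, the tent \<open>max 0 (1 - n * h - n * \<tau> * \<bar>x - m / n\<bar>)\<close> (lemmas
\<open>surviving_upper\<close> and \<open>sum_peaks_le\<close>). Integrating the tents shows that
\<open>t * P\<^sub>1\<close> tends to \<open>pi\<close> times the sum of
\<open>(sin (pi * m / n))\<^sup>2 * (1 - n / X)\<^sup>2 / n\<close> over these fractions
(\<open>survival_prob_limit\<close>).

The rest is number theory. Resolving the coprimality of \<open>m\<close> and \<open>n\<close> by the
Moebius function turns the sum into half the sum of \<open>moebius_mu d / d * \<Phi> (d / X)\<close>
over \<open>d \<le> X\<close>, where \<open>\<Phi> v\<close> is the sum of
\<open>(max 0 (1 - k * v))\<^sup>2\<close> over \<open>k \<ge> 2\<close>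
(\<open>resonance_moebius_sum\<close>). As \<open>\<Phi> v - 1 / (3 * v)\<close> is Lipschitz,
\<open>1 / (3 * v)\<close> gives the main term \<open>X / pi = 2 / \<Delta>\<close> by way of the
value \<open>6 / pi\<^sup>2\<close> of the sum of \<open>moebius_mu d / d\<^sup>2\<close>, and
summation by parts bounds everything else by the partial sums of \<open>moebius_mu d / d\<close>
(\<open>resonance_estimate\<close>). The theorem follows once these are
\<open>O(N powr (\<eta> - 1 / 2))\<close> for every \<open>\<eta> > 0\<close>.

This is where the Riemann hypothesis enters. It makes the reciprocal of zeta holomorphic to the
right of \<open>1 / 2\<close>, the line of real part one being covered by the inequality
\<open>3 + 4 cos \<theta> + cos (2 \<theta>) \<ge> 0\<close>. A normal families argument shows that
the reciprocal grows more slowly than every power of the imaginary part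
(\<open>inv_zeta_bound\<close>). Newman's contour integral with radius \<open>R = N\<close> then
bounds the partial sums of its series at the point 1, where it vanishes
(\<open>newman_estimate\<close>).\<close>

section \<open>Analytic continuation of the zeta function\<close>

lemma norm_of_nat_powr:
  "norm (of_nat n powr s :: complex) = real n powr Re s"
  by (simp add: norm_powr_real_powr)

lemma inverse_Suc_powr: "1 / of_nat (Suc n) powr s = (of_nat (Suc n) powr (-s) :: complex)"
  by (simp only: powr_minus_divide)

text \<open>The remainder of order \<open>K\<close> in the Taylor expansion of \<open>x powr (1 - s)\<close>
about \<open>x = m + 1\<close>, taken at \<open>x = m + 2\<close>. It decays like
\<open>m powr (- Re s - K)\<close>, so the sum over \<open>m\<close> is defined, and holomorphic, in
half-planes that move to the left as \<open>K\<close> grows.\<close>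

definition zeta_rem :: "nat \<Rightarrow> nat \<Rightarrow> complex \<Rightarrow> complex" where
  "zeta_rem K m s = of_nat (Suc (Suc m)) powr (1 - s)
     - (\<Sum>k\<le>K. ((1 - s) gchoose k) * of_nat (Suc m) powr (1 - s - of_nat k))"

lemma gchoose_Suc_factor:
  fixes a :: "'a :: field_char_0"
  shows "a gchoose Suc k = (a gchoose k) * (a - of_nat k) / of_nat (Suc k)"
proof -
  have "(a gchoose Suc k) * fact (Suc k) = (\<Prod>i = 0..<Suc k. a - of_nat i)"
    using gbinomial_mult_fact'[of a "Suc k"] by simp
  also have "\<dots> = (\<Prod>i = 0..<k. a - of_nat i) * (a - of_nat k)"
    by (simp add: prod.atLeast0_lessThan_Suc)
  also have "\<dots> = (a gchoose k) * fact k * (a - of_nat k)"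
    using gbinomial_mult_fact'[of a k] by simp
  finally have "(a gchoose Suc k) * of_nat (Suc k) * fact k = (a gchoose k) * (a - of_nat k) * fact k"
    by (simp add: fact_Suc mult_ac)
  then have "(a gchoose Suc k) * of_nat (Suc k) = (a gchoose k) * (a - of_nat k)"
    by simp
  then show ?thesis
    by (metis nonzero_mult_div_cancel_right of_nat_neq_0)
qed

text \<open>Taylor's theorem on the segment from \<open>m + 1\<close> to \<open>m + 2\<close>: the derivatives
of \<open>x powr (1 - s)\<close> are binomial coefficients times powers of \<open>x\<close>, and the
power in the last one decreases along the segment.\<close>

lemma zeta_rem_bound:
  assumes "Re s + real K \<ge> 0"
  shows "norm (zeta_rem K m s)
    \<le> real (Suc K) * norm ((1 - s) gchoose Suc K) * real (Suc m) powr (- Re s - real K)"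
proof -
  define S where "S = closed_segment (of_nat (Suc m)) (of_nat (Suc (Suc m)) :: complex)"
  define f where "f = (\<lambda>i x. fact i * ((1 - s) gchoose i) * x powr (1 - s - of_nat i) :: complex)"
  have S: "\<exists>u. x = of_real u \<and> real (Suc m) \<le> u \<and> u \<le> real (Suc (Suc m))" if x: "x \<in> S" for x
  proof -
    obtain u where u: "0 \<le> u" "u \<le> 1" "x = (1 - u) *\<^sub>R of_nat (Suc m) + u *\<^sub>R of_nat (Suc (Suc m))"
      using x by (auto simp: S_def closed_segment_def)
    have "x = of_real (real (Suc m) + u)"
      using u(3) by (simp add: scaleR_conv_of_real algebra_simps)
    then show ?thesis using u by (intro exI[of _ "real (Suc m) + u"]) auto
  qed
  have "norm (f 0 (of_nat (Suc (Suc m))) - (\<Sum>i\<le>K. f i (of_nat (Suc m))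
           * (of_nat (Suc (Suc m)) - of_nat (Suc m)) ^ i / fact i))
        \<le> (fact (Suc K) * norm ((1 - s) gchoose Suc K) * real (Suc m) powr (- Re s - real K))
           * norm (of_nat (Suc (Suc m)) - of_nat (Suc m) :: complex) ^ Suc K / fact K"
  proof (rule complex_Taylor)
    show "convex S" by (simp add: S_def)
  next
    fix i x assume x: "x \<in> S" and "i \<le> K"
    from S[OF x] obtain u where u: "x = of_real u" "u > 0" by force
    then have nonp: "x \<notin> \<real>\<^sub>\<le>\<^sub>0" by auto
    have "((\<lambda>x. fact i * ((1 - s) gchoose i) * x powr (1 - s - of_nat i)) has_field_derivative
      fact i * ((1 - s) gchoose i) * ((1 - s - of_nat i) * x powr (1 - s - of_nat i - 1))) (at x)"
      by (intro DERIV_cmult has_field_derivative_powr nonp)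
    moreover have "fact i * ((1 - s) gchoose i) * ((1 - s - of_nat i) * x powr (1 - s - of_nat i - 1))
       = f (Suc i) x"
    proof -
      have "of_nat (Suc i) * ((1 - s) gchoose Suc i) = ((1 - s) gchoose i) * (1 - s - of_nat i)"
        by (subst gchoose_Suc_factor) (simp del: of_nat_Suc)
      then have "fact (Suc i) * ((1 - s) gchoose Suc i) = fact i * (((1 - s) gchoose i) * (1 - s - of_nat i))"
        by (simp add: fact_Suc mult_ac)
      moreover have "1 - s - of_nat i - 1 = 1 - s - of_nat (Suc i)" by simp
      ultimately show ?thesis unfolding f_def by (simp only: mult.assoc)
    qed
    ultimately have "(f i has_field_derivative f (Suc i) x) (at x)"
      by (simp only: f_def)
    then show "(f i has_field_derivative f (Suc i) x) (at x within S)"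
      by (rule has_field_derivative_at_within)
  next
    fix x assume x: "x \<in> S"
    from S[OF x] obtain u where u: "x = of_real u" "real (Suc m) \<le> u" by force
    have "norm (x powr (1 - s - of_nat (Suc K))) = u powr (- Re s - real K)"
      using u by (simp add: norm_powr_real_powr)
    also have "\<dots> \<le> real (Suc m) powr (- Re s - real K)"
      using u assms by (intro powr_mono2') auto
    finally show "norm (f (Suc K) x)
       \<le> fact (Suc K) * norm ((1 - s) gchoose Suc K) * real (Suc m) powr (- Re s - real K)"
      unfolding f_def norm_mult by (auto intro!: mult_mono simp: norm_mult simp del: of_nat_Suc)
  qed (auto simp: S_def)
  also have "\<dots> = real (Suc K) * norm ((1 - s) gchoose Suc K) * real (Suc m) powr (- Re s - real K)"
    by (simp add: fact_Suc)
  also have "(\<Sum>i\<le>K. f i (of_nat (Suc m)) * (of_nat (Suc (Suc m)) - of_nat (Suc m)) ^ i / fact i)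
      = (\<Sum>k\<le>K. ((1 - s) gchoose k) * of_nat (Suc m) powr (1 - s - of_nat k))"
    unfolding f_def by (intro sum.cong) (auto simp del: of_nat_Suc simp: of_nat_Suc[of "Suc m"])
  also have "f 0 (of_nat (Suc (Suc m))) = of_nat (Suc (Suc m)) powr (1 - s)"
    by (simp add: f_def)
  finally show ?thesis by (simp add: zeta_rem_def)
qed

lemma summable_Suc_powr:
  assumes "c > 1" shows "summable (\<lambda>n. real (Suc n) powr (- c))"
  using assms by (subst summable_Suc_iff) (simp add: summable_real_powr_iff)

lemma summable_zeta:
  assumes "Re s > 1" shows "summable (\<lambda>n. of_nat (Suc n) powr (- s) :: complex)"
  by (rule summable_norm_cancel) (simp only: norm_of_nat_powr uminus_complex.simps summable_Suc_powr[OF assms])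

lemma holomorphic_gchoose [holomorphic_intros]:
  "f holomorphic_on A \<Longrightarrow> (\<lambda>s. f s gchoose k :: complex) holomorphic_on A"
  unfolding gbinomial_prod_rev by (intro holomorphic_intros) auto

lemma zeta_rem_holomorphic: "zeta_rem K m holomorphic_on A"
proof -
  have "(\<lambda>s. of_nat (Suc (Suc m)) powr (1 - s)
     - (\<Sum>k\<le>K. ((1 - s) gchoose k) * of_nat (Suc m) powr (1 - s - of_nat k))) holomorphic_on A"
    by (intro holomorphic_intros)
  then show ?thesis by (simp add: zeta_rem_def[abs_def])
qed

lemma open_Re_gt: "open {s. Re s > c}"
  by (rule open_halfspace_Re_gt)

lemma zeta_rem_sum_holomorphic:
  shows "(\<lambda>s. \<Sum>m. zeta_rem K m s) holomorphic_on {s. Re s > 1 - real K}"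
    and "Re s > 1 - real K \<Longrightarrow> summable (\<lambda>m. zeta_rem K m s)"
proof -
  define S where "S = {s. Re s > 1 - real K}"
  have opS: "open S" unfolding S_def by (rule open_Re_gt)
  obtain g where g: "\<forall>x\<in>S. ((\<lambda>n. zeta_rem K n x) sums g x) \<and> g field_differentiable (at x)"
  proof (rule series_differentiable_comparison_complex[OF opS, of "zeta_rem K"])
    fix n x assume "x \<in> S"
    then show "zeta_rem K n field_differentiable at x"
      using zeta_rem_holomorphic[of K n UNIV] by (simp add: holomorphic_on_def)
  next
    fix x assume x: "x \<in> S"
    define d where "d = (Re x - (1 - real K)) / 2"
    have d: "d > 0" using x by (simp add: d_def S_def)
    have "(\<lambda>s. (1 - s) gchoose Suc K :: complex) holomorphic_on cball x d"
      by (intro holomorphic_intros)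
    then have "compact ((\<lambda>s. (1 - s) gchoose Suc K :: complex) ` cball x d)"
      by (intro compact_continuous_image holomorphic_on_imp_continuous_on) auto
    then obtain B where B: "\<And>s. s \<in> cball x d \<Longrightarrow> norm ((1 - s) gchoose Suc K :: complex) \<le> B"
      using compact_imp_bounded bounded_iff by (metis imageI)
    have B0: "B \<ge> 0" using B[of x] d by (smt (verit) centre_in_cball norm_ge_zero)
    define h where "h = (\<lambda>n. real (Suc K) * B * real (Suc n) powr (- (1 + d)))"
    have "\<forall>y\<in>ball x d \<inter> S. norm (zeta_rem K n y) \<le> norm (of_real (h n) :: complex)" for n
    proof
      fix y assume y: "y \<in> ball x d \<inter> S"
      have "\<bar>Re (x - y)\<bar> \<le> norm (x - y)" by (rule abs_Re_le_cmod)
      with y have Re: "Re y + real K \<ge> 1 + d" by (auto simp: d_def dist_norm field_simps)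
      have "norm (zeta_rem K n y) \<le> real (Suc K) * norm ((1 - y) gchoose Suc K) * real (Suc n) powr (- Re y - real K)"
        using Re d by (intro zeta_rem_bound) linarith
      also have "\<dots> \<le> h n"
        unfolding h_def using B[of y] y Re B0
        by (intro mult_mono powr_mono) auto
      finally show "norm (zeta_rem K n y) \<le> norm (of_real (h n) :: complex)" by simp
    qed
    moreover have "summable (\<lambda>n. complex_of_real (h n))"
      unfolding h_def using summable_Suc_powr[of "1 + d"] d
      by (intro summable_of_real summable_mult) auto
    moreover have "range (\<lambda>n. complex_of_real (h n)) \<subseteq> \<real>\<^sub>\<ge>\<^sub>0"
      using B0 by (auto simp: h_def)
    ultimately show "\<exists>d h. 0 < d \<and> summable h \<and> range h \<subseteq> \<real>\<^sub>\<ge>\<^sub>0 \<and>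
        (\<forall>\<^sub>F n in sequentially. \<forall>y\<in>ball x d \<inter> S. cmod (zeta_rem K n y) \<le> cmod (h n))"
      using d by (intro exI[of _ d] exI[of _ "\<lambda>n. complex_of_real (h n)"]) auto
  qed
  have "g holomorphic_on S"
    using g opS by (auto simp: holomorphic_on_def field_differentiable_at_within)
  moreover have "g x = (\<Sum>m. zeta_rem K m x)" if "x \<in> S" for x
    using g that sums_unique by blast
  ultimately show "(\<lambda>s. \<Sum>m. zeta_rem K m s) holomorphic_on {s. Re s > 1 - real K}"
    unfolding S_def by (metis (no_types, lifting) holomorphic_transform)
  show "summable (\<lambda>m. zeta_rem K m s)" if "Re s > 1 - real K"
    using g that by (auto simp: S_def summable_def)
qed

definition zeta_series :: "complex \<Rightarrow> complex" where
  "zeta_series s = (\<Sum>n. of_nat (Suc n) powr (- s))"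

text \<open>Telescoping the differences \<open>(m + 2) powr (1 - s) - (m + 1) powr (1 - s)\<close> gives
\<open>-1\<close>. Expanding each difference by Taylor's formula produces the series of zeta at
\<open>s\<close>, \<open>s + 1\<close>, ... . This expresses zeta at \<open>s\<close> by its values
further to the right and by a remainder that converges further to the left.\<close>

lemma zeta_series_recursion:
  assumes s: "Re s > 1" and K: "K \<ge> 1"
  shows "(s - 1) * zeta_series s = 1 + (\<Sum>m. zeta_rem K m s)
     + (\<Sum>k = 2..K. ((1 - s) gchoose k) * zeta_series (s + of_nat k - 1))"
proof -
  define p where "p = (\<lambda>m. of_nat (Suc m) powr (1 - s) :: complex)"
  have p0: "p \<longlonglongrightarrow> 0"
  proof (rule tendsto_norm_zero_cancel)
    have "(\<lambda>m. real (Suc m) powr (1 - Re s)) \<longlonglongrightarrow> 0"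
      using s by real_asymp
    then show "(\<lambda>m. norm (p m)) \<longlonglongrightarrow> 0"
      unfolding p_def norm_of_nat_powr by simp
  qed
  have "(\<lambda>m. p (Suc m) - p m) sums (0 - p 0)"
    by (rule telescope_sums[OF p0])
  then have tel: "(\<lambda>m. p (Suc m) - p m) sums (-1)"
    by (simp add: p_def)
  have zs: "(\<lambda>m. of_nat (Suc m) powr (- w)) sums zeta_series w" if "Re w > 1" for w
    using summable_zeta[OF that] by (simp add: zeta_series_def summable_sums)
  have "(\<lambda>m. (p (Suc m) - p m) - (\<Sum>k = 1..K. ((1 - s) gchoose k) * of_nat (Suc m) powr (- (s + of_nat k - 1))))
     sums (-1 - (\<Sum>k = 1..K. ((1 - s) gchoose k) * zeta_series (s + of_nat k - 1)))"
    using s by (intro sums_diff tel sums_sum sums_mult zs) auto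
  also have "(\<lambda>m. (p (Suc m) - p m) - (\<Sum>k = 1..K. ((1 - s) gchoose k) * of_nat (Suc m) powr (- (s + of_nat k - 1))))
     = (\<lambda>m. zeta_rem K m s)"
  proof
    fix m
    have "{..K} = insert 0 {1..K}" by auto
    then have "zeta_rem K m s = of_nat (Suc (Suc m)) powr (1 - s)
     - (of_nat (Suc m) powr (1 - s) + (\<Sum>k = 1..K. ((1 - s) gchoose k) * of_nat (Suc m) powr (1 - s - of_nat k)))"
      unfolding zeta_rem_def by simp
    moreover have "1 - s - of_nat k = - (s + of_nat k - 1)" for k by simp
    ultimately show "(p (Suc m) - p m) - (\<Sum>k = 1..K. ((1 - s) gchoose k) * of_nat (Suc m) powr (- (s + of_nat k - 1)))
      = zeta_rem K m s"
      unfolding p_def by (simp only: diff_diff_eq)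
  qed
  finally have "(\<Sum>m. zeta_rem K m s) = -1 - (\<Sum>k = 1..K. ((1 - s) gchoose k) * zeta_series (s + of_nat k - 1))"
    by (simp add: sums_iff)
  moreover have "{1..K} = insert 1 {2..K}" using K by auto
  ultimately show ?thesis
    by (simp add: algebra_simps)
qed

text \<open>The recursion extends the domain by one unit to the left at a time. The possible poles at the points
where \<open>s + k - 1 = 1\<close> do not arise because the factor \<open>s + k - 2\<close> of the
binomial coefficient cancels them; working with \<open>(s - 1) * zeta\<close> makes this
cancellation a formal identity.\<close>

lemma zeta_continuation_halfplane:
  "\<exists>f. f holomorphic_on {s. Re s > - real K} \<and> (\<forall>s. Re s > 1 \<longrightarrow> f s = (s - 1) * zeta_series s)"
proof (induction K)
  case 0
  show ?case
    using zeta_rem_sum_holomorphic(1)[of 1] zeta_series_recursion[of _ 1]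
    by (intro exI[of _ "\<lambda>s. 1 + (\<Sum>m. zeta_rem 1 m s)"]) (auto intro!: holomorphic_intros)
next
  case (Suc K)
  then obtain f where f: "f holomorphic_on {s. Re s > - real K}"
    "\<And>s. Re s > 1 \<Longrightarrow> f s = (s - 1) * zeta_series s" by blast
  define g where "g = (\<lambda>s. 1 + (\<Sum>m. zeta_rem (K + 2) m s)
     + (\<Sum>k = 2..K + 2. - ((1 - s) gchoose (k - 1)) / of_nat k * f (s + of_nat k - 1)))"
  have "g holomorphic_on {s. Re s > - real (Suc K)}"
  proof -
    have "(f \<circ> (\<lambda>s. s + of_nat k - 1)) holomorphic_on {s. Re s > - real (Suc K)}" if "k \<ge> 2" for k
      using that by (intro holomorphic_on_compose_gen[OF _ f(1)] holomorphic_intros) auto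
    then have 1: "(\<lambda>s. f (s + of_nat k - 1)) holomorphic_on {s. Re s > - real (Suc K)}" if "k \<ge> 2" for k
      using that by (simp add: o_def)
    have 2: "(\<lambda>s. \<Sum>m. zeta_rem (K + 2) m s) holomorphic_on {s. Re s > - real (Suc K)}"
      using zeta_rem_sum_holomorphic(1)[of "K + 2"] by simp
    show ?thesis
      unfolding g_def by (intro holomorphic_intros 1 2) auto
  qed
  moreover have "g s = (s - 1) * zeta_series s" if s: "Re s > 1" for s
  proof -
    have "((1 - s) gchoose k) * zeta_series (s + of_nat k - 1)
       = - ((1 - s) gchoose (k - 1)) / of_nat k * f (s + of_nat k - 1)" if k: "k \<in> {2..K + 2}" for k
    proof -
      obtain j where j: "k = Suc j" "j \<ge> 1" using k by (cases k) auto
      have "f (s + of_nat k - 1) = (s + of_nat j - 1) * zeta_series (s + of_nat j)"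
        using f(2)[of "s + of_nat k - 1"] s j by simp
      then show ?thesis
        using j(1) by (simp add: gchoose_Suc_factor divide_simps del: of_nat_Suc) (simp add: algebra_simps)
    qed
    then show ?thesis
      unfolding g_def by (subst zeta_series_recursion[OF s, of "K + 2"]) auto
  qed
  ultimately show ?case by blast
qed

lemma zeta_entire:
  obtains B where "B holomorphic_on UNIV" "\<And>s. Re s > 1 \<Longrightarrow> B s = (s - 1) * zeta_series s"
proof -
  obtain f where f: "\<And>K. f K holomorphic_on {s. Re s > - real K}"
    "\<And>K s. Re s > 1 \<Longrightarrow> f K s = (s - 1) * zeta_series s"
    using zeta_continuation_halfplane by metis
  have eq: "f K s = f L s" if "Re s > - real K" "K \<le> L" for K L s
  proof (rule analytic_continuation_open[of "{s. Re s > 1}" "{s. Re s > - real K}" "f K" "f L"])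
    show "f L holomorphic_on {s. - real K < Re s}"
      by (rule holomorphic_on_subset[OF f(1)]) (use that in auto)
    show "{s. 1 < Re s} \<noteq> {}" by (auto intro!: exI[of _ 2])
    show "connected {s. - real K < Re s}"
      by (intro convex_connected convex_halfspace_Re_gt)
  qed (use f that open_Re_gt in auto)
  define B where "B = (\<lambda>s. f (nat \<lceil>\<bar>Re s\<bar>\<rceil> + 1) s)"
  have BK: "B s = f K s" if "Re s > - real K" for s K
  proof (cases "K \<le> nat \<lceil>\<bar>Re s\<bar>\<rceil> + 1")
    case True
    then show ?thesis using eq[OF that True] by (simp add: B_def)
  next
    case False
    have "Re s > - real (nat \<lceil>\<bar>Re s\<bar>\<rceil> + 1)"
      by (simp add: of_nat_nat) linarith
    then show ?thesis using eq[of "nat \<lceil>\<bar>Re s\<bar>\<rceil> + 1" s K] False by (simp add: B_def)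
  qed
  have "B field_differentiable at s" for s
  proof -
    define K where "K = nat \<lceil>\<bar>Re s\<bar>\<rceil> + 1"
    have s: "Re s > - real K"
      unfolding K_def by (simp add: of_nat_nat) linarith
    have "f K field_differentiable at s"
      using holomorphic_on_imp_differentiable_at[OF f(1)[of K] open_Re_gt] s by auto
    moreover have "eventually (\<lambda>w. f K w = B w) (nhds s)"
      using eventually_nhds_in_open[OF open_Re_gt[of "- real K"], of s] s
      by (auto elim!: eventually_mono simp: BK)
    ultimately show ?thesis
      unfolding field_differentiable_def by (metis DERIV_cong_ev)
  qed
  then have "B holomorphic_on UNIV" by (simp add: holomorphic_on_def)
  moreover have "B s = (s - 1) * zeta_series s" if "Re s > 1" for s
    using BK[of 0 s] f(2)[of s 0] that by simp
  ultimately show ?thesis using that by blast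
qed

lemma riemann_zeta_characterisation:
  "riemann_zeta holomorphic_on - {1}" "riemann_zeta 1 = 0"
  "Re s > 1 \<Longrightarrow> (\<lambda>n. 1 / of_nat (Suc n) powr s) sums riemann_zeta s"
proof -
  define P where "P = (\<lambda>f. f holomorphic_on (- {1}) \<and> f 1 = 0 \<and>
     (\<forall>s. Re s > 1 \<longrightarrow> (\<lambda>n. 1 / of_nat (Suc n) powr s) sums (f s :: complex)))"
  obtain B where B: "B holomorphic_on UNIV" "\<And>s. Re s > 1 \<Longrightarrow> B s = (s - 1) * zeta_series s"
    using zeta_entire by blast
  have "\<exists>!f. P f"
  proof (rule ex_ex1I)
    define f where "f = (\<lambda>s. B s / (s - 1))"
    have "f holomorphic_on - {1}"
      unfolding f_def by (intro holomorphic_intros holomorphic_on_subset[OF B(1)]) auto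
    moreover have "(\<lambda>n. 1 / of_nat (Suc n) powr s) sums f s" if "Re s > 1" for s
    proof -
      have "f s = zeta_series s" using B(2)[OF that] that by (auto simp: f_def)
      then show ?thesis
        using summable_zeta[OF that] unfolding inverse_Suc_powr by (simp add: zeta_series_def summable_sums)
    qed
    ultimately show "\<exists>f. P f" unfolding P_def f_def by (intro exI[of _ "\<lambda>s. B s / (s - 1)"]) auto
  next
    fix f g assume fg: "P f" "P g"
    show "f = g"
    proof
      fix s show "f s = g s"
      proof (cases "s = 1")
        case False
        show ?thesis
        proof (rule analytic_continuation_open[of "{s. Re s > 1}" "- {1}" f g])
          show "{s. 1 < Re s} \<noteq> {}" by (auto intro!: exI[of _ 2])
          show "connected (- {1::complex})" by (rule connected_punctured_universe) auto
          show "f z = g z" if "z \<in> {s. 1 < Re s}" for z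
            using fg that sums_unique2 unfolding P_def by blast
        qed (use fg False open_Re_gt in \<open>auto simp: P_def\<close>)
      qed (use fg in \<open>auto simp: P_def\<close>)
    qed
  qed
  moreover have "riemann_zeta = (THE f. P f)"
    unfolding riemann_zeta_def P_def ..
  ultimately have "P riemann_zeta" using theI'[of P] by simp
  then show "riemann_zeta holomorphic_on - {1}" "riemann_zeta 1 = 0"
    "Re s > 1 \<Longrightarrow> (\<lambda>n. 1 / of_nat (Suc n) powr s) sums riemann_zeta s"
    by (auto simp: P_def)
qed

lemma riemann_zeta_series:
  assumes "Re s > 1" shows "(\<lambda>n. of_nat (Suc n) powr (- s)) sums riemann_zeta s"
  using riemann_zeta_characterisation(3)[OF assms] unfolding inverse_Suc_powr .

definition zeta_num :: "complex \<Rightarrow> complex" where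
  "zeta_num s = (if s = 1 then 1 else (s - 1) * riemann_zeta s)"

text \<open>The recursion of order one is an explicit formula to the right of the imaginary axis; it yields the
value 1 at the pole of zeta and the polynomial growth bound below.\<close>

lemma zeta_num_eq:
  assumes "Re s > 0" shows "zeta_num s = 1 + (\<Sum>m. zeta_rem 1 m s)"
proof (cases "s = 1")
  case True
  have "zeta_rem 1 m 1 = 0" for m
    by (simp add: zeta_rem_def del: of_nat_Suc)
  then show ?thesis by (simp add: True zeta_num_def)
next
  case False
  define g where "g = (\<lambda>s. 1 + (\<Sum>m. zeta_rem 1 m s))"
  have "(s - 1) * riemann_zeta s = g s"
  proof (rule analytic_continuation_open[of "{s. Re s > 1}" "{s. Re s > 0} - {1}"
        "\<lambda>s. (s - 1) * riemann_zeta s" g])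
    show "{s. 1 < Re s} \<noteq> {}" by (auto intro!: exI[of _ 2])
    show "connected ({s. Re s > 0} - {1})"
      by (intro connected_open_delete open_Re_gt convex_connected convex_halfspace_Re_gt) auto
    show "(\<lambda>s. (s - 1) * riemann_zeta s) holomorphic_on {s. 0 < Re s} - {1}"
      by (intro holomorphic_intros holomorphic_on_subset[OF riemann_zeta_characterisation(1)]) auto
    show "g holomorphic_on {s. 0 < Re s} - {1}"
      unfolding g_def using zeta_rem_sum_holomorphic(1)[of 1]
      by (intro holomorphic_intros) (auto elim: holomorphic_on_subset)
    show "(z - 1) * riemann_zeta z = g z" if "z \<in> {s. 1 < Re s}" for z
    proof -
      have "riemann_zeta z = zeta_series z"
        using riemann_zeta_series[of z] that by (simp add: zeta_series_def sums_iff)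
      then show ?thesis using zeta_series_recursion[of z 1] that by (simp add: g_def)
    qed
    show "open ({s. 0 < Re s} - {1})" by (intro open_Diff open_Re_gt) auto
  qed (use False assms open_Re_gt in auto)
  then show ?thesis using False by (simp add: zeta_num_def g_def)
qed

lemma zeta_num_holomorphic: "zeta_num holomorphic_on {s. Re s > 0}"
  using zeta_rem_sum_holomorphic(1)[of 1]
  by (subst holomorphic_cong[OF refl zeta_num_eq]) (auto intro!: holomorphic_intros)

lemma zeta_num_bound:
  obtains C where "C > 0" "\<And>s. Re s \<ge> 1 / 2 \<Longrightarrow> norm (zeta_num s) \<le> 1 + C * norm s * norm (s - 1)"
proof
  define C where "C = (\<Sum>n. real (Suc n) powr (- (3 / 2)))"
  have sm: "summable (\<lambda>n. real (Suc n) powr (- (3 / 2)))" by (rule summable_Suc_powr) simp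
  show "C > 0" unfolding C_def by (rule suminf_pos[OF sm]) simp
  fix s assume s: "Re s \<ge> 1 / 2"
  have b: "norm (zeta_rem 1 m s) \<le> norm s * norm (s - 1) * real (Suc m) powr (- (3 / 2))" for m
  proof -
    have "(1 - s) gchoose Suc 1 = (1 - s) * (- s) / 2"
      by (subst gchoose_Suc_factor) simp
    then have g: "real (Suc 1) * norm ((1 - s) gchoose Suc 1) = norm s * norm (s - 1)"
      by (simp add: norm_mult norm_divide norm_minus_commute)
    have "norm (zeta_rem 1 m s) \<le> norm s * norm (s - 1) * real (Suc m) powr (- Re s - real 1)"
      using zeta_rem_bound[of s 1 m] s unfolding g by simp
    also have "\<dots> \<le> norm s * norm (s - 1) * real (Suc m) powr (- (3 / 2))"
      using s by (intro mult_left_mono powr_mono) auto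
    finally show ?thesis .
  qed
  have "norm (\<Sum>m. zeta_rem 1 m s) \<le> (\<Sum>m. norm s * norm (s - 1) * real (Suc m) powr (- (3 / 2)))"
    by (rule norm_suminf_le[OF b summable_mult[OF sm]])
  also have "\<dots> = C * norm s * norm (s - 1)"
    unfolding C_def by (subst suminf_mult[OF sm]) (simp add: mult_ac)
  finally have *: "norm (\<Sum>m. zeta_rem 1 m s) \<le> C * norm s * norm (s - 1)" .
  have "norm (zeta_num s) \<le> norm (1::complex) + norm (\<Sum>m. zeta_rem 1 m s)"
    unfolding zeta_num_eq[OF less_le_trans[OF half_gt_zero[OF zero_less_one] s]]
    by (rule norm_triangle_ineq)
  then show "norm (zeta_num s) \<le> 1 + C * norm s * norm (s - 1)" using * by simp
qed

section \<open>The Euler product and zeros on the line of real part one\<close>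

lemma has_sum_of_nat_powr:
  assumes "Re s > 1"
  shows "((\<lambda>n. of_nat n powr (- s)) has_sum riemann_zeta s) {1..}"
proof -
  have "summable (\<lambda>n. norm (of_nat (Suc n) powr (- s) :: complex))"
    using summable_Suc_powr[OF assms] unfolding norm_of_nat_powr by simp
  then have "((\<lambda>n. of_nat (Suc n) powr (- s)) has_sum riemann_zeta s) UNIV"
    using riemann_zeta_series[OF assms] by (rule norm_summable_imp_has_sum)
  then have "((\<lambda>n. of_nat n powr (- s)) has_sum riemann_zeta s) (Suc ` UNIV)"
    by (subst has_sum_reindex) (auto simp: o_def)
  moreover have "Suc ` UNIV = {1..}" by (auto simp: image_iff Suc_le_eq gr0_conv_Suc)
  ultimately show ?thesis by simp
qed

lemma powr_abs_summable:
  assumes "Re s > 1"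
  shows "(\<lambda>n. norm (of_nat n powr (- s) :: complex)) summable_on {1..}"
proof -
  have "(\<lambda>n. of_nat n powr (- s) :: complex) summable_on {1..}"
    using has_sum_of_nat_powr[OF assms] by (auto simp: summable_on_def)
  then show ?thesis by (simp only: summable_on_iff_abs_summable_on_complex)
qed

lemma of_nat_mult_powr:
  "(of_nat (a * b) powr s :: complex) = of_nat a powr s * of_nat b powr s"
  by (simp add: powr_times_real)

text \<open>Sieving by one more prime \<open>q\<close> removes the multiples of \<open>q\<close> from the
remaining set, and these are \<open>q\<close> times that set. So each prime contributes one Euler
factor, for finitely many primes at a time.\<close>

lemma euler_sieve:
  assumes s: "Re s > 1" and "finite A" and "\<And>p. p \<in> A \<Longrightarrow> prime p"
  shows "((\<lambda>n. of_nat n powr (- s)) has_sum (riemann_zeta s * (\<Prod>p\<in>A. 1 - of_nat p powr (- s))))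
    {n::nat. n \<ge> 1 \<and> (\<forall>p\<in>A. \<not> p dvd n)}"
  using assms(2,3)
proof (induction A rule: finite_induct)
  case empty
  then show ?case using has_sum_of_nat_powr[OF s] by (simp add: atLeast_def)
next
  case (insert q A)
  define N where "N = {n::nat. n \<ge> 1 \<and> (\<forall>p\<in>A. \<not> p dvd n)}"
  define Z where "Z = riemann_zeta s * (\<Prod>p\<in>A. 1 - of_nat p powr (- s))"
  have q: "prime q" using insert.prems by auto
  have IH: "((\<lambda>n. of_nat n powr (- s)) has_sum Z) N"
    unfolding N_def Z_def using insert by blast
  have "((\<lambda>n. of_nat q powr (- s) * of_nat n powr (- s)) has_sum (of_nat q powr (- s) * Z)) N"
    by (rule has_sum_cmult_right[OF IH])
  then have "((\<lambda>n. of_nat n powr (- s)) has_sum (of_nat q powr (- s) * Z)) ((*) q ` N)"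
    using q by (subst has_sum_reindex) (auto simp: o_def of_nat_mult_powr inj_on_def simp del: of_nat_mult)
  then have "((\<lambda>n. of_nat n powr (- s)) has_sum (Z - of_nat q powr (- s) * Z)) (N - (*) q ` N)"
  proof (rule has_sum_Diff[OF IH])
    show "(*) q ` N \<subseteq> N"
    proof
      fix m assume "m \<in> (*) q ` N"
      then obtain n where n: "m = q * n" "n \<in> N" by auto
      have "\<not> p dvd q * n" if p: "p \<in> A" for p
      proof -
        have "p \<noteq> q" "prime p" using p insert by auto
        then show ?thesis
          using n p q by (auto simp: N_def prime_dvd_mult_iff primes_dvd_imp_eq)
      qed
      then show "m \<in> N" using n q by (auto simp: N_def prime_gt_0_nat Suc_le_eq)
    qed
  qed
  also have "N - (*) q ` N = {n. n \<ge> 1 \<and> (\<forall>p\<in>insert q A. \<not> p dvd n)}"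
  proof -
    have "n \<in> (*) q ` N \<longleftrightarrow> q dvd n" if "n \<in> N" for n
      using that by (auto simp: N_def elim!: dvdE intro!: imageI)
    then show ?thesis by (auto simp: N_def)
  qed
  also have "Z - of_nat q powr (- s) * Z = riemann_zeta s * (\<Prod>p\<in>insert q A. 1 - of_nat p powr (- s))"
    using insert by (simp add: Z_def algebra_simps)
  finally show ?case .
qed

text \<open>After sieving by all primes up to \<open>N\<close>, every remaining number other than 1 exceeds
\<open>N\<close>, so the sieved sum differs from 1 by a tail of a convergent series.\<close>

lemma euler_product:
  assumes s: "Re s > 1"
  shows "(\<lambda>N. riemann_zeta s * (\<Prod>p | prime p \<and> p \<le> N. 1 - of_nat p powr (- s))) \<longlonglongrightarrow> 1"
proof -
  define E where "E = (\<lambda>N. riemann_zeta s * (\<Prod>p | prime p \<and> p \<le> N. 1 - of_nat p powr (- s)))"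
  define f where "f = (\<lambda>n. real (Suc n) powr (- Re s))"
  have sf: "summable f" unfolding f_def by (rule summable_Suc_powr[OF s])
  have bound: "norm (E N - 1) \<le> (\<Sum>n. f (n + N))" for N
  proof -
    define A where "A = {p::nat. prime p \<and> p \<le> N}"
    define M where "M = {n::nat. n \<ge> 1 \<and> (\<forall>p\<in>A. \<not> p dvd n)}"
    have finA: "finite A" by (simp add: A_def)
    have 1: "((\<lambda>n. of_nat n powr (- s)) has_sum E N) M"
      unfolding E_def M_def using euler_sieve[OF s finA] by (simp add: A_def)
    have "((\<lambda>n. of_nat n powr (- s)) has_sum (E N - of_nat 1 powr (- s))) (M - {1})"
      by (rule has_sum_Diff[OF 1]) (auto simp: M_def A_def intro: has_sum_finiteI)
    then have 2: "((\<lambda>n. of_nat n powr (- s)) has_sum (E N - 1)) (M - {1})" by simp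
    have "((\<lambda>n. f (n + N)) has_sum (\<Sum>n. f (n + N))) UNIV"
      using summable_ignore_initial_segment[OF sf, of N]
      by (intro sums_nonneg_imp_has_sum summable_sums) (auto simp: f_def)
    then have 3: "((\<lambda>n. real n powr (- Re s)) has_sum (\<Sum>n. f (n + N))) ((\<lambda>n. Suc (n + N)) ` UNIV)"
      by (subst has_sum_reindex) (auto simp: o_def f_def inj_on_def)
    have sub: "M - {1} \<subseteq> (\<lambda>n. Suc (n + N)) ` UNIV"
    proof
      fix n assume n: "n \<in> M - {1}"
      then have "n \<noteq> 1" by auto
      then obtain p where p: "prime p" "p dvd n" using prime_factor_nat by blast
      with n have "p > N" by (auto simp: M_def A_def)
      moreover have "p \<le> n" using p n by (intro dvd_imp_le) (auto simp: M_def)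
      ultimately show "n \<in> (\<lambda>n. Suc (n + N)) ` UNIV"
        by (intro image_eqI[of _ _ "n - Suc N"]) auto
    qed
    have 4: "(\<lambda>n. norm (of_nat n powr (- s) :: complex)) summable_on M - {1}"
      unfolding norm_of_nat_powr uminus_complex.simps
      by (rule summable_on_subset_banach[OF has_sum_imp_summable[OF 3] sub])
    have "norm (E N - 1) \<le> (\<Sum>\<^sub>\<infinity>n\<in>M - {1}. norm (of_nat n powr (- s) :: complex))"
      using norm_infsum_bound[OF 4] infsumI[OF 2] by simp
    also have "\<dots> \<le> (\<Sum>n. f (n + N))"
    proof -
      have "(\<Sum>\<^sub>\<infinity>n\<in>M - {1}. norm (of_nat n powr (- s) :: complex))
        \<le> (\<Sum>\<^sub>\<infinity>n\<in>(\<lambda>n. Suc (n + N)) ` UNIV. real n powr (- Re s))"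
        using 3 4 sub
        by (intro infsum_mono_neutral) (auto simp: norm_of_nat_powr summable_on_def)
      then show ?thesis using infsumI[OF 3] by simp
    qed
    finally show ?thesis .
  qed
  have "(\<lambda>N. \<Sum>n. f (n + N)) \<longlonglongrightarrow> 0"
    by (rule suminf_exist_split2[OF sf])
  then have "(\<lambda>N. E N - 1) \<longlonglongrightarrow> 0"
    by (rule Lim_null_comparison[rotated]) (auto intro!: always_eventually bound)
  then show ?thesis by (simp add: E_def LIM_zero_iff)
qed

text \<open>Expanding the logarithms into power series, the coefficient of \<open>r ^ n\<close> in the logarithm
of the product is \<open>- 1 / n\<close> times
\<open>3 + 4 cos \<theta> + cos (2 \<theta>) = 2 (1 + cos \<theta>)\<^sup>2\<close>, where
\<open>\<theta>\<close> is the argument of \<open>u ^ n\<close>.\<close>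

lemma three_four_one_local:
  fixes r :: real and u :: complex
  assumes r: "0 \<le> r" "r < 1" and u: "norm u = 1"
  shows "norm (1 - of_real r :: complex) ^ 3 * norm (1 - of_real r * u) ^ 4 * norm (1 - of_real r * u\<^sup>2) \<le> 1"
proof -
  have S: "(\<lambda>n. - Re (w ^ n) / real n) sums ln (norm (1 - w))" if w: "norm w < 1" for w :: complex
  proof -
    have "1 - w \<noteq> 0" using w by auto
    moreover have "(\<lambda>n. - ((-(-w)) ^ n) / of_nat n) sums ln (1 + (- w))"
      by (rule Ln_series') (use w in simp)
    then have "(\<lambda>n. Re (- (w ^ n) / of_nat n)) sums Re (ln (1 - w))"
      by (intro sums_Re) simp
    ultimately show ?thesis by simp
  qed
  have nz: "1 - w \<noteq> 0" if "norm w < 1" for w :: complex using that by auto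
  have w: "norm (complex_of_real r) < 1" "norm (of_real r * u) < 1" "norm (of_real r * u\<^sup>2) < 1"
    using r u by (auto simp: norm_mult norm_power)
  have "(\<lambda>n. 3 * (- Re (of_real r ^ n) / real n) + 4 * (- Re ((of_real r * u) ^ n) / real n)
       + (- Re ((of_real r * u\<^sup>2) ^ n) / real n))
     sums (3 * ln (norm (1 - of_real r :: complex)) + 4 * ln (norm (1 - of_real r * u)) + ln (norm (1 - of_real r * u\<^sup>2)))"
    by (intro sums_add sums_mult S w)
  moreover have "3 * (- Re (of_real r ^ n) / real n) + 4 * (- Re ((of_real r * u) ^ n) / real n)
       + (- Re ((of_real r * u\<^sup>2) ^ n) / real n) \<le> 0" for n
  proof -
    define v where "v = u ^ n"
    have "(Re v)\<^sup>2 + (Im v)\<^sup>2 = 1"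
      using u by (simp add: v_def norm_power flip: cmod_power2)
    then have Re2: "Re (v\<^sup>2) = 2 * (Re v)\<^sup>2 - 1" by (simp add: power2_eq_square)
    have e1: "(of_real r * u) ^ n = of_real (r ^ n) * v" "(of_real r * u\<^sup>2) ^ n = of_real (r ^ n) * v\<^sup>2"
      by (simp_all add: v_def power_mult_distrib flip: power_mult) (simp add: mult.commute)
    have mult_of_real_Re: "Re (of_real a * w) = a * Re w" for a w by simp
    have e2: "complex_of_real r ^ n = of_real (r ^ n)" by simp
    have "3 * (- Re (of_real r ^ n) / real n) + 4 * (- Re ((of_real r * u) ^ n) / real n)
       + (- Re ((of_real r * u\<^sup>2) ^ n) / real n) = - (r ^ n / real n * (2 * (1 + Re v)\<^sup>2))"
      unfolding e1 e2 mult_of_real_Re Re2 Re_complex_of_real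
      by (cases "n = 0") (simp_all add: field_simps power2_eq_square)
    also have "\<dots> \<le> 0" using r by simp
    finally show ?thesis .
  qed
  ultimately have "3 * ln (norm (1 - of_real r :: complex)) + 4 * ln (norm (1 - of_real r * u)) + ln (norm (1 - of_real r * u\<^sup>2)) \<le> 0"
    by (metis (no_types, lifting) sums_le sums_zero)
  moreover have "ln (norm (1 - of_real r :: complex) ^ 3 * norm (1 - of_real r * u) ^ 4 * norm (1 - of_real r * u\<^sup>2))
     = 3 * ln (norm (1 - of_real r :: complex)) + 4 * ln (norm (1 - of_real r * u)) + ln (norm (1 - of_real r * u\<^sup>2))"
    using nz[OF w(1)] nz[OF w(2)] nz[OF w(3)] by (simp add: ln_mult ln_realpow)
  ultimately show ?thesis
    using nz[OF w(1)] nz[OF w(2)] nz[OF w(3)] by (metis ln_le_zero_iff zero_less_mult_iff zero_less_norm_iff zero_less_power)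
qed

lemma three_four_one:
  assumes "x > 1"
  shows "norm (riemann_zeta (of_real x)) ^ 3 * norm (riemann_zeta (Complex x t)) ^ 4
       * norm (riemann_zeta (Complex x (2 * t))) \<ge> 1"
proof -
  define P where "P = (\<lambda>N. {p::nat. prime p \<and> p \<le> N})"
  define e where "e = (\<lambda>s N. riemann_zeta s * (\<Prod>p\<in>P N. 1 - of_nat p powr (- s)))"
  define Z where "Z = norm (riemann_zeta (of_real x)) ^ 3 * norm (riemann_zeta (Complex x t)) ^ 4
       * norm (riemann_zeta (Complex x (2 * t)))"
  have lim: "(\<lambda>N. norm (e (of_real x) N) ^ 3 * norm (e (Complex x t) N) ^ 4 * norm (e (Complex x (2 * t)) N))
     \<longlonglongrightarrow> norm (1::complex) ^ 3 * norm (1::complex) ^ 4 * norm (1::complex)"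
    unfolding e_def P_def using assms by (intro tendsto_intros euler_product) auto
  have "norm (e (of_real x) N) ^ 3 * norm (e (Complex x t) N) ^ 4 * norm (e (Complex x (2 * t)) N) \<le> Z" for N
  proof -
    have loc: "norm (1 - of_nat p powr (- of_real x) :: complex) ^ 3 * norm (1 - of_nat p powr (- Complex x t)) ^ 4
        * norm (1 - of_nat p powr (- Complex x (2 * t))) \<le> 1" if "p \<in> P N" for p
    proof -
      define u where "u = (of_nat p :: complex) powr (- (\<i> * of_real t))"
      have p: "p \<ge> 2" using that by (auto simp: P_def prime_ge_2_nat)
      have u: "norm u = 1" using p by (simp add: u_def norm_of_nat_powr)
      have r: "(of_nat p :: complex) powr (- of_real x) = of_real (real p powr (- x))"
        using powr_of_real[of "real p" "-x"] by simp
      have 1: "(of_nat p :: complex) powr (- Complex x t) = of_real (real p powr (- x)) * u"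
        using p by (simp add: u_def r[symmetric] Complex_eq flip: powr_add)
      have 2: "(of_nat p :: complex) powr (- Complex x (2 * t)) = of_real (real p powr (- x)) * u\<^sup>2"
        using p by (simp add: u_def r[symmetric] Complex_eq power2_eq_square algebra_simps flip: powr_add)
      have "real p powr (- x) < 1" using p assms by (simp add: powr_less_one)
      then show ?thesis unfolding r 1 2 using u by (intro three_four_one_local) auto
    qed
    have "norm (e (of_real x) N) ^ 3 * norm (e (Complex x t) N) ^ 4 * norm (e (Complex x (2 * t)) N)
       = Z * (\<Prod>p\<in>P N. norm (1 - of_nat p powr (- of_real x) :: complex) ^ 3 * norm (1 - of_nat p powr (- Complex x t)) ^ 4
        * norm (1 - of_nat p powr (- Complex x (2 * t))))"
      unfolding e_def Z_def norm_mult prod.distrib prod_norm[symmetric] power_mult_distrib prod_power_distrib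
      by (simp only: mult_ac)
    also have "\<dots> \<le> Z * 1"
      by (intro mult_left_mono prod_le_1) (auto simp: Z_def loc)
    finally show ?thesis by simp
  qed
  then show ?thesis
    using LIMSEQ_le_const2[OF lim] unfolding Z_def by auto
qed

lemma riemann_zeta_nonzero_right: "Re s > 1 \<Longrightarrow> riemann_zeta s \<noteq> 0"
  using euler_product[of s] by (auto simp: LIMSEQ_const_iff)

text \<open>If zeta vanished at \<open>1 + i t\<close>, the product in the previous inequality would have a zero
of order at least four against a pole of order three as \<open>x\<close> tends to 1, hence tend to
0, while it is at least 1.\<close>

lemma riemann_zeta_nonzero_line:
  assumes "t \<noteq> 0" shows "riemann_zeta (Complex 1 t) \<noteq> 0"
proof
  assume z: "riemann_zeta (Complex 1 t) = 0"
  have hol: "riemann_zeta field_differentiable (at s)" if "s \<noteq> 1" for s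
    using riemann_zeta_characterisation(1) that
    by (intro holomorphic_on_imp_differentiable_at[of _ "- {1}"]) auto
  have ne: "Complex 1 t \<noteq> 1" "Complex 1 (2 * t) \<noteq> 1" using assms by (auto simp: complex_eq_iff)
  have pth: "((\<lambda>h::real. Complex (1 + h) t) \<longlongrightarrow> Complex 1 t) (at_right 0)" for t
    by (rule tendsto_eq_intros refl | simp)+
  obtain D where D: "(riemann_zeta has_field_derivative D) (at (Complex 1 t))"
    using hol[OF ne(1)] by (auto simp: field_differentiable_def)
  have "((\<lambda>w. (riemann_zeta w - riemann_zeta (Complex 1 t)) / (w - Complex 1 t)) \<longlongrightarrow> D) (at (Complex 1 t))"
    using D by (simp add: has_field_derivative_iff)
  moreover have "filterlim (\<lambda>h::real. Complex (1 + h) t) (at (Complex 1 t)) (at_right 0)"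
    using pth[of t] by (auto simp: filterlim_at complex_eq_iff eventually_at_filter)
  ultimately have "((\<lambda>h::real. (riemann_zeta (Complex (1 + h) t) - riemann_zeta (Complex 1 t)) /
       (Complex (1 + h) t - Complex 1 t)) \<longlongrightarrow> D) (at_right 0)"
    by (rule filterlim_compose)
  moreover have "Complex (1 + h) t - Complex 1 t = of_real h" for h
    by (simp add: complex_eq_iff)
  ultimately have 2: "((\<lambda>h::real. riemann_zeta (Complex (1 + h) t) / of_real h) \<longlongrightarrow> D) (at_right 0)"
    using z by simp
  have "isCont riemann_zeta (Complex 1 (2 * t))"
    using hol[OF ne(2)] by (rule field_differentiable_imp_continuous_at)
  then have 3: "((\<lambda>h::real. riemann_zeta (Complex (1 + h) (2 * t))) \<longlongrightarrow> riemann_zeta (Complex 1 (2 * t))) (at_right 0)"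
    using pth by (rule isCont_tendsto_compose)
  have "continuous_on {s. Re s > 0} zeta_num"
    using zeta_num_holomorphic by (rule holomorphic_on_imp_continuous_on)
  then have "isCont zeta_num 1"
    by (rule continuous_on_interior) (simp add: interior_open open_Re_gt)
  moreover have "((\<lambda>h::real. Complex (1 + h) 0) \<longlongrightarrow> 1) (at_right 0)"
    using pth[of 0] by (simp only: one_complex.code[symmetric])
  ultimately have 1: "((\<lambda>h::real. zeta_num (Complex (1 + h) 0)) \<longlongrightarrow> zeta_num 1) (at_right 0)"
    by (rule isCont_tendsto_compose)
  have "((\<lambda>h::real. norm (zeta_num (Complex (1 + h) 0)) ^ 3 * norm (riemann_zeta (Complex (1 + h) t) / of_real h) ^ 4
     * norm (riemann_zeta (Complex (1 + h) (2 * t))) * h)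
     \<longlongrightarrow> norm (zeta_num 1) ^ 3 * norm D ^ 4 * norm (riemann_zeta (Complex 1 (2 * t))) * 0) (at_right 0)"
    by (intro tendsto_intros 1 2 3)
  moreover have "eventually (\<lambda>h::real. norm (zeta_num (Complex (1 + h) 0)) ^ 3 * norm (riemann_zeta (Complex (1 + h) t) / of_real h) ^ 4
     * norm (riemann_zeta (Complex (1 + h) (2 * t))) * h \<ge> 1) (at_right 0)"
    using eventually_at_right_less[of 0]
  proof eventually_elim
    case (elim h)
    have "zeta_num (Complex (1 + h) 0) = of_real h * riemann_zeta (of_real (1 + h))"
      using elim by (simp add: zeta_num_def complex_eq_iff complex_of_real_def)
    then have "norm (zeta_num (Complex (1 + h) 0)) = h * norm (riemann_zeta (of_real (1 + h)))"
      using elim by (simp add: norm_mult)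
    moreover have "norm (riemann_zeta (Complex (1 + h) t) / of_real h) = norm (riemann_zeta (Complex (1 + h) t)) / h"
      using elim by (simp add: norm_divide)
    moreover have "(h * a) ^ 3 * (b / h) ^ 4 * c * h = a ^ 3 * b ^ 4 * c" for a b c :: real
      using elim by (simp add: power_mult_distrib power_divide field_simps power4_eq_xxxx power3_eq_cube)
    ultimately show ?case using three_four_one[of "1 + h" t] elim by (simp only:)
  qed
  ultimately have "(1::real) \<le> 0"
    using tendsto_lowerbound[of _ "norm (zeta_num 1) ^ 3 * norm D ^ 4 * norm (riemann_zeta (Complex 1 (2 * t))) * 0" "at_right (0::real)" 1] by simp
  then show False by simp
qed

text \<open>The hypothesis covers the open critical strip, so the line of real part one and the half-plane of
convergence need the two preceding results.\<close>

lemma zeta_num_nonzero: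
  assumes riemann_hypothesis and s: "Re s > 1 / 2"
  shows "zeta_num s \<noteq> 0"
proof (cases "s = 1")
  case False
  have "riemann_zeta s \<noteq> 0"
  proof (cases "Re s" "1::real" rule: linorder_cases)
    case less
    then show ?thesis using assms by (force simp: riemann_hypothesis_def)
  next
    case equal
    then show ?thesis using riemann_zeta_nonzero_line[of "Im s"] False
      by (metis complex.collapse one_complex.code)
  next
    case greater
    then show ?thesis by (rule riemann_zeta_nonzero_right)
  qed
  then show ?thesis using False by (simp add: zeta_num_def)
qed (simp add: zeta_num_def)

section \<open>The Moebius function\<close>

definition moebius_mu :: "nat \<Rightarrow> real" where
  "moebius_mu n = (if squarefree n then (-1) ^ card (prime_factors n) else 0)"

lemma moebius_mu_0 [simp]: "moebius_mu 0 = 0" by (simp add: moebius_mu_def)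
lemma moebius_mu_1 [simp]: "moebius_mu (Suc 0) = 1" by (simp add: moebius_mu_def)

lemma abs_moebius_mu_le: "\<bar>moebius_mu n\<bar> \<le> 1"
  by (simp add: moebius_mu_def power_abs)

lemma moebius_mu_prime_mult:
  assumes p: "prime p" and n: "\<not> p dvd n"
  shows "moebius_mu (p * n) = - moebius_mu n"
proof -
  have cop: "coprime p n" using p n by (simp add: prime_imp_coprime)
  have n0: "n \<noteq> 0" using n by (intro notI) simp
  have "squarefree (p * n) \<longleftrightarrow> squarefree n"
    using squarefree_mult_coprime[OF cop squarefree_prime[OF p]] squarefree_multD(2) by blast
  moreover have "prime_factors (p * n) = insert p (prime_factors n)"
    using p n0 by (subst prime_factors_product) (auto simp: prime_prime_factors)
  moreover have "p \<notin> prime_factors n" using n by (auto simp: prime_factors_dvd)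
  ultimately show ?thesis by (simp add: moebius_mu_def)
qed

text \<open>For a prime \<open>p\<close> dividing \<open>n\<close>, the map \<open>d \<mapsto> p * d\<close>
pairs the divisors that \<open>p\<close> does not divide with divisors of opposite sign. The
divisors outside these pairs are divisible by \<open>p\<^sup>2\<close>.\<close>

lemma sum_moebius_mu_divisors:
  assumes "n > 0"
  shows "(\<Sum>d | d dvd n. moebius_mu d) = (if n = 1 then 1 else 0)"
proof (cases "n = 1")
  case False
  then obtain p where p: "prime p" "p dvd n" using prime_factor_nat by blast
  define A where "A = {d. d dvd n \<and> \<not> p dvd d}"
  define B where "B = (*) p ` A"
  have fin: "finite {d. d dvd n}" using assms by (simp add: finite_divisors_nat)
  have sub: "A \<union> B \<subseteq> {d. d dvd n}"
  proof
    fix d assume "d \<in> A \<union> B"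
    then consider "d \<in> A" | e where "d = p * e" "e \<in> A" by (auto simp: B_def)
    then show "d \<in> {d. d dvd n}"
    proof cases
      case 2
      then have "coprime p e" using p by (simp add: A_def prime_imp_coprime)
      then have "p * e dvd n" using p 2 by (simp add: A_def divides_mult)
      then show ?thesis using 2 by simp
    qed (simp add: A_def)
  qed
  have AB: "finite A" "finite B" "A \<inter> B = {}"
    using finite_subset[OF _ fin] sub by (blast, blast, auto simp: A_def B_def)
  have "moebius_mu d = 0" if d: "d \<in> {d. d dvd n} - (A \<union> B)" for d
  proof -
    from d have "p dvd d" by (auto simp: A_def)
    then obtain e where e: "d = p * e" by auto
    have "e dvd n" using d e by (auto intro: dvd_trans[of e d])
    moreover have "e \<notin> A" using d e by (auto simp: B_def)
    ultimately have "p dvd e" by (simp add: A_def)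
    then have "p ^ 2 dvd d" using e by (simp add: power2_eq_square)
    moreover have "\<not> p dvd 1" using p by (simp add: prime_nat_iff)
    ultimately have "\<not> squarefree d" by (rule not_squarefreeI)
    then show ?thesis by (simp add: moebius_mu_def)
  qed
  then have "(\<Sum>d | d dvd n. moebius_mu d) = (\<Sum>d\<in>A \<union> B. moebius_mu d)"
    using sub fin by (intro sum.mono_neutral_right) auto
  also have "\<dots> = (\<Sum>d\<in>A. moebius_mu d) + (\<Sum>d\<in>B. moebius_mu d)"
    by (rule sum.union_disjoint[OF AB])
  also have "(\<Sum>d\<in>B. moebius_mu d) = (\<Sum>d\<in>A. moebius_mu (p * d))"
    unfolding B_def using p by (subst sum.reindex) (auto simp: inj_on_def)
  also have "\<dots> = - (\<Sum>d\<in>A. moebius_mu d)"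
    using p by (subst sum_negf[symmetric], intro sum.cong) (auto simp: A_def moebius_mu_prime_mult)
  finally show ?thesis using False by simp
qed simp

text \<open>The Dirichlet product of the two series, summed over pairs \<open>(d, k)\<close> and then regrouped
by \<open>n = d * k\<close>, collapses to the term \<open>n = 1\<close>.\<close>

lemma moebius_mu_dirichlet_series:
  assumes s: "Re s > 1"
  shows "((\<lambda>n. of_real (moebius_mu n) * of_nat n powr (- s)) has_sum (1 / riemann_zeta s)) {1..}"
proof -
  define f where "f = (\<lambda>n. of_real (moebius_mu n) * of_nat n powr (- s) :: complex)"
  define g where "g = (\<lambda>n. of_nat n powr (- s) :: complex)"
  define M where "M = (\<Sum>\<^sub>\<infinity>n\<in>{1..}. f n)"
  have absf: "(\<lambda>n. norm (f n)) summable_on {1..}"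
    by (rule Infinite_Sum.abs_summable_on_comparison_test[OF powr_abs_summable[OF s]])
       (auto simp: f_def norm_mult intro!: mult_left_le_one_le abs_moebius_mu_le)
  have M: "(f has_sum M) {1..}"
    unfolding M_def using Infinite_Sum.abs_summable_summable[OF absf] by (rule has_sum_infsum)
  have absg: "(\<lambda>n. norm (g n)) summable_on {1..}" unfolding g_def by (rule powr_abs_summable[OF s])
  have g: "(g has_sum riemann_zeta s) {1..}" unfolding g_def by (rule has_sum_of_nat_powr[OF s])
  have "(\<lambda>x. norm (case x of (d, k) \<Rightarrow> f d * g k)) summable_on {1..} \<times> {1..}"
  proof (rule Infinite_Sum.abs_summable_on_Sigma_iff[THEN iffD2], intro conjI ballI)
    fix d :: nat
    show "(\<lambda>k. norm (case (d, k) of (d, k) \<Rightarrow> f d * g k)) summable_on {1..}"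
      using absg by (auto simp: norm_mult intro!: summable_on_cmult_right)
  next
    have "(\<lambda>d. norm (f d) * (\<Sum>\<^sub>\<infinity>k\<in>{1..}. norm (g k))) summable_on {1..}"
      using absf by (rule summable_on_cmult_left)
    moreover have "0 \<le> (\<Sum>\<^sub>\<infinity>k\<in>{1..}. norm (g k))" by (rule infsum_nonneg) simp
    ultimately show "(\<lambda>d. norm (\<Sum>\<^sub>\<infinity>k\<in>{1..}. norm (case (d, k) of (d, k) \<Rightarrow> f d * g k))) summable_on {1..}"
      by (simp add: norm_mult infsum_cmult_right')
  qed
  then have summ: "(\<lambda>(d, k). f d * g k) summable_on {1..} \<times> {1..}" by (rule Infinite_Sum.abs_summable_summable)
  have 1: "((\<lambda>(d, k). f d * g k) has_sum (M * riemann_zeta s)) ({1..} \<times> {1..})"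
  proof (rule has_sum_SigmaI[where g = "\<lambda>d. f d * riemann_zeta s"])
    show "((\<lambda>d. f d * riemann_zeta s) has_sum M * riemann_zeta s) {1..}"
      by (rule has_sum_cmult_left[OF M])
  qed (use summ g in \<open>auto intro: has_sum_cmult_right\<close>)
  have 2: "((\<lambda>(n, d). of_real (moebius_mu d) * of_nat n powr (- s)) has_sum (M * riemann_zeta s))
     (Sigma {1..} (\<lambda>n. {d. d dvd n}))"
    using 1
    by (subst has_sum_reindex_bij_witness[of _ "\<lambda>(d, k). (d * k, d)" "\<lambda>(n, d). (d, n div d)" "{1..} \<times> {1..}"
          "\<lambda>(d, k). f d * g k", OF _ _ _ _ _ refl])
       (auto simp: f_def g_def of_nat_mult_powr Suc_le_eq div_greater_zero_iff intro: dvd_imp_le dvd_pos_nat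
          simp del: of_nat_mult)
  have 3: "((\<lambda>n. if n = 1 then 1 else 0) has_sum (M * riemann_zeta s)) {1::nat..}"
  proof (rule has_sum_SigmaD[OF 2])
    fix n :: nat assume n: "n \<in> {1..}"
    have "(\<Sum>d | d dvd n. of_real (moebius_mu d) * of_nat n powr (- s))
      = of_real (\<Sum>d | d dvd n. moebius_mu d) * (of_nat n powr (- s) :: complex)"
      by (simp add: sum_distrib_right)
    also have "\<dots> = (if n = 1 then 1 else 0)"
      using n by (subst sum_moebius_mu_divisors) auto
    finally show "((\<lambda>d. case (n, d) of (n, d) \<Rightarrow> of_real (moebius_mu d) * of_nat n powr (- s))
       has_sum (if n = 1 then 1 else (0::complex))) {d. d dvd n}"
      using n by (intro has_sum_finiteI) (auto simp: finite_divisors_nat)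
  qed
  have "((\<lambda>n. if n = 1 then 1 else 0) has_sum (1::complex)) {1::nat}"
    by (rule has_sum_finiteI) auto
  then have "((\<lambda>n. if n = 1 then 1 else 0) has_sum (1::complex)) {1::nat..}"
    by (rule has_sum_cong_neutral[THEN iffD1, rotated -1]) auto
  then have "M * riemann_zeta s = 1" using 3 has_sum_unique by blast
  then have "M = 1 / riemann_zeta s" by (metis mult_zero_right nonzero_eq_divide_eq zero_neq_one)
  then show ?thesis using M by (simp add: f_def)
qed

section \<open>Littlewood's bound for the reciprocal of zeta\<close>

lemma zeta_bounds_right:
  obtains B where "B > 0" "\<And>s. Re s \<ge> 2 \<Longrightarrow> norm (riemann_zeta s) \<le> B"
    "\<And>s. Re s \<ge> 2 \<Longrightarrow> norm (1 / riemann_zeta s) \<le> B"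
proof -
  have "(\<lambda>n. norm (of_nat n powr (- 2) :: complex)) summable_on {1..}"
    by (rule powr_abs_summable) simp
  then have "(\<lambda>n. real n powr (- 2)) summable_on {1..}"
    by (simp add: norm_of_nat_powr)
  then obtain B where B: "((\<lambda>n. real n powr (- 2)) has_sum B) {1..}"
    by (auto simp: summable_on_def)
  have pw: "real n powr (- Re s) \<le> real n powr (- 2)" if "n \<in> {1..}" "Re s \<ge> 2" for n :: nat and s
    using that by (intro powr_mono) auto
  have 1: "norm (riemann_zeta s) \<le> B" if "Re s \<ge> 2" for s
    by (rule norm_infsum_le[OF has_sum_of_nat_powr B]) (use that pw in \<open>auto simp: norm_of_nat_powr\<close>)
  have 2: "norm (1 / riemann_zeta s) \<le> B" if "Re s \<ge> 2" for s
  proof (rule norm_infsum_le[OF moebius_mu_dirichlet_series B])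
    fix n :: nat assume n: "n \<in> {1..}"
    have "norm (of_real (moebius_mu n) * of_nat n powr (- s) :: complex) = \<bar>moebius_mu n\<bar> * real n powr (- Re s)"
      by (simp add: norm_mult norm_of_nat_powr)
    also have "\<dots> \<le> 1 * real n powr (- 2)"
      using pw[OF n that] by (intro mult_mono abs_moebius_mu_le) auto
    finally show "norm (of_real (moebius_mu n) * of_nat n powr (- s) :: complex) \<le> real n powr (- 2)" by simp
  qed (use that in auto)
  have "B > 0"
  proof -
    have "0 < norm (riemann_zeta 2)" using riemann_zeta_nonzero_right[of 2] by simp
    also have "\<dots> \<le> B" by (rule 1) simp
    finally show ?thesis .
  qed
  then show ?thesis using 1 2 that by blast
qed

text \<open>To the right of 2 both zeta and its reciprocal are bounded, so \<open>zeta_num\<close> has the size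
of its factor \<open>s - 1\<close>.\<close>

lemma log_zeta_num_limit:
  fixes t :: "nat \<Rightarrow> real"
  assumes t: "filterlim (\<lambda>n. \<bar>t n\<bar>) at_top sequentially" and z: "Re z > 2"
  shows "(\<lambda>n. ln (norm (zeta_num (z + \<i> * of_real (t n)))) / ln \<bar>t n\<bar>) \<longlonglongrightarrow> 1"
proof -
  obtain B where B: "B > 0" "\<And>s. Re s \<ge> 2 \<Longrightarrow> norm (riemann_zeta s) \<le> B"
    "\<And>s. Re s \<ge> 2 \<Longrightarrow> norm (1 / riemann_zeta s) \<le> B"
    using zeta_bounds_right by blast
  define a where "a = norm z + 1"
  have ev: "eventually (\<lambda>n. \<bar>t n\<bar> > 2 * a + 2) sequentially"
    using t by (simp add: filterlim_at_top_dense)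
  have bnd: "ln (\<bar>t n\<bar> / 2 / B) / ln \<bar>t n\<bar> \<le> ln (norm (zeta_num (z + \<i> * of_real (t n)))) / ln \<bar>t n\<bar>
      \<and> ln (norm (zeta_num (z + \<i> * of_real (t n)))) / ln \<bar>t n\<bar> \<le> ln (2 * \<bar>t n\<bar> * B) / ln \<bar>t n\<bar>"
    if n: "\<bar>t n\<bar> > 2 * a + 2" for n
  proof -
    define s where "s = z + \<i> * of_real (t n)"
    have s: "Re s \<ge> 2" "s \<noteq> 1" using z by (auto simp: s_def complex_eq_iff)
    have a: "a \<ge> 1" by (simp add: a_def)
    have e: "norm (zeta_num s) = norm (s - 1) * norm (riemann_zeta s)"
      using s by (simp add: zeta_num_def norm_mult)
    have "norm (s - 1) \<le> norm (z - 1) + norm (\<i> * of_real (t n))"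
      unfolding s_def by (metis add.commute add_diff_eq norm_triangle_ineq)
    also have "\<dots> \<le> a + \<bar>t n\<bar>"
      using norm_triangle_ineq4[of z 1] by (simp add: a_def norm_mult)
    finally have u: "norm (s - 1) \<le> 2 * \<bar>t n\<bar>" using n a by simp
    have "norm (\<i> * of_real (t n)) \<le> norm (s - 1) + norm (z - 1)"
      unfolding s_def using norm_triangle_ineq4[of "z + \<i> * of_real (t n) - 1" "z - 1"] by simp
    then have l: "norm (s - 1) \<ge> \<bar>t n\<bar> / 2"
      using n norm_triangle_ineq4[of z 1] by (simp add: a_def norm_mult)
    have z0: "riemann_zeta s \<noteq> 0" using s by (intro riemann_zeta_nonzero_right) simp
    have l2: "norm (riemann_zeta s) \<ge> 1 / B"
      using B(3)[OF s(1)] z0 B(1) by (simp add: norm_divide field_simps)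
    have "norm (zeta_num s) \<le> 2 * \<bar>t n\<bar> * B"
      unfolding e using u B(2)[OF s(1)] by (intro mult_mono) auto
    moreover have "norm (zeta_num s) \<ge> \<bar>t n\<bar> / 2 * (1 / B)"
      unfolding e using l l2 B(1) by (intro mult_mono) auto
    moreover have "\<bar>t n\<bar> / 2 * (1 / B) > 0" using n a B(1) by simp
    moreover from calculation have "norm (zeta_num s) > 0" by linarith
    ultimately show ?thesis
      unfolding s_def[symmetric] using n a B(1)
      by (intro conjI divide_right_mono ln_le_cancel_iff[THEN iffD2]) auto
  qed
  have l1: "(\<lambda>n. ln (\<bar>t n\<bar> / 2 / B) / ln \<bar>t n\<bar>) \<longlonglongrightarrow> 1"
    by (rule filterlim_compose[OF _ t]) (use B(1) in real_asymp)
  have l2: "(\<lambda>n. ln (2 * \<bar>t n\<bar> * B) / ln \<bar>t n\<bar>) \<longlonglongrightarrow> 1"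
    by (rule filterlim_compose[OF _ t]) (use B(1) in real_asymp)
  show ?thesis
    by (rule tendsto_sandwich[OF _ _ l1 l2]) (use ev bnd in \<open>auto elim!: eventually_mono\<close>)
qed

text \<open>Littlewood's theorem, by a compactness argument. Suppose the bound fails along a sequence with
imaginary parts \<open>t n\<close>. The functions
\<open>h n z = zeta_num (z + \<i> * t n) powr (1 / ln \<bar>t n\<bar>)\<close> are holomorphic
because the zeros are excluded, and bounded because \<open>zeta_num\<close> grows polynomially. By
Montel's theorem a subsequence converges locally uniformly. The limit has modulus
\<open>exp 1\<close> to the right of 2, so by the maximum principle it is constant. Hence the
modulus of \<open>h n\<close> tends to \<open>exp 1\<close> uniformly on the segment from
\<open>1 / 2 + \<delta>\<close> to 1, which contradicts the failure.\<close>

lemma zeta_num_lower_bound: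
  assumes RH: riemann_hypothesis and \<delta>: "\<delta> > 0" and \<epsilon>: "\<epsilon> > 0"
  obtains T where "T \<ge> 1"
    "\<And>s. 1 / 2 + \<delta> \<le> Re s \<Longrightarrow> Re s \<le> 1 \<Longrightarrow> \<bar>Im s\<bar> \<ge> T \<Longrightarrow> norm (zeta_num s) \<ge> \<bar>Im s\<bar> powr (1 - \<epsilon>)"
proof (rule ccontr)
  assume no: "\<not> thesis"
  have "\<exists>s. 1 / 2 + \<delta> \<le> Re s \<and> Re s \<le> 1 \<and> \<bar>Im s\<bar> \<ge> real n + 6 \<and> norm (zeta_num s) < \<bar>Im s\<bar> powr (1 - \<epsilon>)" for n
  proof (rule ccontr)
    assume "\<not> ?thesis"
    then have "thesis" by (intro that[of "real n + 6"]) force+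
    with no show False by simp
  qed
  then obtain s where s: "\<And>n. 1 / 2 + \<delta> \<le> Re (s n)" "\<And>n. Re (s n) \<le> 1" "\<And>n. \<bar>Im (s n)\<bar> \<ge> real n + 6"
    "\<And>n. norm (zeta_num (s n)) < \<bar>Im (s n)\<bar> powr (1 - \<epsilon>)"
    by metis
  define t where "t = (\<lambda>n. Im (s n))"
  have t6: "\<bar>t n\<bar> \<ge> 6" for n using s(3)[of n] by (simp add: t_def)
  have lnt: "ln \<bar>t n\<bar> \<ge> 1" for n
  proof -
    have "exp 1 \<le> \<bar>t n\<bar>" using exp_le t6[of n] by linarith
    then show ?thesis using t6[of n] by (simp add: ln_ge_iff)
  qed
  have t: "filterlim (\<lambda>n. \<bar>t n\<bar>) at_top sequentially"
    by (rule filterlim_at_top_mono[OF filterlim_real_sequentially])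
       (intro always_eventually allI, unfold t_def, rule order_trans[OF _ s(3)], simp)
  define H where "H = {s. Re s > 1 / 2}"
  have H: "convex H" "open H"
    unfolding H_def by (rule convex_halfspace_Re_gt, rule open_Re_gt)
  have znH: "zeta_num holomorphic_on H"
    by (rule holomorphic_on_subset[OF zeta_num_holomorphic]) (auto simp: H_def)
  have nz: "zeta_num s \<noteq> 0" if "s \<in> H" for s
    using zeta_num_nonzero[OF RH, of s] that by (simp add: H_def)
  \<comment> \<open>A logarithm gives meaning to the power \<open>1 / ln \<bar>t n\<bar>\<close> in the definition of \<open>h\<close>.\<close>
  obtain L where L: "L holomorphic_on H" "\<And>s. s \<in> H \<Longrightarrow> exp (L s) = zeta_num s"
    by (rule holomorphic_logarithm_exists[OF H znH nz, of 2]) (auto simp: H_def)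
  have ReL: "Re (L s) = ln (norm (zeta_num s))" if "s \<in> H" for s
    using L(2)[OF that] by (metis ln_exp norm_exp_eq_Re)
  define h where "h = (\<lambda>n z. exp (L (z + \<i> * of_real (t n)) / of_real (ln \<bar>t n\<bar>)))"
  have inH: "z + \<i> * of_real (t n) \<in> H \<longleftrightarrow> z \<in> H" for z n by (simp add: H_def)
  have norm_h: "norm (h n z) = exp (ln (norm (zeta_num (z + \<i> * of_real (t n)))) / ln \<bar>t n\<bar>)" if "z \<in> H" for n z
    using ReL[of "z + \<i> * of_real (t n)"] that by (simp add: h_def inH)
  define S where "S = H \<inter> ball 0 5"
  have S: "open S" "connected S" using H by (auto simp: S_def intro!: convex_connected convex_Int)
  have holh: "h n holomorphic_on S" for n
  proof -
    have "(L \<circ> (\<lambda>z. z + \<i> * of_real (t n))) holomorphic_on S"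
      by (rule holomorphic_on_compose_gen[OF _ L(1)]) (auto intro!: holomorphic_intros simp: S_def inH)
    then show ?thesis unfolding h_def o_def by (intro holomorphic_intros) (use lnt[of n] in auto)
  qed
  obtain C where C: "C > 0" "\<And>s. Re s \<ge> 1 / 2 \<Longrightarrow> norm (zeta_num s) \<le> 1 + C * norm s * norm (s - 1)"
    using zeta_num_bound by blast
  have bound: "norm (h n z) \<le> exp (ln (1 + 4 * C) + 2)" if z: "z \<in> S" for n z
  proof -
    define w where "w = z + \<i> * of_real (t n)"
    have zH: "z \<in> H" "w \<in> H" using z by (auto simp: S_def w_def inH)
    have z5: "norm z < 5" using z by (simp add: S_def)
    have w1: "norm w \<le> 2 * \<bar>t n\<bar>"
      using norm_triangle_ineq[of z "\<i> * of_real (t n)"] z5 t6[of n] by (simp add: w_def norm_mult)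
    have "norm (w - 1) \<le> norm z + 1 + \<bar>t n\<bar>"
      using norm_triangle_ineq4[of w 1] norm_triangle_ineq[of z "\<i> * of_real (t n)"] by (simp add: w_def norm_mult)
    then have w2: "norm (w - 1) \<le> 2 * \<bar>t n\<bar>" using z5 t6[of n] by simp
    have "norm (zeta_num w) \<le> 1 + C * norm w * norm (w - 1)"
      using zH by (intro C(2)) (simp add: H_def)
    also have "\<dots> \<le> 1 + C * (2 * \<bar>t n\<bar>) * (2 * \<bar>t n\<bar>)"
      using w1 w2 C(1) by (intro add_left_mono mult_mono) auto
    also have "\<dots> \<le> (1 + 4 * C) * \<bar>t n\<bar> ^ 2"
    proof -
      have "1 \<le> \<bar>t n\<bar> ^ 2" using t6[of n] by (intro one_le_power) simp
      then show ?thesis by (simp add: algebra_simps power2_eq_square)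
    qed
    finally have "ln (norm (zeta_num w)) \<le> ln ((1 + 4 * C) * \<bar>t n\<bar> ^ 2)"
      using nz[OF zH(2)] by (subst ln_le_cancel_iff) (auto intro: less_le_trans[of 0 "norm (zeta_num w)"])
    also have "\<dots> = ln (1 + 4 * C) + 2 * ln \<bar>t n\<bar>"
    proof -
      have "ln ((1 + 4 * C) * x ^ 2) = ln (1 + 4 * C) + 2 * ln x" if "x > 0" for x :: real
        using C(1) that by (simp add: ln_mult ln_realpow)
      from this[of "\<bar>t n\<bar>"] show ?thesis using t6[of n] by simp
    qed
    finally have "ln (norm (zeta_num w)) / ln \<bar>t n\<bar> \<le> ln (1 + 4 * C) / ln \<bar>t n\<bar> + 2"
      using lnt[of n] by (simp add: field_simps)
    also have "ln (1 + 4 * C) / ln \<bar>t n\<bar> \<le> ln (1 + 4 * C) / 1"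
      using lnt[of n] C(1) by (intro divide_left_mono) auto
    finally show ?thesis using norm_h[OF zH(1), of n] by (simp add: w_def)
  qed
  obtain g r where g: "g holomorphic_on S" "strict_mono (r :: nat \<Rightarrow> nat)"
    "\<And>x. x \<in> S \<Longrightarrow> ((\<lambda>n. h (r n) x) \<longlonglongrightarrow> g x)"
    "\<And>K. compact K \<Longrightarrow> K \<subseteq> S \<Longrightarrow> uniform_limit K (h \<circ> r) g sequentially"
    by (rule Montel[OF S(1), of "range h" h]) (use holh bound S_def in blast)+
  have ge: "norm (g z) = exp 1" if z: "z \<in> S" "Re z > 2" for z
  proof (rule LIMSEQ_unique)
    show "(\<lambda>n. norm (h (r n) z)) \<longlonglongrightarrow> norm (g z)"
      by (intro tendsto_norm g z)
    have "(\<lambda>n. ln (norm (zeta_num (z + \<i> * of_real (t n)))) / ln \<bar>t n\<bar>) \<longlonglongrightarrow> 1"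
      by (rule log_zeta_num_limit[OF t z(2)])
    then have "(\<lambda>n. exp (ln (norm (zeta_num (z + \<i> * of_real (t n)))) / ln \<bar>t n\<bar>)) \<longlonglongrightarrow> exp 1"
      by (rule tendsto_exp)
    then have "(\<lambda>n. norm (h n z)) \<longlonglongrightarrow> exp 1"
      using z by (simp add: norm_h S_def)
    then show "(\<lambda>n. norm (h (r n) z)) \<longlonglongrightarrow> exp 1"
      using LIMSEQ_subseq_LIMSEQ[OF _ g(2)] by (auto simp: o_def)
  qed
  have "g constant_on S"
  proof (rule maximum_modulus_principle[OF g(1) S])
    show "open (S \<inter> {z. Re z > 2})" using S(1) open_Re_gt by blast
    show "3 \<in> S \<inter> {z. Re z > 2}" by (simp add: S_def H_def)
    show "norm (g z) \<le> norm (g 3)" if "z \<in> S \<inter> {z. Re z > 2}" for z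
      using that ge[of z] ge[of 3] by (simp add: S_def H_def)
  qed auto
  then have gS: "norm (g z) = exp 1" if "z \<in> S" for z
    using that ge[of 3] by (auto simp: constant_on_def S_def H_def)
  define K where "K = (of_real ` {1 / 2 + \<delta>..1} :: complex set)"
  have K: "compact K" "K \<subseteq> S"
    using \<delta> by (auto simp: K_def S_def H_def intro!: compact_continuous_image continuous_intros)
  have "exp 1 - exp (1 - \<epsilon>) > (0::real)" using \<epsilon> by simp
  from uniform_limitD[OF g(4)[OF K] this] obtain n
    where n: "\<And>z. z \<in> K \<Longrightarrow> dist (h (r n) z) (g z) < exp 1 - exp (1 - \<epsilon>)"
    by (auto simp: eventually_sequentially)
  define m where "m = r n"
  define z where "z = complex_of_real (Re (s m))"
  have z: "z \<in> K" "z \<in> S" using s(1,2)[of m] K(2) by (auto simp: z_def K_def)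
  have sm: "z + \<i> * of_real (t m) = s m" by (simp add: z_def t_def complex_eq_iff)
  have "ln (norm (zeta_num (s m))) \<le> ln (\<bar>t m\<bar> powr (1 - \<epsilon>))"
    using s(4)[of m] nz[of "s m"] s(1)[of m] \<delta> t6[of m]
    by (subst ln_le_cancel_iff) (auto simp: t_def H_def)
  also have "\<dots> = (1 - \<epsilon>) * ln \<bar>t m\<bar>" using t6[of m] by (simp add: ln_powr)
  finally have "norm (h m z) \<le> exp (1 - \<epsilon>)"
    using lnt[of m] z(2) by (simp add: norm_h S_def sm field_simps)
  moreover have "norm (g z) - norm (h m z) < exp 1 - exp (1 - \<epsilon>)"
    using n[OF z(1)] norm_triangle_ineq2[of "g z" "h m z"] by (simp add: m_def dist_norm norm_minus_commute)
  ultimately show False using gS[OF z(2)] by simp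
qed

text \<open>The reciprocal of zeta in a form that takes the value 0 at the pole of zeta.\<close>

definition inv_zeta :: "complex \<Rightarrow> complex" where
  "inv_zeta s = (s - 1) / zeta_num s"

lemma inv_zeta_eq: "Re s > 1 \<Longrightarrow> inv_zeta s = 1 / riemann_zeta s"
  by (auto simp: inv_zeta_def zeta_num_def)

lemma inv_zeta_holomorphic:
  "riemann_hypothesis \<Longrightarrow> inv_zeta holomorphic_on {s. Re s > 1 / 2}"
  unfolding inv_zeta_def using zeta_num_nonzero
  by (intro holomorphic_intros holomorphic_on_subset[OF zeta_num_holomorphic]) auto

text \<open>High up this is the bound just proved; near the real axis it is continuity on a compact rectangle.\<close>

lemma inv_zeta_bound:
  assumes RH: riemann_hypothesis and \<delta>: "\<delta> > 0" and \<epsilon>: "\<epsilon> > 0"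
  obtains C where "C > 0"
    "\<And>s. 1 / 2 + \<delta> \<le> Re s \<Longrightarrow> Re s \<le> 1 \<Longrightarrow> norm (inv_zeta s) \<le> C * (1 + \<bar>Im s\<bar>) powr \<epsilon>"
proof -
  obtain T where T: "T \<ge> 1"
    "\<And>s. 1 / 2 + \<delta> \<le> Re s \<Longrightarrow> Re s \<le> 1 \<Longrightarrow> \<bar>Im s\<bar> \<ge> T \<Longrightarrow> norm (zeta_num s) \<ge> \<bar>Im s\<bar> powr (1 - \<epsilon>)"
    using zeta_num_lower_bound[OF assms] by blast
  define K where "K = cbox (Complex (1 / 2 + \<delta>) (- T)) (Complex 1 T)"
  have "compact (inv_zeta ` K)"
    using \<delta> by (intro compact_continuous_image holomorphic_on_imp_continuous_on
        holomorphic_on_subset[OF inv_zeta_holomorphic[OF RH]]) (auto simp: K_def in_cbox_complex_iff)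
  then obtain B where B: "\<And>s. s \<in> K \<Longrightarrow> norm (inv_zeta s) \<le> B"
    using compact_imp_bounded bounded_iff by (metis imageI)
  define C where "C = \<bar>B\<bar> + 2"
  have "norm (inv_zeta s) \<le> C * (1 + \<bar>Im s\<bar>) powr \<epsilon>" if s: "1 / 2 + \<delta> \<le> Re s" "Re s \<le> 1" for s
  proof (cases "\<bar>Im s\<bar> \<ge> T")
    case False
    then have "s \<in> K" using s by (auto simp: K_def in_cbox_complex_iff)
    then have "norm (inv_zeta s) \<le> C * 1" using B[of s] by (simp add: C_def)
    also have "\<dots> \<le> C * (1 + \<bar>Im s\<bar>) powr \<epsilon>"
      using \<epsilon> by (intro mult_left_mono ge_one_powr_ge_zero) (auto simp: C_def)
    finally show ?thesis .
  next
    case True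
    then have Im: "\<bar>Im s\<bar> \<ge> 1" using T(1) by simp
    have "norm (s - 1) \<le> \<bar>Re (s - 1)\<bar> + \<bar>Im (s - 1)\<bar>" by (rule cmod_le)
    also have "\<dots> \<le> 2 * \<bar>Im s\<bar>" using s \<delta> Im by simp
    finally have "norm (inv_zeta s) \<le> (2 * \<bar>Im s\<bar>) / \<bar>Im s\<bar> powr (1 - \<epsilon>)"
      unfolding inv_zeta_def norm_divide using T(2)[OF s True] Im by (intro frac_le) auto
    also have "\<dots> = 2 * \<bar>Im s\<bar> powr \<epsilon>"
      using Im by (simp add: powr_diff)
    also have "\<dots> \<le> C * (1 + \<bar>Im s\<bar>) powr \<epsilon>"
      using \<epsilon> by (intro mult_mono powr_mono2) (auto simp: C_def)
    finally show ?thesis .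
  qed
  then show ?thesis using that[of C] by (simp add: C_def)
qed

section \<open>Newman's contour and partial sums of the Moebius function\<close>

lemma closed_segment_coordinates:
  fixes u x y :: complex
  assumes "u \<in> closed_segment x y"
  shows "Re u \<ge> min (Re x) (Re y) \<and> Re u \<le> max (Re x) (Re y)
     \<and> Im u \<ge> min (Im x) (Im y) \<and> Im u \<le> max (Im x) (Im y)"
proof -
  have "Re u \<in> closed_segment (Re x) (Re y)" "Im u \<in> closed_segment (Im x) (Im y)"
    using assms by (auto simp: closed_segment_def)
  then show ?thesis by (auto simp: closed_segment_eq_real_ivl split: if_splits)
qed

text \<open>Cauchy's formula at 0, with the two horizontal sides split at the imaginary axis: different
estimates will be used on the two sides of this axis.\<close>

lemma rectangle_integral:
  fixes f :: "complex \<Rightarrow> complex"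
  assumes R: "R > 0" and b: "0 < b" "b < c" and f: "f holomorphic_on {z. Re z > - c}"
  defines "q \<equiv> \<lambda>w. f w / w"
  shows "contour_integral (linepath (Complex (- b) (- R)) (Complex 0 (- R))) q
       + contour_integral (linepath (Complex 0 (- R)) (Complex R (- R))) q
       + contour_integral (linepath (Complex R (- R)) (Complex R R)) q
       + contour_integral (linepath (Complex R R) (Complex 0 R)) q
       + contour_integral (linepath (Complex 0 R) (Complex (- b) R)) q
       + contour_integral (linepath (Complex (- b) R) (Complex (- b) (- R))) q
     = 2 * pi * \<i> * f 0"
proof -
  define H where "H = {z. Re z > - c}"
  define G B C E where GBCE: "G = Complex (- b) (- R)" "B = Complex R (- R)" "C = Complex R R" "E = Complex (- b) R"
  have H: "convex H" "open H"
    unfolding H_def by (rule convex_halfspace_Re_gt, rule open_Re_gt)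
  have cont: "continuous_on (H - {0}) q"
    unfolding q_def using f by (intro continuous_intros holomorphic_on_imp_continuous_on)
      (auto simp: H_def intro: continuous_on_subset holomorphic_on_subset)
  have seg: "closed_segment G B \<subseteq> H - {0}" "closed_segment B C \<subseteq> H - {0}"
     "closed_segment C E \<subseteq> H - {0}" "closed_segment E G \<subseteq> H - {0}"
    using R b by (auto simp: H_def GBCE dest!: closed_segment_coordinates)
  have int: "q contour_integrable_on linepath x y" if "closed_segment x y \<subseteq> H - {0}" for x y
    by (rule contour_integrable_continuous_linepath[OF continuous_on_subset[OF cont that]])
  have rp: "rectpath G C = linepath G B +++ linepath B C +++ linepath C E +++ linepath E G"
    by (simp add: rectpath_def Let_def GBCE)
  have im: "path_image (rectpath G C) \<subseteq> H - {0}"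
    unfolding rp using seg by (simp add: path_image_join)
  have "((\<lambda>w. f w / (w - 0)) has_contour_integral (2 * pi * \<i> * winding_number (rectpath G C) 0 * f 0)) (rectpath G C)"
    by (rule Cauchy_integral_formula_convex_simple[OF H(1)])
       (use f im b in \<open>auto simp: H_def[symmetric] interior_open[OF H(2)]\<close>, auto simp: H_def)
  moreover have "winding_number (rectpath G C) 0 = 1"
    by (rule winding_number_rectpath) (use R b in \<open>auto simp: GBCE in_box_complex_iff\<close>)
  ultimately have "contour_integral (rectpath G C) q = 2 * pi * \<i> * f 0"
    unfolding q_def by (auto dest: contour_integral_unique)
  moreover have "contour_integral (rectpath G C) q = contour_integral (linepath G B) q
     + contour_integral (linepath B C) q + contour_integral (linepath C E) q + contour_integral (linepath E G) q"
    unfolding rp using int seg by (simp add: contour_integral_join contour_integrable_joinI valid_path_join)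
  moreover have "contour_integral (linepath G B) q = contour_integral (linepath G (Complex 0 (- R))) q
     + contour_integral (linepath (Complex 0 (- R)) B) q"
  proof (rule contour_integral_split_linepath)
    show "Complex 0 (- R) \<in> closed_segment G B"
      using b R by (simp add: GBCE closed_segment_same_Im closed_segment_eq_real_ivl)
  qed (use continuous_on_subset[OF cont seg(1)] in auto)
  moreover have "contour_integral (linepath C E) q = contour_integral (linepath C (Complex 0 R)) q
     + contour_integral (linepath (Complex 0 R) E) q"
  proof (rule contour_integral_split_linepath)
    show "Complex 0 R \<in> closed_segment C E"
      using b R by (simp add: GBCE closed_segment_same_Im closed_segment_eq_real_ivl)
  qed (use continuous_on_subset[OF cont seg(3)] in auto)
  ultimately show ?thesis by (simp add: GBCE add_ac)
qed

text \<open>Newman's kernel \<open>1 / z + z / R\<^sup>2\<close> vanishes at \<open>\<i> * R\<close> and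
\<open>- \<i> * R\<close>. Therefore it is small where the horizontal lines
\<open>\<bar>Im z\<bar> = R\<close> meet the imaginary axis, which compensates the factor
\<open>1 / \<bar>Re z\<bar>\<close> in the estimates for tails and partial sums.\<close>

lemma kernel_bound:
  assumes R: "R > 0" and z: "\<bar>Im z\<bar> = R \<and> \<bar>Re z\<bar> \<le> R \<or> \<bar>Re z\<bar> = R \<and> \<bar>Im z\<bar> \<le> R"
  shows "norm ((1 + z\<^sup>2 / of_real (R\<^sup>2)) / z) \<le> 3 * \<bar>Re z\<bar> / R\<^sup>2"
proof -
  have zR: "norm z \<ge> R" using z abs_Re_le_cmod[of z] abs_Im_le_cmod[of z] by auto
  have "norm (of_real (R\<^sup>2) + z\<^sup>2) \<le> 3 * R * \<bar>Re z\<bar>"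
    using z
  proof
    assume z: "\<bar>Im z\<bar> = R \<and> \<bar>Re z\<bar> \<le> R"
    define w where "w = of_real (Im z) * \<i>"
    have w: "norm w = R" "z - w = of_real (Re z)" "w\<^sup>2 = - of_real (R\<^sup>2)"
      using z by (auto simp: w_def norm_mult complex_eq_iff power2_eq_square)
    have "of_real (R\<^sup>2) + z\<^sup>2 = (z - w) * (z - w + 2 * w)"
      using w(3) by (simp add: algebra_simps power2_eq_square)
    also have "norm \<dots> \<le> \<bar>Re z\<bar> * (\<bar>Re z\<bar> + 2 * R)"
      unfolding norm_mult w(2) using norm_triangle_ineq[of "of_real (Re z)" "2 * w"] w(1)
      by (auto intro!: mult_left_mono simp: norm_mult)
    also have "\<dots> \<le> \<bar>Re z\<bar> * (3 * R)" using z by (intro mult_left_mono) auto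
    finally show ?thesis by (simp add: mult_ac)
  next
    assume z: "\<bar>Re z\<bar> = R \<and> \<bar>Im z\<bar> \<le> R"
    have "(norm z)\<^sup>2 = (Re z)\<^sup>2 + (Im z)\<^sup>2" by (rule cmod_power2)
    also have "\<dots> \<le> R\<^sup>2 + R\<^sup>2" using z by (intro add_mono) (auto simp: abs_le_square_iff[symmetric])
    finally have "norm (z\<^sup>2) \<le> 2 * R\<^sup>2" by (simp add: norm_power)
    then have "norm (of_real (R\<^sup>2) + z\<^sup>2) \<le> 3 * R\<^sup>2"
      using norm_triangle_ineq[of "of_real (R\<^sup>2)" "z\<^sup>2"] by (simp add: norm_power)
    then show ?thesis using z by (simp add: power2_eq_square)
  qed
  moreover have e: "(1 + z\<^sup>2 / of_real (R\<^sup>2)) / z = (of_real (R\<^sup>2) + z\<^sup>2) / (of_real (R\<^sup>2) * z)"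
    using R zR by (simp add: field_simps)
  moreover have "norm (of_real (R\<^sup>2) * z) \<ge> R\<^sup>2 * R"
    using zR R by (auto simp: norm_mult norm_power intro!: mult_left_mono)
  ultimately have "norm ((1 + z\<^sup>2 / of_real (R\<^sup>2)) / z) \<le> (3 * R * \<bar>Re z\<bar>) / (R\<^sup>2 * R)"
    unfolding e norm_divide using R by (intro frac_le) auto
  also have "\<dots> = 3 * \<bar>Re z\<bar> / R\<^sup>2" using R by simp
  finally show ?thesis .
qed

definition moebius_poly :: "nat \<Rightarrow> complex \<Rightarrow> complex" where
  "moebius_poly N s = (\<Sum>n = 1..N. of_real (moebius_mu n) * of_nat n powr (- s))"

lemma powr_diff_lower:
  assumes "x > 0" "n \<ge> 1"
  shows "x * real (Suc n) powr (- x - 1) \<le> real n powr (- x) - real (Suc n) powr (- x)"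
proof -
  have "\<exists>\<xi>. real n < \<xi> \<and> \<xi> < real (Suc n) \<and>
     real (Suc n) powr (- x) - real n powr (- x) = (real (Suc n) - real n) * ((- x) * \<xi> powr (- x - 1))"
    using assms by (intro MVT2) (auto intro!: derivative_eq_intros)
  then obtain \<xi> where \<xi>: "real n < \<xi>" "\<xi> < real (Suc n)"
    "real (Suc n) powr (- x) - real n powr (- x) = (real (Suc n) - real n) * ((- x) * \<xi> powr (- x - 1))" by blast
  have "real (Suc n) powr (- x - 1) \<le> \<xi> powr (- x - 1)"
    using \<xi> assms by (intro powr_mono2') auto
  then have "x * real (Suc n) powr (- x - 1) \<le> x * \<xi> powr (- x - 1)"
    using assms by (intro mult_left_mono) auto
  then show ?thesis using \<xi>(3) by simp
qed

text \<open>Comparison of the tail of the Dirichlet series with the integral of \<open>x powr (- Re s)\<close>,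
in telescoping form.\<close>

lemma moebius_tail_bound:
  assumes N: "N \<ge> 1" and s: "Re s > 1"
  shows "norm (inv_zeta s - moebius_poly N s) \<le> real N powr (1 - Re s) / (Re s - 1)"
proof -
  define x where "x = Re s - 1"
  have x: "x > 0" using s by (simp add: x_def)
  have "((\<lambda>n. of_real (moebius_mu n) * of_nat n powr (- s)) has_sum (inv_zeta s - moebius_poly N s)) ({1..} - {1..N})"
    using moebius_mu_dirichlet_series[OF s] unfolding inv_zeta_eq[OF s] moebius_poly_def
    by (rule has_sum_Diff) (auto intro!: has_sum_finite)
  also have "{1..} - {1..N} = (\<lambda>m. Suc (N + m)) ` UNIV"
    by (auto simp: image_iff dest!: less_imp_Suc_add[of N] simp: not_le)
  finally have 1: "((\<lambda>m. of_real (moebius_mu (Suc (N + m))) * of_nat (Suc (N + m)) powr (- s)) has_sum (inv_zeta s - moebius_poly N s)) UNIV"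
    by (subst (asm) has_sum_reindex) (auto simp: o_def inj_on_def)
  define p where "p = (\<lambda>m. real (N + m) powr (- x))"
  have "p \<longlonglongrightarrow> 0" unfolding p_def using x by real_asymp
  then have "(\<lambda>m. p m - p (Suc m)) sums (p 0 - 0)" by (rule telescope_sums')
  then have "(\<lambda>m. (p m - p (Suc m)) / x) sums (p 0 / x)" by (auto dest: sums_divide[of _ _ x])
  moreover have le: "real (Suc (N + m)) powr (- Re s) \<le> (p m - p (Suc m)) / x" for m
  proof -
    have "x * real (Suc (N + m)) powr (- x - 1) \<le> p m - p (Suc m)"
      using powr_diff_lower[OF x, of "N + m"] N by (simp add: p_def add_ac)
    then show ?thesis using x by (simp add: x_def field_simps)
  qed
  ultimately have 2: "((\<lambda>m. (p m - p (Suc m)) / x) has_sum (p 0 / x)) UNIV"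
    by (intro sums_nonneg_imp_has_sum) (auto intro: order_trans[OF _ le])
  have "norm (inv_zeta s - moebius_poly N s) \<le> p 0 / x"
  proof (rule norm_infsum_le[OF 1 2])
    fix m
    have "norm (of_real (moebius_mu (Suc (N + m))) * of_nat (Suc (N + m)) powr (- s) :: complex)
       = \<bar>moebius_mu (Suc (N + m))\<bar> * real (Suc (N + m)) powr (- Re s)"
      unfolding norm_mult norm_of_nat_powr by simp
    also have "\<dots> \<le> 1 * ((p m - p (Suc m)) / x)"
      by (intro mult_mono abs_moebius_mu_le le) auto
    finally show "norm (of_real (moebius_mu (Suc (N + m))) * of_nat (Suc (N + m)) powr (- s) :: complex) \<le> (p m - p (Suc m)) / x"
      by simp
  qed
  then show ?thesis by (simp add: p_def x_def)
qed

lemma sum_powr_bound: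
  assumes y: "y > 0" and N: "N \<ge> 1"
  shows "(\<Sum>n = 1..N. real n powr (y - 1)) \<le> real N powr y / y + real N powr (y - 1)"
proof -
  have mvt: "\<exists>\<xi>. real n < \<xi> \<and> \<xi> < real (Suc n) \<and>
     real (Suc n) powr y - real n powr y = (real (Suc n) - real n) * (y * \<xi> powr (y - 1))" if "n \<ge> 1" for n
    using that by (intro MVT2) (auto intro!: derivative_eq_intros)
  show ?thesis
  proof (cases "y \<ge> 1")
    case True
    show ?thesis
      using N
    proof (induction N rule: nat_induct_at_least)
      case (Suc n)
      obtain \<xi> where \<xi>: "real n < \<xi>" "\<xi> < real (Suc n)"
        "real (Suc n) powr y - real n powr y = (real (Suc n) - real n) * (y * \<xi> powr (y - 1))"
        using mvt[OF Suc.hyps] by blast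
      have "real n powr (y - 1) \<le> \<xi> powr (y - 1)" using \<xi> True by (intro powr_mono2) auto
      then have "real n powr (y - 1) \<le> real (Suc n) powr y / y - real n powr y / y"
        using \<xi>(3) y by (simp add: field_simps)
      then show ?case using Suc.IH by simp
    qed (use y in simp)
  next
    case False
    have "(\<Sum>n = 1..N. real n powr (y - 1)) \<le> real N powr y / y"
      using N
    proof (induction N rule: nat_induct_at_least)
      case (Suc n)
      obtain \<xi> where \<xi>: "real n < \<xi>" "\<xi> < real (Suc n)"
        "real (Suc n) powr y - real n powr y = (real (Suc n) - real n) * (y * \<xi> powr (y - 1))"
        using mvt[OF Suc.hyps] by blast
      have "real (Suc n) powr (y - 1) \<le> \<xi> powr (y - 1)"
        using \<xi> Suc.hyps False by (intro powr_mono2') auto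
      then have "real (Suc n) powr (y - 1) \<le> real (Suc n) powr y / y - real n powr y / y"
        using \<xi>(3) y by (simp add: field_simps)
      then show ?case using Suc.IH by simp
    qed (use y False in simp)
    then show ?thesis by (smt (verit) powr_ge_zero)
  qed
qed

lemma moebius_poly_bound:
  assumes N: "N \<ge> 1" and s: "Re s < 1"
  shows "norm (moebius_poly N s) \<le> real N powr (1 - Re s) * (1 / (1 - Re s) + 1 / real N)"
proof -
  have "norm (moebius_poly N s) \<le> (\<Sum>n = 1..N. real n powr ((1 - Re s) - 1))"
    unfolding moebius_poly_def
  proof (rule sum_norm_le)
    fix n
    have "norm (of_real (moebius_mu n) * of_nat n powr (- s) :: complex) = \<bar>moebius_mu n\<bar> * real n powr (- Re s)"
      by (simp add: norm_mult norm_of_nat_powr)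
    also have "\<dots> \<le> 1 * real n powr (- Re s)"
      by (intro mult_right_mono abs_moebius_mu_le) auto
    finally show "norm (of_real (moebius_mu n) * of_nat n powr (- s) :: complex) \<le> real n powr ((1 - Re s) - 1)" by simp
  qed
  also have "\<dots> \<le> real N powr (1 - Re s) / (1 - Re s) + real N powr ((1 - Re s) - 1)"
    using s N by (intro sum_powr_bound) auto
  also have "real N powr ((1 - Re s) - 1) = real N powr (1 - Re s) / real N"
    using N by (subst powr_diff) simp
  also have "real N powr (1 - Re s) / (1 - Re s) + real N powr (1 - Re s) / real N
      = real N powr (1 - Re s) * (1 / (1 - Re s) + 1 / real N)"
    by (simp add: distrib_left)
  finally show ?thesis .
qed

lemma moebius_poly_holomorphic: "moebius_poly N holomorphic_on A"
  unfolding moebius_poly_def by (intro holomorphic_intros)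

text \<open>A bound with decay \<open>1 / (1 + y)\<close> along a vertical segment integrates to a logarithm.\<close>

lemma log_segment_bound:
  assumes R: "R > 0" and M: "M \<ge> 0" and cont: "continuous_on (closed_segment (of_real c) (Complex c (\<sigma> * R))) f"
    and \<sigma>: "\<bar>\<sigma>\<bar> = 1"
    and f: "\<And>y. 0 \<le> y \<Longrightarrow> y \<le> R \<Longrightarrow> norm (f (Complex c (\<sigma> * y))) \<le> M / (1 + y)"
  shows "norm (contour_integral (linepath (of_real c) (Complex c (\<sigma> * R))) f) \<le> M * ln (1 + R)"
proof -
  define p where "p = linepath (of_real c) (Complex c (\<sigma> * R))"
  have "f contour_integrable_on p"
    unfolding p_def by (rule contour_integrable_continuous_linepath[OF cont])
  then have 1: "((\<lambda>x. f (p x) * (Complex c (\<sigma> * R) - of_real c)) has_integral contour_integral p f) {0..1}"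
    unfolding p_def has_contour_integral_linepath[symmetric] by (rule has_contour_integral_integral)
  have px: "p x = Complex c (\<sigma> * (R * x))" for x
    by (simp add: p_def linepath_def complex_eq_iff algebra_simps)
  have nd: "norm (Complex c (\<sigma> * R) - of_real c) = R"
  proof -
    have "Complex c (\<sigma> * R) - of_real c = \<i> * of_real (\<sigma> * R)" by (simp add: complex_eq_iff)
    then show ?thesis using \<sigma> R by (simp add: norm_mult abs_mult del: of_real_mult)
  qed
  have 2: "((\<lambda>x. M * R / (1 + R * x)) has_integral (M * ln (1 + R * 1) - M * ln (1 + R * 0))) {0..1}"
  proof (rule fundamental_theorem_of_calculus)
    fix x :: real assume x: "x \<in> {0..1}"
    have "1 + R * x > 0" using R x by (intro add_pos_nonneg) auto
    then show "((\<lambda>x. M * ln (1 + R * x)) has_vector_derivative M * R / (1 + R * x)) (at x within {0..1})"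
      unfolding has_real_derivative_iff_has_vector_derivative[symmetric]
      by (auto intro!: derivative_eq_intros)
  qed simp
  have "norm (contour_integral p f) \<le> M * ln (1 + R * 1) - M * ln (1 + R * 0)"
    unfolding integral_unique[OF 1, symmetric] integral_unique[OF 2, symmetric]
  proof (rule integral_norm_bound_integral)
    fix x :: real assume x: "x \<in> {0..1}"
    have Rx: "0 \<le> R * x" "R * x \<le> R" using R x by (auto simp: mult_left_le)
    have "norm (f (p x)) * R \<le> M / (1 + R * x) * R"
      unfolding px using f[OF Rx] R by (intro mult_right_mono) auto
    then show "norm (f (p x) * (Complex c (\<sigma> * R) - of_real c)) \<le> M * R / (1 + R * x)"
      by (simp add: norm_mult nd)
  qed (use 1 2 in \<open>auto intro: has_integral_integrable\<close>)
  then show ?thesis by (simp add: p_def)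
qed

text \<open>With \<open>R = N\<close>, write \<open>f\<close> and \<open>g\<close> for the products of
\<open>N powr z * (1 + z\<^sup>2 / R\<^sup>2)\<close> with the reciprocal of zeta and with the
partial sum of its series, both at \<open>1 + z\<close>. Cauchy's formula at 0 is applied to
\<open>f\<close> on the rectangle with left side \<open>Re z = - a\<close> and to \<open>g\<close>,
which is entire, on the square with left side \<open>Re z = - R\<close>. On the part of the contour
to the right of the imaginary axis, \<open>f - g\<close> is a tail of the series. On the left part
of the square, \<open>g\<close> is bounded trivially. On the left part of the rectangle, the factor
\<open>N powr z\<close> is at most \<open>N powr (- a)\<close> on the vertical side and the kernel
is of order \<open>1 / R\<^sup>2\<close> on the short horizontal ones. As the reciprocal of zeta
vanishes at 1, the difference of the two formulas is, up to a constant factor, the partial sum at 1.\<close>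

lemma newman_estimate:
  assumes RH: riemann_hypothesis and a: "0 < a" "a < 1 / 2" and K: "K \<ge> 0" and \<epsilon>: "\<epsilon> \<ge> 0"
    and F: "\<And>s. 1 - a \<le> Re s \<Longrightarrow> Re s \<le> 1 \<Longrightarrow> norm (inv_zeta s) \<le> K * (1 + \<bar>Im s\<bar>) powr \<epsilon>"
    and N: "N \<ge> 1"
  shows "2 * pi * norm (moebius_poly N 1) \<le> 36 / real N + 3 * K * (1 + real N) powr \<epsilon> / (real N)\<^sup>2
     + 2 * (K * (1 + real N) powr \<epsilon> * real N powr (- a) * (2 / a + 4)) * ln (1 + real N)"
proof -
  define R where "R = real N"
  have R: "R \<ge> 1" using N by (simp add: R_def)
  define ker where "ker = (\<lambda>z::complex. (1 + z\<^sup>2 / of_real (R\<^sup>2)) / z)"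
  define f where "f = (\<lambda>z. inv_zeta (1 + z) * of_nat N powr z * (1 + z\<^sup>2 / of_real (R\<^sup>2)))"
  define g where "g = (\<lambda>z. moebius_poly N (1 + z) * of_nat N powr z * (1 + z\<^sup>2 / of_real (R\<^sup>2)))"
  define I where "I = (\<lambda>h x y. contour_integral (linepath x y) (\<lambda>w::complex. h w / w))"
  have inv_hol: "(\<lambda>z. inv_zeta (1 + z)) holomorphic_on {z. Re z > - (1/2)}"
  proof -
    have "(inv_zeta \<circ> (\<lambda>z. 1 + z)) holomorphic_on {z. Re z > - (1/2)}"
      by (rule holomorphic_on_compose_gen[OF _ inv_zeta_holomorphic[OF RH]]) (auto intro!: holomorphic_intros)
    then show ?thesis by (simp add: o_def)
  qed
  have mp_hol: "(\<lambda>z. moebius_poly N (1 + z)) holomorphic_on A" for A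
  proof -
    have "(moebius_poly N \<circ> (\<lambda>z. 1 + z)) holomorphic_on A"
      by (rule holomorphic_on_compose_gen[OF _ moebius_poly_holomorphic[of N UNIV]]) (auto intro!: holomorphic_intros)
    then show ?thesis by (simp add: o_def)
  qed
  have fhol: "f holomorphic_on {z. Re z > - (1/2)}"
    unfolding f_def using R by (intro holomorphic_intros inv_hol) auto
  have ghol: "g holomorphic_on A" for A
    unfolding g_def using R by (intro holomorphic_intros mp_hol) auto
  define w1 w2 w3 w4 where "w1 = Complex 0 (- R)" "w2 = Complex R (- R)" "w3 = Complex R R" "w4 = Complex 0 R"
  define e1 e2 where "e1 = Complex (- a) R" "e2 = Complex (- a) (- R)"
  define d1 d2 where "d1 = Complex (- R) R" "d2 = Complex (- R) (- R)"
  have "I f e2 w1 + I f w1 w2 + I f w2 w3 + I f w3 w4 + I f w4 e1 + I f e1 e2 = 2 * pi * \<i> * f 0"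
    unfolding I_def w1_w2_w3_w4_def e1_e2_def
    by (rule rectangle_integral[OF _ a(1,2) fhol]) (use R in auto)
  moreover have "f 0 = 0" by (simp add: f_def inv_zeta_def)
  ultimately have If: "I f e2 w1 + I f w1 w2 + I f w2 w3 + I f w3 w4 + I f w4 e1 + I f e1 e2 = 0" by simp
  have Ig: "I g d2 w1 + I g w1 w2 + I g w2 w3 + I g w3 w4 + I g w4 d1 + I g d1 d2 = 2 * pi * \<i> * moebius_poly N 1"
    using rectangle_integral[OF _ _ _ ghol, of R R "R + 1"] R N
    unfolding I_def w1_w2_w3_w4_def d1_d2_def by (simp add: g_def)
  have contf: "continuous_on A (\<lambda>w. f w / w)" if "A \<subseteq> {z. Re z > - (1/2)} - {0}" for A
    using that by (intro continuous_intros holomorphic_on_imp_continuous_on holomorphic_on_subset[OF fhol]) auto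
  have contg: "continuous_on A (\<lambda>w. g w / w)" if "A \<subseteq> - {0}" for A
    using that by (intro continuous_intros holomorphic_on_imp_continuous_on ghol) auto
  have Npowr: "norm (of_nat N powr z :: complex) = R powr Re z" for z
    by (simp add: norm_of_nat_powr R_def)
  have edge: "norm (I h x y) \<le> B * norm (y - x)"
    if "continuous_on (closed_segment x y) (\<lambda>w. h w / w)" "\<And>z. z \<in> closed_segment x y \<Longrightarrow> norm (h z / z) \<le> B" "B \<ge> 0"
    for h x y B
    unfolding I_def using that by (intro contour_integral_bound_linepath contour_integrable_continuous_linepath) auto
  have right: "norm (I f x y - I g x y) \<le> 3 / R\<^sup>2 * norm (y - x)"
    if xy: "\<And>z. z \<in> closed_segment x y \<Longrightarrow> Re z \<ge> 0 \<and> (\<bar>Im z\<bar> = R \<and> \<bar>Re z\<bar> \<le> R \<or> \<bar>Re z\<bar> = R \<and> \<bar>Im z\<bar> \<le> R)" for x y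
  proof -
    have sub: "closed_segment x y \<subseteq> {z. Re z > - (1/2)} - {0}" using xy R by force
    have c: "continuous_on (closed_segment x y) (\<lambda>w. f w / w)" "continuous_on (closed_segment x y) (\<lambda>w. g w / w)"
      using contf[OF sub] contg sub by blast+
    have "I f x y - I g x y = I (\<lambda>z. f z - g z) x y"
      unfolding I_def diff_divide_distrib
      by (subst contour_integral_diff) (auto intro!: contour_integrable_continuous_linepath c)
    also have "norm \<dots> \<le> 3 / R\<^sup>2 * norm (y - x)"
    proof (rule edge)
      show "continuous_on (closed_segment x y) (\<lambda>w. (f w - g w) / w)"
        unfolding diff_divide_distrib by (intro continuous_intros c)
      fix z assume z: "z \<in> closed_segment x y"
      have e: "(f z - g z) / z = (inv_zeta (1 + z) - moebius_poly N (1 + z)) * of_nat N powr z * ker z"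
        by (simp add: f_def g_def ker_def algebra_simps diff_divide_distrib)
      have kb: "norm (ker z) \<le> 3 * \<bar>Re z\<bar> / R\<^sup>2"
        unfolding ker_def by (rule kernel_bound) (use xy[OF z] R in auto)
      show "norm ((f z - g z) / z) \<le> 3 / R\<^sup>2"
      proof (cases "Re z = 0")
        case True
        then have "ker z = 0" using kb by simp
        then show ?thesis by (simp only: e) simp
      next
        case False
        then have z0: "Re z > 0" using xy[OF z] by simp
        have "norm ((f z - g z) / z) = norm (inv_zeta (1 + z) - moebius_poly N (1 + z)) * R powr Re z * norm (ker z)"
          unfolding e norm_mult Npowr ..
        also have "\<dots> \<le> (R powr (- Re z) / Re z) * R powr Re z * (3 * Re z / R\<^sup>2)"
          using moebius_tail_bound[OF N, of "1 + z"] z0 kb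
          by (intro mult_mono) (auto simp: R_def)
        also have "\<dots> = 3 / R\<^sup>2" using z0 R by (simp add: powr_minus field_simps)
        finally show ?thesis .
      qed
    qed (use R in auto)
    finally show ?thesis .
  qed
  have left: "norm (I g x y) \<le> 6 / R\<^sup>2 * norm (y - x)"
    if xy: "\<And>z. z \<in> closed_segment x y \<Longrightarrow> Re z \<le> 0 \<and> (\<bar>Im z\<bar> = R \<and> \<bar>Re z\<bar> \<le> R \<or> \<bar>Re z\<bar> = R \<and> \<bar>Im z\<bar> \<le> R)" for x y
  proof (rule edge)
    show "continuous_on (closed_segment x y) (\<lambda>w. g w / w)"
      using xy R by (intro contg) force
    fix z assume z: "z \<in> closed_segment x y"
    have e: "g z / z = moebius_poly N (1 + z) * of_nat N powr z * ker z"
      by (simp add: g_def ker_def)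
    have kb: "norm (ker z) \<le> 3 * \<bar>Re z\<bar> / R\<^sup>2"
      unfolding ker_def by (rule kernel_bound) (use xy[OF z] R in auto)
    show "norm (g z / z) \<le> 6 / R\<^sup>2"
    proof (cases "Re z = 0")
      case True
      then have "ker z = 0" using kb by simp
      then show ?thesis by (simp only: e) simp
    next
      case False
      define v where "v = - Re z"
      have v: "v > 0" "v \<le> R" using xy[OF z] False by (auto simp: v_def)
      have "norm (g z / z) = norm (moebius_poly N (1 + z)) * R powr Re z * norm (ker z)"
        unfolding e norm_mult Npowr ..
      also have "\<dots> \<le> (R powr v * (1 / v + 1 / R)) * R powr (- v) * (3 * v / R\<^sup>2)"
      proof (intro mult_mono)
        show "norm (moebius_poly N (1 + z)) \<le> R powr v * (1 / v + 1 / R)"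
          using moebius_poly_bound[OF N, of "1 + z"] v by (simp add: R_def v_def)
        show "R powr Re z \<le> R powr (- v)" by (simp add: v_def)
        show "norm (ker z) \<le> 3 * v / R\<^sup>2" using kb v by (simp add: v_def)
      qed (use v R in auto)
      also have "\<dots> = (1 / v + 1 / R) * (3 * v) / R\<^sup>2" using R by (simp add: powr_minus field_simps)
      also have "\<dots> \<le> 6 / R\<^sup>2"
      proof (rule divide_right_mono)
        have "(1 / v + 1 / R) * (3 * v) = 3 + 3 * (v / R)" using v R by (simp add: field_simps)
        also have "v / R \<le> 1" using v R by simp
        finally have "(1 / v + 1 / R) * (3 * v) \<le> 3 + 3 * 1" by simp
        then show "(1 / v + 1 / R) * (3 * v) \<le> 6" by simp
      qed simp
      finally show ?thesis .
    qed
  qed (use R in auto)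
  define Q where "Q = K * (1 + R) powr \<epsilon>"
  have Q: "Q \<ge> 0" using K by (simp add: Q_def)
  have fbound: "norm (f z / z) \<le> Q * R powr Re z * norm (ker z)"
    if "- a \<le> Re z" "Re z \<le> 0" "\<bar>Im z\<bar> \<le> R" for z
  proof -
    have "norm (inv_zeta (1 + z)) \<le> K * (1 + \<bar>Im z\<bar>) powr \<epsilon>"
      using F[of "1 + z"] that by simp
    also have "\<dots> \<le> Q" unfolding Q_def using K \<epsilon> that by (intro mult_left_mono powr_mono2) auto
    finally have "norm (inv_zeta (1 + z)) \<le> Q" .
    moreover have "f z / z = inv_zeta (1 + z) * of_nat N powr z * ker z"
      by (simp add: f_def ker_def)
    ultimately show ?thesis by (auto simp: norm_mult Npowr intro!: mult_right_mono)
  qed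
  have horiz: "norm (I f x y) \<le> (3 * Q / R\<^sup>2) * norm (y - x)"
    if xy: "\<And>z. z \<in> closed_segment x y \<Longrightarrow> - a \<le> Re z \<and> Re z \<le> 0 \<and> \<bar>Im z\<bar> = R" for x y
  proof (rule edge)
    show "continuous_on (closed_segment x y) (\<lambda>w. f w / w)"
      using xy R a by (intro contf) force
    fix z assume z: "z \<in> closed_segment x y"
    have kb: "norm (ker z) \<le> 3 * \<bar>Re z\<bar> / R\<^sup>2"
      unfolding ker_def by (rule kernel_bound) (use xy[OF z] R a in auto)
    also have "\<dots> \<le> 3 * 1 / R\<^sup>2"
      using xy[OF z] a by (intro divide_right_mono mult_left_mono) auto
    finally have kb: "norm (ker z) \<le> 3 / R\<^sup>2" by simp
    have "R powr Re z \<le> R powr 0" using xy[OF z] R by (intro powr_mono) auto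
    then have "Q * R powr Re z * norm (ker z) \<le> Q * 1 * (3 / R\<^sup>2)"
      using Q kb R by (intro mult_mono) auto
    then show "norm (f z / z) \<le> 3 * Q / R\<^sup>2"
      using fbound[of z] xy[OF z] by (simp add: mult_ac)
  qed (use Q in auto)
  define M where "M = Q * R powr (- a) * (2 / a + 4)"
  have vert: "norm (contour_integral (linepath (of_real (- a)) (Complex (- a) (\<sigma> * R))) (\<lambda>w. f w / w)) \<le> M * ln (1 + R)"
    and vertc: "continuous_on (closed_segment (of_real (- a)) (Complex (- a) (\<sigma> * R))) (\<lambda>w. f w / w)"
    if \<sigma>: "\<bar>\<sigma>\<bar> = 1" for \<sigma>
  proof -
    show c: "continuous_on (closed_segment (of_real (- a)) (Complex (- a) (\<sigma> * R))) (\<lambda>w. f w / w)"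
      using a by (intro contf) (auto dest!: closed_segment_coordinates)
    show "norm (contour_integral (linepath (of_real (- a)) (Complex (- a) (\<sigma> * R))) (\<lambda>w. f w / w)) \<le> M * ln (1 + R)"
    proof (rule log_segment_bound[OF _ _ c \<sigma>])
      fix y assume y: "0 \<le> y" "y \<le> R"
      define z where "z = Complex (- a) (\<sigma> * y)"
      have Imz: "\<bar>Im z\<bar> = y" using \<sigma> y by (simp add: z_def abs_mult)
      have zl: "norm z \<ge> a" "norm z \<ge> y"
        using abs_Re_le_cmod[of z] abs_Im_le_cmod[of z] a Imz by (auto simp: z_def)
      have zu: "norm z \<le> a + y" using cmod_le[of z] Imz a by (simp add: z_def)
      have z0: "z \<noteq> 0" using zl a by auto
      have "ker z = 1 / z + z / of_real (R\<^sup>2)"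
        using z0 R by (simp add: ker_def field_simps power2_eq_square)
      then have "norm (ker z) \<le> 1 / norm z + norm z / R\<^sup>2"
        using norm_triangle_ineq[of "1 / z" "z / of_real (R\<^sup>2)"] by (simp add: norm_divide norm_power)
      also have "1 / norm z \<le> (2 / a) / (1 + y)"
      proof -
        have "a * (1 + y) \<le> 2 * norm z"
        proof -
          have "a * y \<le> 1 * y" using a y by (intro mult_right_mono) auto
          then show ?thesis using zl by (simp add: algebra_simps)
        qed
        then have "2 / (2 * norm z) \<le> 2 / (a * (1 + y))"
          using a y by (intro divide_left_mono) (auto intro!: mult_pos_pos simp: z0)
        then show ?thesis by simp
      qed
      also have "norm z / R\<^sup>2 \<le> 4 / (1 + y)"
      proof -
        have "norm z * (1 + y) \<le> (2 * R) * (2 * R)"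
          using zu a y R by (intro mult_mono) auto
        then show ?thesis using R y by (simp add: field_simps power2_eq_square)
      qed
      finally have kb: "norm (ker z) \<le> (2 / a + 4) / (1 + y)" by (simp add: add_divide_distrib)
      have "norm (f z / z) \<le> Q * R powr (- a) * norm (ker z)"
        using fbound[of z] Imz y a by (simp add: z_def)
      also have "\<dots> \<le> Q * R powr (- a) * ((2 / a + 4) / (1 + y))"
        using kb Q by (intro mult_left_mono) auto
      also have "\<dots> = M / (1 + y)" by (simp add: M_def)
      finally show "norm (f (Complex (- a) (\<sigma> * y)) / Complex (- a) (\<sigma> * y)) \<le> M / (1 + y)" by (simp add: z_def)
    qed (use R Q a in \<open>auto simp: M_def\<close>)
  qed
  have vertical: "norm (I f e1 e2) \<le> 2 * M * ln (1 + R)"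
  proof -
    define mid where "mid = complex_of_real (- a)"
    have "closed_segment e1 e2 \<subseteq> {z. Re z > - (1/2)} - {0}"
      using a by (auto simp: e1_e2_def dest!: closed_segment_coordinates)
    then have "I f e1 e2 = contour_integral (linepath e1 mid) (\<lambda>w. f w / w) + contour_integral (linepath mid e2) (\<lambda>w. f w / w)"
      unfolding I_def
    proof (intro contour_integral_split_linepath contf)
      show "mid \<in> closed_segment e1 e2"
        by (auto simp: mid_def e1_e2_def closed_segment_def complex_eq_iff intro!: exI[of _ "1/2"])
    qed
    also have "contour_integral (linepath e1 mid) (\<lambda>w. f w / w) = - contour_integral (linepath mid e1) (\<lambda>w. f w / w)"
      using vertc[of 1] by (intro contour_integral_reverse_linepath) (simp add: mid_def e1_e2_def closed_segment_commute)
    finally have "norm (I f e1 e2) \<le> norm (contour_integral (linepath mid e1) (\<lambda>w. f w / w))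
        + norm (contour_integral (linepath mid e2) (\<lambda>w. f w / w))"
      using norm_triangle_ineq[of "- contour_integral (linepath mid e1) (\<lambda>w. f w / w)"] by simp
    then show ?thesis using vert[of 1] vert[of "-1"] by (simp add: mid_def e1_e2_def)
  qed
  have n1: "norm (w2 - w1) = R" "norm (w3 - w2) = 2 * R" "norm (w4 - w3) = R" "norm (w1 - d2) = R" "norm (d1 - w4) = R"
     "norm (d2 - d1) = 2 * R" "norm (w1 - e2) = a" "norm (e1 - w4) = a"
    using R a by (auto simp: w1_w2_w3_w4_def d1_d2_def e1_e2_def cmod_def real_sqrt_mult)
  note W = w1_w2_w3_w4_def d1_d2_def e1_e2_def
  have "norm (I f w1 w2 - I g w1 w2) \<le> 3 / R\<^sup>2 * norm (w2 - w1)"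
    by (rule right, drule closed_segment_coordinates) (use R in \<open>auto simp: W min_def max_def\<close>)
  moreover have "norm (I f w2 w3 - I g w2 w3) \<le> 3 / R\<^sup>2 * norm (w3 - w2)"
    by (rule right, drule closed_segment_coordinates) (use R in \<open>auto simp: W min_def max_def\<close>)
  moreover have "norm (I f w3 w4 - I g w3 w4) \<le> 3 / R\<^sup>2 * norm (w4 - w3)"
    by (rule right, drule closed_segment_coordinates) (use R in \<open>auto simp: W min_def max_def\<close>)
  ultimately have r: "norm (I f w1 w2 - I g w1 w2) \<le> 3 / R\<^sup>2 * R" "norm (I f w2 w3 - I g w2 w3) \<le> 3 / R\<^sup>2 * (2 * R)"
     "norm (I f w3 w4 - I g w3 w4) \<le> 3 / R\<^sup>2 * R"
    by (simp_all only: n1)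
  have "norm (I g d2 w1) \<le> 6 / R\<^sup>2 * norm (w1 - d2)"
    by (rule left, drule closed_segment_coordinates) (use R in \<open>auto simp: W min_def max_def\<close>)
  moreover have "norm (I g w4 d1) \<le> 6 / R\<^sup>2 * norm (d1 - w4)"
    by (rule left, drule closed_segment_coordinates) (use R in \<open>auto simp: W min_def max_def\<close>)
  moreover have "norm (I g d1 d2) \<le> 6 / R\<^sup>2 * norm (d2 - d1)"
    by (rule left, drule closed_segment_coordinates) (use R in \<open>auto simp: W min_def max_def\<close>)
  ultimately have l: "norm (I g d2 w1) \<le> 6 / R\<^sup>2 * R" "norm (I g w4 d1) \<le> 6 / R\<^sup>2 * R" "norm (I g d1 d2) \<le> 6 / R\<^sup>2 * (2 * R)"
    by (simp_all only: n1)
  have "norm (I f e2 w1) \<le> 3 * Q / R\<^sup>2 * norm (w1 - e2)"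
    by (rule horiz, drule closed_segment_coordinates) (use R a in \<open>auto simp: W min_def max_def\<close>)
  moreover have "norm (I f w4 e1) \<le> 3 * Q / R\<^sup>2 * norm (e1 - w4)"
    by (rule horiz, drule closed_segment_coordinates) (use R a in \<open>auto simp: W min_def max_def\<close>)
  ultimately have h: "norm (I f e2 w1) \<le> 3 * Q / R\<^sup>2 * a" "norm (I f w4 e1) \<le> 3 * Q / R\<^sup>2 * a"
    by (simp_all only: n1)
  have "2 * pi * \<i> * moebius_poly N 1 = I g d2 w1 + I g w4 d1 + I g d1 d2
     - (I f w1 w2 - I g w1 w2) - (I f w2 w3 - I g w2 w3) - (I f w3 w4 - I g w3 w4)
     - I f e2 w1 - I f w4 e1 - I f e1 e2"
  proof -
    have "i1 + u1 + u2 + u3 + i4 + i5 = v1 + v2 + v3 - (w - u1) - (y - u2) - (z - u3) - x1 - x2 - x3"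
      if "x1 + w + y + z + x2 + x3 = 0" "i1 = v1" "i4 = v2" "i5 = v3"
      for i1 u1 u2 u3 i4 i5 v1 v2 v3 w y z x1 x2 x3 :: complex
    proof -
      have "v1 + v2 + v3 - (w - u1) - (y - u2) - (z - u3) - x1 - x2 - x3
        = v1 + u1 + u2 + u3 + v2 + v3 - (x1 + w + y + z + x2 + x3)"
        by (simp only: algebra_simps)
      then show ?thesis using that by simp
    qed
    from this[OF If refl refl refl] show ?thesis unfolding Ig[symmetric] .
  qed
  then have "norm (2 * pi * \<i> * moebius_poly N 1) \<le> norm (I g d2 w1) + norm (I g w4 d1) + norm (I g d1 d2)
     + norm (I f w1 w2 - I g w1 w2) + norm (I f w2 w3 - I g w2 w3) + norm (I f w3 w4 - I g w3 w4)
     + norm (I f e2 w1) + norm (I f w4 e1) + norm (I f e1 e2)"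
  proof -
    have "norm (b1 + b2 + b3 - b4 - b5 - b6 - b7 - b8 - b9) \<le> norm b1 + norm b2 + norm b3 + norm b4
       + norm b5 + norm b6 + norm b7 + norm b8 + norm b9" for b1 b2 b3 b4 b5 b6 b7 b8 b9 :: complex
      by (intro order_trans[OF norm_triangle_ineq4 add_right_mono] order_trans[OF norm_triangle_ineq add_right_mono] order_refl)
    then show ?thesis by (simp only: \<open>2 * pi * \<i> * moebius_poly N 1 = _\<close>)
  qed
  also have "\<dots> \<le> 6 / R\<^sup>2 * R + 6 / R\<^sup>2 * R + 6 / R\<^sup>2 * (2 * R) + 3 / R\<^sup>2 * R + 3 / R\<^sup>2 * (2 * R) + 3 / R\<^sup>2 * R
     + 3 * Q / R\<^sup>2 * a + 3 * Q / R\<^sup>2 * a + 2 * M * ln (1 + R)"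
    by (intro add_mono r l h vertical)
  also have "\<dots> = 36 / R + 3 * Q / R\<^sup>2 * (2 * a) + 2 * M * ln (1 + R)"
    using R by (simp add: power2_eq_square field_simps)
  also have "\<dots> \<le> 36 / R + 3 * Q / R\<^sup>2 * 1 + 2 * M * ln (1 + R)"
    using a Q by (intro add_right_mono add_left_mono mult_left_mono) auto
  finally show ?thesis by (simp add: norm_mult M_def Q_def R_def mult_ac)
qed

text \<open>The previous estimate with \<open>a\<close> slightly below \<open>1 / 2\<close>; logarithms and the
growth of the reciprocal of zeta only cost an arbitrarily small power of \<open>N\<close>.\<close>

lemma moebius_reciprocal_sum_bound:
  assumes RH: riemann_hypothesis and \<eta>: "\<eta> > 0"
  obtains C where "C > 0" "\<And>N. N \<ge> 1 \<Longrightarrow> \<bar>\<Sum>n = 1..N. moebius_mu n / real n\<bar> \<le> C * real N powr (\<eta> - 1 / 2)"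
proof -
  \<comment> \<open>A smaller exponent gives a stronger bound; it keeps \<open>a\<close> positive.\<close>
  define \<eta>' where "\<eta>' = min \<eta> (1 / 4)"
  have \<eta>': "\<eta>' > 0" "\<eta>' \<le> \<eta>" "\<eta>' \<le> 1 / 4" using \<eta> by (auto simp: \<eta>'_def)
  define a \<epsilon> where "a = 1 / 2 - \<eta>' / 2" and "\<epsilon> = \<eta>' / 8"
  have a: "0 < a" "a < 1 / 2" and \<epsilon>: "\<epsilon> > 0" "2 * \<epsilon> \<le> 1" using \<eta>' by (auto simp: a_def \<epsilon>_def)
  obtain K where K: "K > 0" "\<And>s. 1 / 2 + \<eta>' / 2 \<le> Re s \<Longrightarrow> Re s \<le> 1 \<Longrightarrow> norm (inv_zeta s) \<le> K * (1 + \<bar>Im s\<bar>) powr \<epsilon>"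
    using inv_zeta_bound[OF RH half_gt_zero[OF \<eta>'(1)] \<epsilon>(1)] by metis
  define C where "C = 36 + 6 * K + 4 * K * (2 / a + 4) / \<epsilon>"
  have bound: "\<bar>\<Sum>n = 1..N. moebius_mu n / real n\<bar> \<le> C * real N powr (\<eta> - 1 / 2)" if N: "N \<ge> 1" for N
  proof -
    define x where "x = real N"
    have x: "x \<ge> 1" using N by (simp add: x_def)
    define P where "P = x powr (\<eta> - 1 / 2)"
    have mono: "x powr u \<le> P" if "u \<le> \<eta>' - 1 / 2" for u
      unfolding P_def using x \<eta>' that by (intro powr_mono) auto
    have two: "(1 + x) powr u \<le> 2 * x powr u" if "0 \<le> u" "u \<le> 1" for u
    proof -
      have "(1 + x) powr u \<le> (2 * x) powr u" using x that by (intro powr_mono2) auto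
      also have "\<dots> = 2 powr u * x powr u" using x by (simp add: powr_mult)
      also have "\<dots> \<le> 2 powr 1 * x powr u" using that by (intro mult_right_mono powr_mono) auto
      finally show ?thesis by simp
    qed
    have t1: "36 / x \<le> 36 * P"
      using mono[of "-1"] \<eta>' x by (simp add: powr_minus_divide)
    have t2: "3 * K * (1 + x) powr \<epsilon> / x\<^sup>2 \<le> 6 * K * P"
    proof -
      have "3 * K * (1 + x) powr \<epsilon> / x\<^sup>2 \<le> 3 * K * (2 * x powr \<epsilon>) / x\<^sup>2"
        using K(1) two[of \<epsilon>] \<epsilon> by (intro divide_right_mono mult_left_mono) auto
      also have "\<dots> = 6 * K * x powr (\<epsilon> - 2)" using x by (simp add: powr_diff)
      also have "\<dots> \<le> 6 * K * P" using K(1) \<eta>' by (intro mult_left_mono mono) (auto simp: \<epsilon>_def)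
      finally show ?thesis .
    qed
    have t3: "2 * (K * (1 + x) powr \<epsilon> * x powr (- a) * (2 / a + 4)) * ln (1 + x) \<le> 4 * K * (2 / a + 4) / \<epsilon> * P"
    proof -
      have "2 * (K * (1 + x) powr \<epsilon> * x powr (- a) * (2 / a + 4)) * ln (1 + x)
        \<le> 2 * (K * (1 + x) powr \<epsilon> * x powr (- a) * (2 / a + 4)) * ((1 + x) powr \<epsilon> / \<epsilon>)"
        using ln_powr_bound[of "1 + x" \<epsilon>] x \<epsilon> K(1) a by (intro mult_left_mono) auto
      also have "\<dots> = 2 * K * (2 / a + 4) / \<epsilon> * ((1 + x) powr (2 * \<epsilon>) * x powr (- a))"
      proof -
        have "(1 + x) powr (2 * \<epsilon>) = (1 + x) powr \<epsilon> * (1 + x) powr \<epsilon>"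
          by (simp flip: powr_add)
        then show ?thesis by (simp only: times_divide_eq_right times_divide_eq_left mult_ac)
      qed
      also have "\<dots> \<le> 2 * K * (2 / a + 4) / \<epsilon> * ((2 * x powr (2 * \<epsilon>)) * x powr (- a))"
        using two[of "2 * \<epsilon>"] \<epsilon> K(1) a by (intro mult_left_mono mult_right_mono) auto
      also have "\<dots> = 4 * K * (2 / a + 4) / \<epsilon> * x powr (2 * \<epsilon> - a)"
        by (simp add: powr_diff powr_minus field_simps)
      also have "\<dots> \<le> 4 * K * (2 / a + 4) / \<epsilon> * P"
        using K(1) a \<epsilon> \<eta>' by (intro mult_left_mono mono) (auto simp: \<epsilon>_def a_def)
      finally show ?thesis .
    qed
    have "2 * pi * norm (moebius_poly N 1) \<le> 36 * P + 6 * K * P + 4 * K * (2 / a + 4) / \<epsilon> * P"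
    proof -
      have "2 * pi * norm (moebius_poly N 1) \<le> 36 / x + 3 * K * (1 + x) powr \<epsilon> / x\<^sup>2
         + 2 * (K * (1 + x) powr \<epsilon> * x powr (- a) * (2 / a + 4)) * ln (1 + x)"
        unfolding x_def
      proof (rule newman_estimate[OF RH a])
        show "norm (inv_zeta s) \<le> K * (1 + \<bar>Im s\<bar>) powr \<epsilon>" if "1 - a \<le> Re s" "Re s \<le> 1" for s
          by (rule K(2)) (use that in \<open>simp_all add: a_def\<close>)
      qed (use K(1) \<epsilon> N in auto)
      then show ?thesis using t1 t2 t3 by linarith
    qed
    also have "\<dots> = C * P" by (simp add: C_def algebra_simps)
    finally have *: "2 * pi * norm (moebius_poly N 1) \<le> C * P" .
    have "1 * norm (moebius_poly N 1) \<le> 2 * pi * norm (moebius_poly N 1)"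
      using pi_ge_two by (intro mult_right_mono) auto
    with * have "norm (moebius_poly N 1) \<le> C * P" by simp
    moreover have "moebius_poly N 1 = of_real (\<Sum>n = 1..N. moebius_mu n / real n)"
      unfolding moebius_poly_def of_real_sum
      by (intro sum.cong) (auto simp: powr_minus_divide)
    ultimately show ?thesis by (simp only: norm_of_real P_def x_def)
  qed
  have "C > 0" using K(1) a \<epsilon>
    unfolding C_def by (intro add_pos_pos mult_pos_pos divide_pos_pos) auto
  then show ?thesis using bound that by blast
qed

section \<open>The arithmetic of the resonance sum\<close>

text \<open>Half of the sum of \<open>1 - cos (2 \<pi> j / k)\<close>, where the cosines are the real parts of
all roots of unity of order \<open>k\<close>.\<close>

lemma sum_sin_squared_roots:
  assumes k: "k \<ge> 1"
  shows "(\<Sum>j<k. (sin (pi * real j / real k))\<^sup>2) = (if k = 1 then 0 else real k / 2)"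
proof (cases "k = 1")
  case False
  then have k2: "k \<ge> 2" using k by simp
  define u where "u = cis (2 * pi / real k)"
  have u1: "u \<noteq> 1"
  proof
    assume "u = 1"
    then have "cos (2 * pi / real k) = 1" by (simp add: u_def complex_eq_iff)
    then obtain n :: int where n: "2 * pi / real k = real_of_int n * 2 * pi"
      using cos_one_2pi_int by auto
    then have "real_of_int n * real k = 1" using k by (simp add: field_simps)
    then have "n * int k = 1" by (metis of_int_eq_1_iff of_int_mult of_int_of_nat_eq)
    then have "int k dvd 1" by (metis dvd_triv_right)
    then show False using k2 by simp
  qed
  have "u ^ k = cis (real k * (2 * pi / real k))" unfolding u_def by (rule Complex.DeMoivre)
  also have "real k * (2 * pi / real k) = 2 * pi" using k by simp
  finally have uk: "u ^ k = 1" by simp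
  have "(\<Sum>j<k. u ^ j) = 0" using geometric_sum[OF u1, of k] uk by simp
  then have "(\<Sum>j<k. Re (u ^ j)) = 0" by (metis Re_sum zero_complex.simps(1))
  moreover have "Re (u ^ j) = cos (2 * (pi * real j / real k))" for j
    by (simp add: u_def Complex.DeMoivre mult_ac)
  ultimately have c: "(\<Sum>j<k. cos (2 * (pi * real j / real k))) = 0" by simp
  have "(\<Sum>j<k. (sin (pi * real j / real k))\<^sup>2) = (\<Sum>j<k. 1 / 2 - cos (2 * (pi * real j / real k)) / 2)"
  proof (intro sum.cong refl)
    fix j
    show "(sin (pi * real j / real k))\<^sup>2 = 1 / 2 - cos (2 * (pi * real j / real k)) / 2"
      using cos_double_sin[of "pi * real j / real k"] by linarith
  qed
  also have "\<dots> = real k / 2" using c by (simp add: sum_subtractf flip: sum_divide_distrib)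
  finally show ?thesis using False by simp
qed simp

lemma sum_divisor_swap:
  fixes f :: "nat \<Rightarrow> nat \<Rightarrow> 'a :: comm_monoid_add"
  shows "(\<Sum>n = 1..D. \<Sum>d | d dvd n. f d (n div d)) = (\<Sum>d = 1..D. \<Sum>k = 1..D div d. f d k)"
proof -
  have fin: "finite {d. d dvd n}" if "n \<in> {1..D}" for n
    using that by (simp add: finite_divisors_nat)
  have "(\<Sum>n = 1..D. \<Sum>d | d dvd n. f d (n div d)) = (\<Sum>(n, d)\<in>Sigma {1..D} (\<lambda>n. {d. d dvd n}). f d (n div d))"
    using fin by (subst sum.Sigma) auto
  also have "\<dots> = (\<Sum>(d, k)\<in>Sigma {1..D} (\<lambda>d. {1..D div d}). f d k)"
  proof (rule sum.reindex_bij_witness[of _ "\<lambda>(d, k). (d * k, d)" "\<lambda>(n, d). (d, n div d)"])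
    fix a assume a: "a \<in> Sigma {1..D} (\<lambda>n. {d. d dvd n})"
    obtain n d where nd: "a = (n, d)" by (cases a)
    with a have n: "1 \<le> n" "n \<le> D" "d dvd n" by auto
    then have d: "1 \<le> d" "d \<le> n" by (auto intro: dvd_imp_le simp: Suc_le_eq dvd_pos_nat)
    have "1 \<le> n div d" "n div d \<le> D div d" using n d by (auto simp: Suc_le_eq div_greater_zero_iff div_le_mono)
    then show "(case a of (n, d) \<Rightarrow> (d, n div d)) \<in> Sigma {1..D} (\<lambda>d. {1..D div d})"
      using nd n d by auto
  next
    fix b assume b: "b \<in> Sigma {1..D} (\<lambda>d. {1..D div d})"
    obtain d k where dk: "b = (d, k)" by (cases b)
    have "d * k \<le> d * (D div d)" using b dk by (intro mult_le_mono2) auto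
    then have "d * k \<le> D" by (meson le_trans times_div_less_eq_dividend)
    then show "(case b of (d, k) \<Rightarrow> (d * k, d)) \<in> Sigma {1..D} (\<lambda>n. {d. d dvd n})"
      using b dk by auto
  qed auto
  also have "\<dots> = (\<Sum>d = 1..D. \<Sum>k = 1..D div d. f d k)"
    by (subst sum.Sigma) auto
  finally show ?thesis .
qed

text \<open>Coprimality is detected by the sum of the Moebius function over common divisors, and the fractions
with a given common divisor are all fractions with a smaller denominator.\<close>

lemma sum_sin_squared_coprime:
  assumes n: "n \<ge> 1"
  shows "(\<Sum>m | m \<le> n \<and> coprime m n. (sin (pi * real m / real n))\<^sup>2)
     = (\<Sum>d | d dvd n. moebius_mu d * (if n div d = 1 then 0 else real (n div d) / 2))"
proof -
  define s where "s = (\<lambda>m. (sin (pi * real m / real n))\<^sup>2)"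
  have fin: "finite {d. d dvd n}" using n by (simp add: finite_divisors_nat)
  have sn: "s n = 0" using n by (simp add: s_def)
  have "(\<Sum>m | m \<le> n \<and> coprime m n. s m) = (\<Sum>m<n. if coprime m n then s m else 0)"
  proof -
    have "(\<Sum>m | m \<le> n \<and> coprime m n. s m) = (\<Sum>m\<in>{..n}. if coprime m n then s m else 0)"
      by (subst sum.inter_filter[symmetric]) (auto intro!: sum.cong)
    also have "{..n} = insert n {..<n}" by auto
    also have "(\<Sum>m\<in>insert n {..<n}. if coprime m n then s m else 0) = (\<Sum>m<n. if coprime m n then s m else 0)"
      by (subst sum.insert) (auto simp only: sn finite_lessThan lessThan_iff less_irrefl if_cancel add_0)
    finally show ?thesis .
  qed
  also have "\<dots> = (\<Sum>m<n. \<Sum>d | d dvd n. if d dvd m then moebius_mu d * s m else 0)"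
  proof (intro sum.cong refl)
    fix m
    have "(\<Sum>d | d dvd n. if d dvd m then moebius_mu d * s m else 0) = (\<Sum>d\<in>{d. d dvd n} \<inter> {d. d dvd m}. moebius_mu d * s m)"
      using fin by (subst sum.inter_restrict) (auto intro!: sum.cong)
    also have "{d. d dvd n} \<inter> {d. d dvd m} = {d. d dvd gcd m n}" by auto
    also have "(\<Sum>d | d dvd gcd m n. moebius_mu d * s m) = (\<Sum>d | d dvd gcd m n. moebius_mu d) * s m"
      by (rule sum_distrib_right[symmetric])
    also have "\<dots> = (if coprime m n then s m else 0)"
      using n by (subst sum_moebius_mu_divisors) (auto simp: coprime_iff_gcd_eq_1)
    finally show "(if coprime m n then s m else 0) = (\<Sum>d | d dvd n. if d dvd m then moebius_mu d * s m else 0)" ..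
  qed
  also have "\<dots> = (\<Sum>d | d dvd n. \<Sum>m<n. if d dvd m then moebius_mu d * s m else 0)"
    by (rule sum.swap)
  also have "\<dots> = (\<Sum>d | d dvd n. moebius_mu d * (if n div d = 1 then 0 else real (n div d) / 2))"
  proof (intro sum.cong refl)
    fix d assume "d \<in> {d. d dvd n}"
    then obtain k where k: "n = d * k" by auto
    have dk: "d \<ge> 1" "k \<ge> 1" using k n by (auto simp: Suc_le_eq)
    have "(\<Sum>m<n. if d dvd m then moebius_mu d * s m else 0) = (\<Sum>m\<in>{..<n} \<inter> {m. d dvd m}. moebius_mu d * s m)"
      by (subst sum.inter_restrict) (auto intro!: sum.cong)
    also have "{..<n} \<inter> {m. d dvd m} = (*) d ` {..<k}"
      using dk by (auto simp: k elim!: dvdE)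
    also have "(\<Sum>m\<in>(*) d ` {..<k}. moebius_mu d * s m) = (\<Sum>j<k. moebius_mu d * s (d * j))"
      using dk by (subst sum.reindex) (auto simp: inj_on_def)
    also have "\<dots> = moebius_mu d * (\<Sum>j<k. (sin (pi * real j / real k))\<^sup>2)"
      using dk by (simp add: s_def k sum_distrib_left)
    finally show "(\<Sum>m<n. if d dvd m then moebius_mu d * s m else 0) = moebius_mu d * (if n div d = 1 then 0 else real (n div d) / 2)"
      using sum_sin_squared_roots[OF dk(2)] dk by (simp add: k)
  qed
  finally show ?thesis by (simp add: s_def)
qed

text \<open>For \<open>K * v \<ge> 1\<close> this is the sum over all \<open>k \<ge> 2\<close>. The term
\<open>k = 1\<close> is absent because the squared sines at fractions of denominator 1 vanish.\<close>

definition tooth_sum :: "nat \<Rightarrow> real \<Rightarrow> real" where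
  "tooth_sum K v = (\<Sum>k = 2..K. (max 0 (1 - real k * v))\<^sup>2)"

lemma has_real_derivative_max_square:
  "((\<lambda>v. (max 0 (1 - c * v))\<^sup>2) has_real_derivative (- 2 * c * max 0 (1 - c * v))) (at v)"
proof -
  have sq: "((\<lambda>x. (max 0 x)\<^sup>2) has_real_derivative 2 * max 0 x) (at x)" for x :: real
  proof (cases x "0::real" rule: linorder_cases)
    case less
    have "eventually (\<lambda>y. (0::real) = (max 0 y)\<^sup>2) (nhds x)"
      using eventually_nhds_in_open[of "{..<0}" x] less by (auto elim!: eventually_mono)
    then have "((\<lambda>x. (max 0 x)\<^sup>2) has_real_derivative 0) (at x)"
      by (rule DERIV_cong_ev[THEN iffD1, OF refl _ refl]) simp
    then show ?thesis using less by simp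
  next
    case equal
    have "((\<lambda>h. (max 0 h)\<^sup>2 / h) \<longlongrightarrow> 0) (at (0::real))"
    proof (rule Lim_null_comparison)
      show "\<forall>\<^sub>F h in at 0. norm ((max 0 h)\<^sup>2 / h) \<le> \<bar>h\<bar>"
        by (intro always_eventually allI) (auto simp: max_def power2_eq_square abs_mult)
      show "((\<lambda>h. \<bar>h\<bar>) \<longlongrightarrow> 0) (at (0::real))" by (rule tendsto_eq_intros refl | simp)+
    qed
    then show ?thesis using equal by (simp add: DERIV_def)
  next
    case greater
    have "eventually (\<lambda>y. y\<^sup>2 = (max 0 y)\<^sup>2) (nhds x)"
      using eventually_nhds_in_open[of "{0<..}" x] greater by (auto elim!: eventually_mono)
    moreover have "((\<lambda>x. x\<^sup>2) has_real_derivative 2 * x) (at x)"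
      by (auto intro!: derivative_eq_intros)
    ultimately have "((\<lambda>x. (max 0 x)\<^sup>2) has_real_derivative 2 * x) (at x)"
      using DERIV_cong_ev[OF refl] by fast
    then show ?thesis using greater by simp
  qed
  have "((\<lambda>v. (max 0 (1 - c * v))\<^sup>2) has_real_derivative (2 * max 0 (1 - c * v)) * (- c)) (at v)"
    by (rule DERIV_chain'[OF _ sq]) (auto intro!: derivative_eq_intros)
  then show ?thesis by (simp add: mult_ac)
qed

text \<open>The sum is a Riemann sum of step 1 for \<open>x * (1 - x * v)\<close> on the interval from 0 to
\<open>y = 1 / v\<close>. This function vanishes at both end points, so the error is of order 1;
since the integrand is a quadratic polynomial, the error can be computed exactly in terms of
\<open>y\<close> and its fractional part \<open>f\<close>.\<close>

lemma euler_maclaurin_tooth: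
  assumes v: "0 < v" "v \<le> 1" and K: "real K * v \<ge> 1"
  shows "\<bar>(\<Sum>k = 1..K. real k * max 0 (1 - real k * v)) - 1 / (6 * v\<^sup>2)\<bar> \<le> 1 / 3"
proof -
  define y where "y = 1 / v"
  define m where "m = nat \<lfloor>y\<rfloor>"
  define f where "f = y - real m"
  have y: "y \<ge> 1" using v by (simp add: y_def)
  have f: "0 \<le> f" "f \<le> 1" using y unfolding f_def m_def by linarith+
  have vy: "v = 1 / y" by (simp add: y_def)
  have "y \<le> real K" using K v by (simp add: y_def field_simps)
  then have mK: "m \<le> K" unfolding m_def by linarith
  have "(\<Sum>k = 1..K. real k * max 0 (1 - real k * v)) = (\<Sum>k = 1..m. real k * (1 - real k * v))"
  proof (rule sum.mono_neutral_cong_right)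
    show "\<forall>k\<in>{1..K} - {1..m}. real k * max 0 (1 - real k * v) = 0"
    proof
      fix k assume "k \<in> {1..K} - {1..m}"
      then have "real k \<ge> y" unfolding m_def by auto linarith
      then show "real k * max 0 (1 - real k * v) = 0" using y by (simp add: vy field_simps)
    qed
    show "real k * max 0 (1 - real k * v) = real k * (1 - real k * v)" if "k \<in> {1..m}" for k
    proof -
      have "real k \<le> y" using that f by (auto simp: f_def)
      then show ?thesis using y by (simp add: vy field_simps)
    qed
  qed (use mK in auto)
  also have "\<dots> = (\<Sum>k = 1..m. real k) - (\<Sum>k = 1..m. (real k)\<^sup>2) * v"
    by (simp add: algebra_simps power2_eq_square sum_subtractf sum_distrib_left)
  also have "(\<Sum>k = 1..m. real k) = real m * (real m + 1) / 2"
    by (induction m) (auto simp: field_simps)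
  also have "(\<Sum>k = 1..m. (real k)\<^sup>2) = real m * (real m + 1) * (2 * real m + 1) / 6"
    by (induction m) (auto simp: field_simps power2_eq_square)
  finally have S: "(\<Sum>k = 1..K. real k * max 0 (1 - real k * v))
      = real m * (real m + 1) / 2 - real m * (real m + 1) * (2 * real m + 1) / 6 * v" .
  have m: "real m = y - f" by (simp add: f_def)
  have "6 * y * ((\<Sum>k = 1..K. real k * max 0 (1 - real k * v)) - 1 / (6 * v\<^sup>2))
     = (- f * (1 - f) - (1 - 2 * f)\<^sup>2) * y + f * (1 - f) * (1 - 2 * f)"
    unfolding S unfolding m vy using y by (simp add: field_simps power2_eq_square power3_eq_cube) (simp add: algebra_simps)?
  moreover have "\<bar>(- f * (1 - f) - (1 - 2 * f)\<^sup>2) * y + f * (1 - f) * (1 - 2 * f)\<bar> \<le> 2 * y"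
  proof -
    have "- f * (1 - f) - (1 - 2 * f)\<^sup>2 = - 1 + 3 * (f * (1 - f))" by (simp add: power2_eq_square algebra_simps)
    moreover have ff: "0 \<le> f * (1 - f)" "f * (1 - f) \<le> 1 / 4"
      using f zero_le_power2[of "f - 1 / 2"] by (simp_all add: power2_eq_square field_simps mult_left_le)
    ultimately have "\<bar>- f * (1 - f) - (1 - 2 * f)\<^sup>2\<bar> \<le> 1" by linarith
    then have "\<bar>(- f * (1 - f) - (1 - 2 * f)\<^sup>2) * y\<bar> \<le> 1 * y"
      unfolding abs_mult using y by (intro mult_mono) auto
    moreover have "\<bar>f * (1 - f) * (1 - 2 * f)\<bar> \<le> (1 / 4) * 1"
      unfolding abs_mult[of "f * (1 - f)"] using ff f by (intro mult_mono) auto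
    ultimately show ?thesis using y by linarith
  qed
  ultimately have b: "\<bar>6 * y * ((\<Sum>k = 1..K. real k * max 0 (1 - real k * v)) - 1 / (6 * v\<^sup>2))\<bar> \<le> 2 * y"
    by simp
  have "\<bar>e\<bar> \<le> 1 / 3" if "\<bar>6 * y * e\<bar> \<le> 2 * y" for e
  proof -
    have "6 * y * \<bar>e\<bar> \<le> 2 * y" using that y by (simp add: abs_mult)
    then show ?thesis using y by simp
  qed
  from this[OF b] show ?thesis .
qed

text \<open>The derivative of \<open>tooth_sum\<close> is, up to the term \<open>k = 1\<close>, twice the sum
estimated above, and the main term \<open>1 / (6 * v\<^sup>2)\<close> of that sum is cancelled by
the derivative of \<open>1 / (3 * v)\<close>.\<close>

lemma tooth_sum_lipschitz:
  assumes u: "0 < u" "u \<le> w" "w \<le> 1" and K: "real K * u \<ge> 1" "K \<ge> 1"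
  shows "\<bar>(tooth_sum K u - 1 / (3 * u)) - (tooth_sum K w - 1 / (3 * w))\<bar> \<le> 3 * (w - u)"
proof (cases "u = w")
  case False
  then have uw: "u < w" using u by simp
  define D where "D = (\<lambda>v. (\<Sum>k = 2..K. - 2 * real k * max 0 (1 - real k * v)) + 1 / (3 * v\<^sup>2))"
  have "\<exists>z. u < z \<and> z < w \<and> (tooth_sum K w - 1 / (3 * w)) - (tooth_sum K u - 1 / (3 * u)) = (w - u) * D z"
  proof (rule MVT2[OF uw])
    fix x assume x: "u \<le> x" "x \<le> w"
    show "((\<lambda>v. tooth_sum K v - 1 / (3 * v)) has_real_derivative D x) (at x)"
    proof -
      have 1: "((\<lambda>v. tooth_sum K v) has_real_derivative (\<Sum>k = 2..K. - 2 * real k * max 0 (1 - real k * x))) (at x)"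
        unfolding tooth_sum_def by (intro DERIV_sum has_real_derivative_max_square)
      have 2: "((\<lambda>v. 1 / (3 * v)) has_real_derivative (- 1 / (3 * x\<^sup>2))) (at x)"
        using x u by (auto intro!: derivative_eq_intros simp: power2_eq_square field_simps)
      show ?thesis using DERIV_diff[OF 1 2] by (simp add: D_def)
    qed
  qed
  then obtain z where z: "u < z" "z < w" "(tooth_sum K w - 1 / (3 * w)) - (tooth_sum K u - 1 / (3 * u)) = (w - u) * D z"
    by blast
  have "real K * u \<le> real K * z" using z by (intro mult_left_mono) auto
  then have "real K * z \<ge> 1" using K by linarith
  then have em: "\<bar>(\<Sum>k = 1..K. real k * max 0 (1 - real k * z)) - 1 / (6 * z\<^sup>2)\<bar> \<le> 1 / 3"
    using z u by (intro euler_maclaurin_tooth) auto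
  have "{1..K} = insert 1 {2..K}" using K by auto
  then have "D z = -2 * ((\<Sum>k = 1..K. real k * max 0 (1 - real k * z)) - 1 / (6 * z\<^sup>2)) + 2 * max 0 (1 - z)"
    unfolding D_def by (simp add: sum_distrib_left sum_negf algebra_simps)
  moreover have "0 \<le> max 0 (1 - z)" "max 0 (1 - z) \<le> 1" using z u by auto
  moreover have "\<bar>x\<bar> \<le> 3" if "x = - 2 * e + 2 * b" "0 \<le> b" "b \<le> 1" "\<bar>e\<bar> \<le> 1 / 3" for x e b :: real
    using that by linarith
  ultimately have "\<bar>D z\<bar> \<le> 3" using em by blast
  then have "\<bar>(w - u) * D z\<bar> \<le> (w - u) * 3" unfolding abs_mult using uw by (intro mult_mono) auto
  then show ?thesis using z(3) by linarith
qed (use u in simp)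

lemma summation_by_parts:
  fixes g r :: "nat \<Rightarrow> real"
  shows "m \<le> n \<Longrightarrow> (\<Sum>d = Suc m..Suc n. (g d - g (d - 1)) * r d)
    = g (Suc n) * r (Suc n) - g m * r (Suc m) + (\<Sum>d = Suc m..n. g d * (r d - r (Suc d)))"
proof (induction n rule: nat_induct_at_least)
  case base
  then show ?case by (simp add: left_diff_distrib)
next
  case (Suc n)
  have 1: "{Suc m..Suc (Suc n)} = insert (Suc (Suc n)) {Suc m..Suc n}"
    "{Suc m..Suc n} = insert (Suc n) {Suc m..n}" using Suc.hyps by auto
  have "(\<Sum>d = Suc m..Suc (Suc n). (g d - g (d - 1)) * r d)
     = (g (Suc (Suc n)) - g (Suc n)) * r (Suc (Suc n)) + (\<Sum>d = Suc m..Suc n. (g d - g (d - 1)) * r d)"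
    unfolding 1(1) by (subst sum.insert) auto
  also have "\<dots> = (g (Suc (Suc n)) - g (Suc n)) * r (Suc (Suc n)) + (g (Suc n) * r (Suc n) - g m * r (Suc m)
      + (\<Sum>d = Suc m..n. g d * (r d - r (Suc d))))"
    by (simp only: Suc.IH)
  also have "\<dots> = g (Suc (Suc n)) * r (Suc (Suc n)) - g m * r (Suc m) +
      (g (Suc n) * (r (Suc n) - r (Suc (Suc n))) + (\<Sum>d = Suc m..n. g d * (r d - r (Suc d))))"
    by (simp only: left_diff_distrib right_diff_distrib)
  also have "g (Suc n) * (r (Suc n) - r (Suc (Suc n))) + (\<Sum>d = Suc m..n. g d * (r d - r (Suc d)))
     = (\<Sum>d = Suc m..Suc n. g d * (r d - r (Suc d)))"
    unfolding 1(2) by (subst sum.insert) auto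
  finally show ?case .
qed

text \<open>After the coprimality condition is resolved, writing \<open>n = d * k\<close> leaves for each
\<open>d\<close> the sum of \<open>(1 - k * d / X)\<^sup>2\<close> over \<open>k \<ge> 2\<close>.\<close>

lemma resonance_moebius_sum:
  assumes X: "X \<ge> 1"
  defines "D \<equiv> nat \<lfloor>X\<rfloor>"
  shows "(\<Sum>n = 1..D. \<Sum>m | m \<le> n \<and> coprime m n. (sin (pi * real m / real n))\<^sup>2 * (1 - real n / X)\<^sup>2 / real n)
    = (\<Sum>d = 1..D. moebius_mu d / real d * tooth_sum D (real d / X)) / 2"
proof -
  define w where "w = (\<lambda>n. (1 - real n / X)\<^sup>2 / real n)"
  have Dx: "real n \<le> X \<longleftrightarrow> n \<le> D" for n using X unfolding D_def by linarith
  have "(\<Sum>n = 1..D. \<Sum>m | m \<le> n \<and> coprime m n. (sin (pi * real m / real n))\<^sup>2 * (1 - real n / X)\<^sup>2 / real n)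
    = (\<Sum>n = 1..D. \<Sum>d | d dvd n. moebius_mu d * (if n div d = 1 then 0 else real (n div d) / 2) * w (d * (n div d)))"
  proof (rule sum.cong[OF refl])
    fix n assume n: "n \<in> {1..D}"
    have "(\<Sum>m | m \<le> n \<and> coprime m n. (sin (pi * real m / real n))\<^sup>2 * (1 - real n / X)\<^sup>2 / real n)
      = (\<Sum>m | m \<le> n \<and> coprime m n. (sin (pi * real m / real n))\<^sup>2) * w n"
      unfolding w_def sum_distrib_right by (intro sum.cong) simp_all
    also have "\<dots> = (\<Sum>d | d dvd n. moebius_mu d * (if n div d = 1 then 0 else real (n div d) / 2)) * w n"
      using n by (subst sum_sin_squared_coprime) auto
    also have "\<dots> = (\<Sum>d | d dvd n. moebius_mu d * (if n div d = 1 then 0 else real (n div d) / 2) * w (d * (n div d)))"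
      by (subst sum_distrib_right) (auto intro!: sum.cong)
    finally show "(\<Sum>m | m \<le> n \<and> coprime m n. (sin (pi * real m / real n))\<^sup>2 * (1 - real n / X)\<^sup>2 / real n)
      = (\<Sum>d | d dvd n. moebius_mu d * (if n div d = 1 then 0 else real (n div d) / 2) * w (d * (n div d)))" .
  qed
  also have "\<dots> = (\<Sum>d = 1..D. \<Sum>k = 1..D div d. moebius_mu d * (if k = 1 then 0 else real k / 2) * w (d * k))"
    by (rule sum_divisor_swap)
  also have "\<dots> = (\<Sum>d = 1..D. moebius_mu d / real d * tooth_sum D (real d / X) / 2)"
  proof (rule sum.cong[OF refl])
    fix d assume d: "d \<in> {1..D}"
    have "tooth_sum D (real d / X) = (\<Sum>k = 1..D div d. if k = 1 then 0 else (1 - real k * (real d / X))\<^sup>2)"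
      unfolding tooth_sum_def
    proof (rule sum.mono_neutral_cong)
      fix k assume "k \<in> {2..D} - {1..D div d}"
      then have "\<not> k * d \<le> D" using d by (auto simp: less_eq_div_iff_mult_less_eq)
      then have "real k * real d > X" using Dx[of "k * d"] by simp
      then show "(max 0 (1 - real k * (real d / X)))\<^sup>2 = 0" using X by (simp add: field_simps)
    next
      fix k assume k: "k \<in> {1..D div d} - {2..D}"
      then have "k \<le> D" by (meson DiffD1 atLeastAtMost_iff div_le_dividend le_trans)
      then show "(if k = 1 then 0 else (1 - real k * (real d / X))\<^sup>2) = 0" using k by auto
    next
      fix k assume k: "k \<in> {2..D} \<inter> {1..D div d}"
      then have "k * d \<le> D" using d by (auto simp: less_eq_div_iff_mult_less_eq)
      then have "real k * real d \<le> X" using Dx[of "k * d"] by simp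
      then show "(max 0 (1 - real k * (real d / X)))\<^sup>2 = (if k = 1 then 0 else (1 - real k * (real d / X))\<^sup>2)"
        using X k by (simp add: field_simps max_def)
    qed auto
    also have "moebius_mu d / real d * \<dots> / 2
        = (\<Sum>k = 1..D div d. moebius_mu d * (if k = 1 then 0 else real k / 2) * w (d * k))"
      unfolding sum_distrib_left sum_divide_distrib
      using d by (intro sum.cong refl) (auto simp: w_def field_simps)
    finally show "(\<Sum>k = 1..D div d. moebius_mu d * (if k = 1 then 0 else real k / 2) * w (d * k))
       = moebius_mu d / real d * tooth_sum D (real d / X) / 2" ..
  qed
  finally show ?thesis by (simp add: sum_divide_distrib)
qed

lemma of_nat_powr_minus_2: "n > 0 \<Longrightarrow> (of_nat n :: complex) powr (- 2) = 1 / (of_nat n)\<^sup>2"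
proof -
  assume n: "n > 0"
  have "(of_nat n :: complex) powr (of_nat 2) = of_nat n ^ 2"
    by (rule powr_complexpow) (use n in simp)
  then have "(of_nat n :: complex) powr 2 = of_nat n ^ 2" by simp
  then show ?thesis by (simp only: powr_minus_divide)
qed

lemma sum_moebius_squares: "(\<lambda>n. moebius_mu n / (real n)\<^sup>2) sums (6 / pi\<^sup>2)"
proof -
  have "(\<lambda>n. of_nat (Suc n) powr (- 2)) sums riemann_zeta 2"
    by (rule riemann_zeta_series) simp
  moreover have "(\<lambda>n. of_nat (Suc n) powr (- 2)) = (\<lambda>n. complex_of_real (1 / (real n + 1)\<^sup>2))"
  proof
    fix n
    have "(of_nat (Suc n) :: complex) powr (- 2) = 1 / (of_nat (Suc n))\<^sup>2"
      by (rule of_nat_powr_minus_2) simp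
    also have "\<dots> = complex_of_real (1 / (real n + 1)\<^sup>2)"
      by (simp add: add_ac)
    finally show "(of_nat (Suc n) :: complex) powr (- 2) = complex_of_real (1 / (real n + 1)\<^sup>2)" .
  qed
  moreover have "(\<lambda>n. complex_of_real (1 / (real n + 1)\<^sup>2)) sums of_real (pi\<^sup>2 / 6)"
  proof -
    have "(\<lambda>n. 1 / (real n + 1)\<^sup>2) sums (pi\<^sup>2 / 6)"
      using inverse_squares_sums by (simp add: add_ac)
    then show ?thesis by (simp only: sums_of_real_iff)
  qed
  ultimately have z2: "riemann_zeta 2 = of_real (pi\<^sup>2 / 6)" using sums_unique2 by metis
  have "((\<lambda>n. of_real (moebius_mu n) * of_nat n powr (- 2)) has_sum (1 / riemann_zeta 2)) {1..}"
    by (rule moebius_mu_dirichlet_series) simp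
  then have "((\<lambda>n. of_real (moebius_mu n) * of_nat n powr (- 2)) has_sum (complex_of_real (6 / pi\<^sup>2))) {1..}"
    by (simp add: z2)
  also have "?this \<longleftrightarrow> ((\<lambda>n. of_real (moebius_mu n / (real n)\<^sup>2)) has_sum (complex_of_real (6 / pi\<^sup>2))) UNIV"
  proof (rule has_sum_cong_neutral)
    fix n :: nat assume n: "n \<in> {1..} \<inter> UNIV"
    have "(of_nat n :: complex) powr (- 2) = 1 / (of_nat n)\<^sup>2"
      using n by (intro of_nat_powr_minus_2) auto
    then show "of_real (moebius_mu n) * of_nat n powr (- 2) = complex_of_real (moebius_mu n / (real n)\<^sup>2)" by simp
  next
    fix n :: nat assume "n \<in> UNIV - {1..}"
    then have "n = 0" by auto
    then show "complex_of_real (moebius_mu n / (real n)\<^sup>2) = 0" by simp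
  qed auto
  finally have "(\<lambda>n. complex_of_real (moebius_mu n / (real n)\<^sup>2)) sums of_real (6 / pi\<^sup>2)"
    by (rule has_sum_imp_sums)
  then show ?thesis by (simp only: sums_of_real_iff)
qed

text \<open>In the formula just proved, the term \<open>1 / (3 * v)\<close> of \<open>tooth_sum\<close> at
\<open>v = d / X\<close> gives the main term through the sum of
\<open>moebius_mu d / d\<^sup>2\<close>. The rest is Lipschitz in \<open>d / X\<close>, so that
summation by parts bounds it, as well as the tail of the main term, by the partial sums of
\<open>moebius_mu d / d\<close>.\<close>

lemma resonance_estimate:
  assumes RH: riemann_hypothesis and \<eta>: "\<eta> > 0" "\<eta> < 1 / 2"
  shows "\<exists>C. \<forall>X\<ge>1.
    \<bar>pi * (\<Sum>n = 1..nat \<lfloor>X\<rfloor>. \<Sum>m | m \<le> n \<and> coprime m n.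
        (sin (pi * real m / real n))\<^sup>2 * (1 - real n / X)\<^sup>2 / real n) - X / pi\<bar> \<le> C * X powr (\<eta> - 1 / 2)"
proof -
  define a where "a = (\<lambda>d. moebius_mu d / real d)"
  define g where "g = (\<lambda>N. \<Sum>n = 1..N. a n)"
  obtain C where C: "C > 0" "\<And>N. N \<ge> 1 \<Longrightarrow> \<bar>g N\<bar> \<le> C * real N powr (\<eta> - 1 / 2)"
    using moebius_reciprocal_sum_bound[OF RH \<eta>(1)] unfolding g_def a_def by metis
  have ag: "a d = g d - g (d - 1)" if "d \<ge> 1" for d
    using that by (cases d) (auto simp: g_def)
  have tail: "\<bar>6 / pi\<^sup>2 - (\<Sum>d = 1..D. a d / real d)\<bar> \<le> 2 * C * real D powr (\<eta> - 1 / 2) / real D"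
    if D: "D \<ge> 1" for D
  proof -
    define P where "P = C * real D powr (\<eta> - 1 / 2)"
    have P: "P \<ge> 0" using C by (simp add: P_def)
    have gP: "\<bar>g d\<bar> \<le> P" if "d \<ge> D" for d
    proof -
      have "real d powr (\<eta> - 1 / 2) \<le> real D powr (\<eta> - 1 / 2)"
        using that D \<eta> by (intro powr_mono2') auto
      then have "C * real d powr (\<eta> - 1 / 2) \<le> P"
        unfolding P_def using C(1) by (intro mult_left_mono) auto
      then show ?thesis using C(2)[of d] that D by linarith
    qed
    have part: "\<bar>(\<Sum>d = Suc D..Suc E. a d / real d)\<bar> \<le> 2 * P / real D" if E: "E \<ge> D" for E
    proof -
      define r where "r = (\<lambda>d. 1 / real d)"
      have rpos: "r d \<ge> 0" for d by (simp add: r_def)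
      have rdec: "r (Suc d) \<le> r d" if "d \<ge> 1" for d using that by (simp add: r_def field_simps)
      have tele: "(\<Sum>d = Suc D..E. r d - r (Suc d)) = r (Suc D) - r (Suc E)"
        using sum_Suc_diff'[of "Suc D" "Suc E" "\<lambda>d. - r d"] E by (simp add: atLeastLessThanSuc_atLeastAtMost)
      have "(\<Sum>d = Suc D..Suc E. a d / real d) = (\<Sum>d = Suc D..Suc E. (g d - g (d - 1)) * r d)"
        by (intro sum.cong refl) (simp add: ag r_def)
      also have "\<dots> = g (Suc E) * r (Suc E) - g D * r (Suc D) + (\<Sum>d = Suc D..E. g d * (r d - r (Suc d)))"
        using E by (rule summation_by_parts)
      also have "\<bar>\<dots>\<bar> \<le> P * r (Suc E) + P * r (Suc D) + (\<Sum>d = Suc D..E. P * (r d - r (Suc d)))"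
      proof -
        have "\<bar>g (Suc E) * r (Suc E)\<bar> \<le> P * r (Suc E)" "\<bar>g D * r (Suc D)\<bar> \<le> P * r (Suc D)"
          using gP[of "Suc E"] gP[of D] E rpos P by (auto simp: abs_mult intro!: mult_mono)
        moreover have "\<bar>\<Sum>d = Suc D..E. g d * (r d - r (Suc d))\<bar> \<le> (\<Sum>d = Suc D..E. P * (r d - r (Suc d)))"
        proof (intro order_trans[OF sum_abs] sum_mono)
          fix d assume d: "d \<in> {Suc D..E}"
          then have "r (Suc d) \<le> r d" using D by (intro rdec) auto
          then show "\<bar>g d * (r d - r (Suc d))\<bar> \<le> P * (r d - r (Suc d))"
            using gP[of d] d by (auto simp: abs_mult intro!: mult_right_mono)
        qed
        ultimately show ?thesis by linarith
      qed
      also have "\<dots> = 2 * P * r (Suc D)"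
        unfolding sum_distrib_left[symmetric] tele by (simp add: algebra_simps)
      also have "\<dots> \<le> 2 * P * r D" using P rdec[OF D] by (intro mult_left_mono) auto
      finally show ?thesis by (simp add: r_def)
    qed
    have "(\<lambda>n. \<Sum>d<n. moebius_mu d / (real d)\<^sup>2) \<longlonglongrightarrow> 6 / pi\<^sup>2"
      using sum_moebius_squares by (simp add: sums_def)
    then have "(\<lambda>E. \<Sum>d<Suc (Suc E). moebius_mu d / (real d)\<^sup>2) \<longlonglongrightarrow> 6 / pi\<^sup>2"
      by (intro LIMSEQ_Suc)
    moreover have "(\<Sum>d<Suc (Suc E). moebius_mu d / (real d)\<^sup>2) = (\<Sum>d = 1..Suc E. a d / real d)" for E
      by (rule sum.mono_neutral_cong_right) (auto simp: a_def power2_eq_square Suc_le_eq)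
    ultimately have "(\<lambda>E. \<Sum>d = 1..Suc E. a d / real d) \<longlonglongrightarrow> 6 / pi\<^sup>2" by simp
    then have lim: "(\<lambda>E. \<bar>(\<Sum>d = 1..Suc E. a d / real d) - (\<Sum>d = 1..D. a d / real d)\<bar>)
       \<longlonglongrightarrow> \<bar>6 / pi\<^sup>2 - (\<Sum>d = 1..D. a d / real d)\<bar>"
      by (intro tendsto_intros)
    have "\<bar>(\<Sum>d = 1..Suc E. a d / real d) - (\<Sum>d = 1..D. a d / real d)\<bar> \<le> 2 * P / real D" if E: "E \<ge> D" for E
    proof -
      have "{1..Suc E} = {1..D} \<union> {Suc D..Suc E}" using E by auto
      then have "(\<Sum>d = 1..Suc E. a d / real d) = (\<Sum>d = 1..D. a d / real d) + (\<Sum>d = Suc D..Suc E. a d / real d)"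
        by (simp only:) (rule sum.union_disjoint, auto)
      then show ?thesis using part[OF E] by simp
    qed
    then have "\<exists>N. \<forall>E\<ge>N. \<bar>(\<Sum>d = 1..Suc E. a d / real d) - (\<Sum>d = 1..D. a d / real d)\<bar> \<le> 2 * P / real D"
      by blast
    from LIMSEQ_le_const2[OF lim this] show ?thesis by (simp only: P_def mult.assoc)
  qed
  define y where "y = \<eta> + 1 / 2"
  have y: "y > 0" "y - 1 = \<eta> - 1 / 2" using \<eta> by (auto simp: y_def)
  define B where "B = 4 * C + 3 * C * (1 / y + 1) + 2 * C"
  have main: "\<bar>pi * (\<Sum>n = 1..nat \<lfloor>X\<rfloor>. \<Sum>m | m \<le> n \<and> coprime m n.
        (sin (pi * real m / real n))\<^sup>2 * (1 - real n / X)\<^sup>2 / real n) - X / pi\<bar> \<le> (4 * B) * X powr (\<eta> - 1 / 2)"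
    if X: "X \<ge> 1" for X
  proof -
    define D where "D = nat \<lfloor>X\<rfloor>"
    have D123: "D \<ge> 1" "real D \<le> X" "X \<le> real D + 1" using X unfolding D_def by linarith+
    then have D: "D \<ge> 1" "real D \<le> X" "X \<le> real D + 1" "X \<le> 2 * real D" by simp_all
    define Q where "Q = real D powr (\<eta> - 1 / 2)"
    have Q: "Q \<ge> 0" by (simp add: Q_def)
    \<comment> \<open>The cutoff \<open>Suc D\<close> exceeds \<open>X\<close>, as the Lipschitz bound requires; the additional term vanishes.\<close>
    define \<rho> where "\<rho> = (\<lambda>d. tooth_sum (Suc D) (real d / X) - 1 / (3 * (real d / X)))"
    have ts: "tooth_sum (Suc D) (real d / X) = tooth_sum D (real d / X)" if "d \<ge> 1" for d
    proof -
      have "X \<le> (real D + 1) * real d"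
      proof -
        have "(real D + 1) * 1 \<le> (real D + 1) * real d" using that by (intro mult_left_mono) auto
        with D(3) show ?thesis by (metis mult.right_neutral order_trans)
      qed
      then have "1 - real (Suc D) * (real d / X) \<le> 0" using X by (simp add: field_simps)
      then have "(max 0 (1 - real (Suc D) * (real d / X)))\<^sup>2 = 0" by (simp only: max_absorb1) simp
      moreover have "{2..Suc D} = insert (Suc D) {2..D}" using D(1) by auto
      ultimately show ?thesis unfolding tooth_sum_def by (simp only:) simp
    qed
    have lip: "\<bar>\<rho> d - \<rho> e\<bar> \<le> 3 * (real e / X - real d / X)" if "1 \<le> d" "d \<le> e" "e \<le> D" for d e
      unfolding \<rho>_def
    proof (rule tooth_sum_lipschitz)
      have "X \<le> (real D + 1) * real d"
      proof -
        have "(real D + 1) * 1 \<le> (real D + 1) * real d" using that by (intro mult_left_mono) auto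
        with D(3) show ?thesis by (metis mult.right_neutral order_trans)
      qed
      then show "1 \<le> real (Suc D) * (real d / X)" using X by (simp add: field_simps)
    qed (use that D X in \<open>auto simp: field_simps\<close>)
    have \<rho>D: "\<bar>\<rho> D\<bar> \<le> 4"
    proof -
      have "1 / 2 \<le> real D / X" "real D / X \<le> 1" using D X by (auto simp: field_simps)
      moreover have "tooth_sum (Suc D) (real D / X) = 0"
        unfolding tooth_sum_def
      proof (rule sum.neutral, rule ballI)
        fix k assume "k \<in> {2..Suc D}"
        then have "real k * (real D / X) \<ge> 2 * (1 / 2)" using \<open>1 / 2 \<le> real D / X\<close> by (intro mult_mono) auto
        then show "(max 0 (1 - real k * (real D / X)))\<^sup>2 = 0" by (simp only: max_absorb1) simp
      qed
      ultimately show ?thesis using X D by (simp add: \<rho>_def field_simps)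
    qed
    have osc: "\<bar>\<Sum>d = 1..D. a d * \<rho> d\<bar> \<le> (4 * C + 3 * C * (1 / y + 1)) * Q"
    proof -
      obtain E where E: "D = Suc E" using D(1) by (cases D) auto
      have "(\<Sum>d = 1..D. a d * \<rho> d) = (\<Sum>d = Suc 0..Suc E. (g d - g (d - 1)) * \<rho> d)"
        unfolding E by (intro sum.cong) (auto simp: ag)
      also have "\<dots> = g D * \<rho> D + (\<Sum>d = Suc 0..E. g d * (\<rho> d - \<rho> (Suc d)))"
        by (subst summation_by_parts) (auto simp: E g_def)
      also have "\<bar>\<dots>\<bar> \<le> (C * Q) * 4 + (3 * C / X) * ((1 / y + 1) * (real D * Q))"
      proof -
        have 1: "\<bar>g D * \<rho> D\<bar> \<le> (C * Q) * 4"
          unfolding abs_mult Q_def using C(2)[OF D(1)] \<rho>D C(1) by (intro mult_mono) auto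
        have "\<bar>\<Sum>d = Suc 0..E. g d * (\<rho> d - \<rho> (Suc d))\<bar> \<le> (\<Sum>d = 1..E. (C * real d powr (y - 1)) * (3 / X))"
        proof (simp only: One_nat_def, intro order_trans[OF sum_abs] sum_mono)
          fix d assume d: "d \<in> {Suc 0..E}"
          have "\<bar>\<rho> d - \<rho> (Suc d)\<bar> \<le> 3 * (real (Suc d) / X - real d / X)"
            using d E by (intro lip) auto
          also have "\<dots> = 3 / X" by (simp add: add_divide_distrib)
          finally show "\<bar>g d * (\<rho> d - \<rho> (Suc d))\<bar> \<le> (C * real d powr (y - 1)) * (3 / X)"
            unfolding abs_mult using C(2)[of d] d C(1) y(2) by (intro mult_mono) auto
        qed
        also have "\<dots> = (3 * C / X) * (\<Sum>d = 1..E. real d powr (y - 1))"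
          by (simp add: sum_distrib_left mult_ac)
        also have "\<dots> \<le> (3 * C / X) * (\<Sum>d = 1..D. real d powr (y - 1))"
          using C(1) X E by (intro mult_left_mono sum_mono2) auto
        also have "\<dots> \<le> (3 * C / X) * (real D powr y / y + real D powr (y - 1))"
          using C(1) X by (intro mult_left_mono sum_powr_bound y D) auto
        also have "\<dots> \<le> (3 * C / X) * ((1 / y + 1) * (real D * Q))"
        proof (intro mult_left_mono)
          have Dy: "real D powr y = real D * Q"
            using D(1) y(2) powr_mult_base[of "real D" "y - 1"] by (simp add: Q_def y_def add.commute)
          have "real D powr (y - 1) \<le> real D * Q" using D(1) Q unfolding y(2) Q_def[symmetric]
            by (simp add: mult_le_cancel_right1)
          then show "real D powr y / y + real D powr (y - 1) \<le> (1 / y + 1) * (real D * Q)"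
            unfolding Dy by (simp add: algebra_simps)
        qed (use C(1) X in auto)
        finally show ?thesis using 1 by linarith
      qed
      also have "(3 * C / X) * ((1 / y + 1) * (real D * Q)) = 3 * C * (1 / y + 1) * Q * (real D / X)" by simp
      also have "\<dots> \<le> 3 * C * (1 / y + 1) * Q * 1"
        using C(1) y(1) Q D X by (intro mult_left_mono) (auto simp: field_simps)
      finally show ?thesis by (simp add: algebra_simps)
    qed
    have "(\<Sum>d = 1..D. moebius_mu d / real d * tooth_sum D (real d / X)) = (\<Sum>d = 1..D. a d * \<rho> d + X / 3 * (a d / real d))"
    proof (intro sum.cong refl)
      fix d assume "d \<in> {1..D}"
      then show "moebius_mu d / real d * tooth_sum D (real d / X) = a d * \<rho> d + X / 3 * (a d / real d)"
        using ts[of d] X by (simp add: a_def \<rho>_def algebra_simps)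
    qed
    also have "\<dots> = (\<Sum>d = 1..D. a d * \<rho> d) + X / 3 * (\<Sum>d = 1..D. a d / real d)"
      by (simp only: sum.distrib sum_distrib_left)
    finally have S: "(\<Sum>d = 1..D. moebius_mu d / real d * tooth_sum D (real d / X))
       = (\<Sum>d = 1..D. a d * \<rho> d) + X / 3 * (\<Sum>d = 1..D. a d / real d)" .
    have tl: "\<bar>X / 3 * (6 / pi\<^sup>2 - (\<Sum>d = 1..D. a d / real d))\<bar> \<le> 2 * C * Q"
    proof -
      have "\<bar>X / 3 * (6 / pi\<^sup>2 - (\<Sum>d = 1..D. a d / real d))\<bar> \<le> (2 * real D / 3) * (2 * C * Q / real D)"
        unfolding abs_mult using tail[OF D(1)] X D by (intro mult_mono) (auto simp: Q_def)
      also have "\<dots> \<le> 2 * C * Q" using D(1) C(1) Q by simp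
      finally show ?thesis .
    qed
    have "pi * ((\<Sum>d = 1..D. moebius_mu d / real d * tooth_sum D (real d / X)) / 2) - X / pi
       = pi / 2 * ((\<Sum>d = 1..D. a d * \<rho> d) - X / 3 * (6 / pi\<^sup>2 - (\<Sum>d = 1..D. a d / real d)))"
      unfolding S by (simp add: field_simps power2_eq_square)
    also have "\<bar>\<dots>\<bar> \<le> 2 * (B * Q)"
    proof -
      have "\<bar>(\<Sum>d = 1..D. a d * \<rho> d) - X / 3 * (6 / pi\<^sup>2 - (\<Sum>d = 1..D. a d / real d))\<bar> \<le> B * Q"
        using osc tl by (simp add: B_def algebra_simps)
      moreover have "\<bar>pi / 2\<bar> \<le> 2" using pi_less_4 pi_gt_zero by linarith
      ultimately show ?thesis unfolding abs_mult by (intro mult_mono) auto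
    qed
    also have "Q \<le> 2 * X powr (\<eta> - 1 / 2)"
    proof -
      have "Q \<le> (X / 2) powr (\<eta> - 1 / 2)" unfolding Q_def using D X \<eta> by (intro powr_mono2') auto
      also have "\<dots> = X powr (\<eta> - 1 / 2) / 2 powr (\<eta> - 1 / 2)"
        using X by (simp add: powr_divide)
      also have "\<dots> = X powr (\<eta> - 1 / 2) * 2 powr (1 / 2 - \<eta>)"
        using powr_minus_divide[of 2 "\<eta> - 1 / 2"] by simp
      also have "\<dots> \<le> X powr (\<eta> - 1 / 2) * 2 powr 1"
        using \<eta> by (intro mult_left_mono powr_mono) auto
      finally show ?thesis by simp
    qed
    finally have "\<bar>pi * ((\<Sum>d = 1..D. moebius_mu d / real d * tooth_sum D (real d / X)) / 2) - X / pi\<bar>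
        \<le> 2 * (B * (2 * X powr (\<eta> - 1 / 2)))"
      using C(1) y(1) by (simp add: B_def mult_left_mono)
    also have "2 * (B * (2 * X powr (\<eta> - 1 / 2))) = 4 * B * X powr (\<eta> - 1 / 2)" by simp
    finally have fin: "\<bar>pi * ((\<Sum>d = 1..D. moebius_mu d / real d * tooth_sum D (real d / X)) / 2) - X / pi\<bar>
        \<le> 4 * B * X powr (\<eta> - 1 / 2)" .
    have "(\<Sum>n = 1..D. \<Sum>m | m \<le> n \<and> coprime m n.
        (sin (pi * real m / real n))\<^sup>2 * (1 - real n / X)\<^sup>2 / real n)
      = (\<Sum>d = 1..D. moebius_mu d / real d * tooth_sum D (real d / X)) / 2"
      unfolding D_def by (rule resonance_moebius_sum[OF X])
    with fin show ?thesis unfolding D_def[symmetric] by (simp only:)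
  qed
  show ?thesis by (intro exI[of _ "4 * B"] allI impI main)
qed

section \<open>The billiard as a family of rotations\<close>

lemma hole_iff: "b \<in> hole d \<longleftrightarrow> (\<exists>k::int. 0 < b + 2 * pi * of_int k \<and> b + 2 * pi * of_int k < d)"
proof
  assume "b \<in> hole d"
  then obtain b' where b': "0 < b'" "b' < d" "[b = b'] (rmod 2 * pi)" by (auto simp: hole_def)
  then obtain k :: int where "b' = b + of_int k * (2 * pi)"
    by (metis rcong_altdef)
  then show "\<exists>k::int. 0 < b + 2 * pi * of_int k \<and> b + 2 * pi * of_int k < d"
    using b' by (intro exI[of _ k]) (auto simp: mult_ac)
next
  assume "\<exists>k::int. 0 < b + 2 * pi * of_int k \<and> b + 2 * pi * of_int k < d"
  then obtain k :: int where k: "0 < b + 2 * pi * of_int k" "b + 2 * pi * of_int k < d" by blast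
  have "[b = b + 2 * pi * of_int k] (rmod 2 * pi)"
    unfolding rcong_altdef by (intro exI[of _ k]) simp
  then show "b \<in> hole d" using k by (auto simp: hole_def)
qed

lemma angle_repr_shift: "\<exists>k::int. angle_repr x = x + 2 * pi * of_int k"
  unfolding angle_repr_def rmod_def
  by (intro exI[of _ "\<lfloor>(pi - x) / \<bar>2 * pi\<bar>\<rfloor>"]) simp

text \<open>The reduction of angles to one period changes the iterates by multiples of \<open>2 * pi\<close>
only, and the hole is periodic.\<close>

lemma billiard_iterate:
  "snd ((billiard_map ^^ n) (b, p)) = p \<and>
   (\<exists>k::int. fst ((billiard_map ^^ n) (b, p)) = b + real n * (pi - 2 * p) + 2 * pi * of_int k)"
proof (induction n)
  case 0
  then show ?case by (auto intro: exI[of _ 0])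
next
  case (Suc n)
  define z where "z = (billiard_map ^^ n) (b, p)"
  from Suc obtain k :: int where z: "snd z = p" "fst z = b + real n * (pi - 2 * p) + 2 * pi * of_int k"
    by (auto simp: z_def)
  obtain j :: int where j: "angle_repr (fst z + pi - 2 * snd z) = fst z + pi - 2 * snd z + 2 * pi * of_int j"
    using angle_repr_shift by blast
  have "(billiard_map ^^ Suc n) (b, p) = (angle_repr (fst z + pi - 2 * snd z), snd z)"
    by (simp add: billiard_map_def z_def case_prod_unfold)
  moreover have "fst z + pi - 2 * snd z + 2 * pi * of_int j
      = b + real (Suc n) * (pi - 2 * p) + 2 * pi * of_int (k + j)"
    unfolding z by (simp add: algebra_simps)
  ultimately show ?case using z(1) j by (metis fst_conv snd_conv)
qed

lemma hole_iterate_iff: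
  "fst ((billiard_map ^^ n) (b, p)) \<in> hole d \<longleftrightarrow>
   (\<exists>k::int. 0 < b + real n * (pi - 2 * p) + 2 * pi * of_int k \<and> b + real n * (pi - 2 * p) + 2 * pi * of_int k < d)"
proof -
  obtain j :: int where j: "fst ((billiard_map ^^ n) (b, p)) = b + real n * (pi - 2 * p) + 2 * pi * of_int j"
    using billiard_iterate by blast
  have "fst ((billiard_map ^^ n) (b, p)) + 2 * pi * of_int k = b + real n * (pi - 2 * p) + 2 * pi * of_int (j + k)" for k
    by (simp add: j algebra_simps)
  then show ?thesis unfolding hole_iff by (metis add.commute diff_add_cancel)
qed

text \<open>The condition that the trajectory lies in the hole at collision \<open>n\<close>, stated without the
reduction of angles.\<close>

definition hits :: "real \<Rightarrow> real \<Rightarrow> real \<Rightarrow> nat \<Rightarrow> bool" where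
  "hits d b p n \<longleftrightarrow> (\<exists>k::int. 0 < b + real n * (pi - 2 * p) + 2 * pi * of_int k \<and> b + real n * (pi - 2 * p) + 2 * pi * of_int k < d)"

text \<open>On grazing trajectories, where the cosine vanishes, the equivalence uses that the escape time is
infinite exactly if the hole is never hit.\<close>

lemma escape_time_gt_iff:
  assumes t: "t \<ge> 0" and p: "(b, p) \<in> phase_space"
  shows "escape_time d (b, p) > ereal t \<longleftrightarrow> (\<forall>n. hits d b p n \<longrightarrow> t < 2 * cos p * real n)"
proof (cases "escapes d (b, p)")
  case False
  then have "\<not> hits d b p n" for n by (auto simp: escapes_def hole_iterate_iff hits_def)
  then show ?thesis using False by (auto simp: escape_time_def collisions_before_escape_def)
next
  case True
  define N where "N = (LEAST n. hits d b p n)"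
  have ex: "\<exists>n. hits d b p n" using True by (auto simp: escapes_def hole_iterate_iff hits_def)
  have N: "hits d b p N" unfolding N_def using ex by (rule LeastI_ex)
  have le: "N \<le> n" if "hits d b p n" for n unfolding N_def using that by (rule Least_le)
  have "cos p \<ge> 0" using p by (intro cos_ge_zero) (auto simp: phase_space_def)
  then have mono: "2 * cos p * real N \<le> 2 * cos p * real n" if "hits d b p n" for n
    using le[OF that] by (intro mult_left_mono) auto
  have "escape_time d (b, p) = ereal (2 * cos p * real N)"
    using True by (simp add: escape_time_def collisions_before_escape_def hole_iterate_iff N_def hits_def)
  then show ?thesis using N mono by (auto intro: less_le_trans)
qed

lemma survival_region_measurable:
  "{(b, p). \<forall>n. hits d b p n \<longrightarrow> t < 2 * cos p * real n} \<in> sets (borel :: (real \<times> real) measure)"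
proof -
  have "Measurable.pred (borel \<Otimes>\<^sub>M borel) (\<lambda>x::real \<times> real. \<forall>n. hits d (fst x) (snd x) n \<longrightarrow> t < 2 * cos (snd x) * real n)"
    unfolding hits_def by measurable
  then show ?thesis
    by (simp add: pred_def borel_prod case_prod_unfold)
qed

text \<open>The circle is measured in fractions of its length: \<open>v\<close> is the starting point,
\<open>h\<close> the length of the hole, \<open>x\<close> the advance per collision and
\<open>\<tau>\<close> the number of collisions, which may be any real number.\<close>

definition surviving_set :: "real \<Rightarrow> real \<Rightarrow> real \<Rightarrow> real set" where
  "surviving_set h x \<tau> = {v. \<forall>n::nat. real n \<le> \<tau> \<longrightarrow> (\<forall>k::int. \<not> (0 < v + real n * x + of_int k \<and> v + real n * x + of_int k < h))}"

abbreviation survival_fraction :: "real \<Rightarrow> real \<Rightarrow> real \<Rightarrow> ennreal" where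
  "survival_fraction h x \<tau> \<equiv> emeasure lborel (surviving_set h x \<tau> \<inter> {- 1 / 2<..1 / 2})"

text \<open>The density of the invariant measure in the coordinate \<open>x\<close>, where
\<open>sin (pi * x)\<close> is the cosine of the angle of reflection. It is cut off at the grazing
angles, which have measure zero.\<close>

abbreviation angle_density :: "real \<Rightarrow> real" where
  "angle_density x \<equiv> pi / 2 * (sin (pi * x) * indicator {0<..<1} x)"

text \<open>Fubini's theorem with the substitutions \<open>p = pi / 2 - pi * x\<close> and
\<open>b = 2 * pi * v\<close>. The bound \<open>\<tau>\<close> on the number of collisions depends
on the angle, because the length of a chord does.\<close>

lemma survival_prob_integral:
  assumes t: "t \<ge> 0"
  shows "emeasure billiard_measure {x \<in> phase_space. escape_time d x > ereal t}
    = (\<integral>\<^sup>+ x. ennreal (angle_density x) *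
         survival_fraction (d / (2 * pi)) x (t / (2 * sin (pi * x))) \<partial>lborel)"
proof -
  define R where "R = {(b, p). \<forall>n. hits d b p n \<longrightarrow> t < 2 * cos p * real n}"
  define A where "A = {x \<in> phase_space. escape_time d x > ereal t}"
  have ps: "phase_space \<in> sets (borel :: (real \<times> real) measure)"
    unfolding phase_space_def by (simp add: borel_prod[symmetric])
  have R: "R \<in> sets borel" unfolding R_def by (rule survival_region_measurable)
  have A: "A = R \<inter> phase_space"
    unfolding A_def R_def using escape_time_gt_iff[OF t] by auto
  define f where "f = (\<lambda>(b::real, p::real). ennreal (cos p / (4 * pi)))"
  have fm: "f \<in> borel_measurable (borel :: (real \<times> real) measure)"
    unfolding f_def by (simp add: borel_prod[symmetric])
  have "emeasure billiard_measure A = (\<integral>\<^sup>+ x. f x * indicator A x \<partial>restrict_space lborel phase_space)"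
    unfolding billiard_measure_def f_def[symmetric]
    using R ps fm by (intro emeasure_density) (auto simp: A sets_restrict_space_iff intro: measurable_restrict_space1)
  also have "\<dots> = (\<integral>\<^sup>+ x. f x * indicator A x * indicator phase_space x \<partial>lborel)"
    using ps by (intro nn_integral_restrict_space) auto
  also have "\<dots> = (\<integral>\<^sup>+ x. f x * indicator A x \<partial>(lborel \<Otimes>\<^sub>M lborel))"
    unfolding lborel_prod by (intro nn_integral_cong) (auto simp: A split: split_indicator)
  also have "\<dots> = (\<integral>\<^sup>+ p. \<integral>\<^sup>+ b. f (b, p) * indicator A (b, p) \<partial>lborel \<partial>lborel)"
    using fm R ps by (intro lborel_pair.nn_integral_snd[symmetric]) (simp add: A lborel_prod)
  also have "\<dots> = ennreal \<bar>- pi\<bar> * (\<integral>\<^sup>+ x. \<integral>\<^sup>+ b. f (b, pi / 2 + - pi * x) * indicator A (b, pi / 2 + - pi * x) \<partial>lborel \<partial>lborel)"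
  proof (rule nn_integral_real_affine)
    have "(\<lambda>x. f x * indicator A x) \<in> borel_measurable (lborel \<Otimes>\<^sub>M lborel)"
      using fm R ps by (simp add: A lborel_prod)
    then show "(\<lambda>p. \<integral>\<^sup>+ b. f (b, p) * indicator A (b, p) \<partial>lborel) \<in> borel_measurable borel"
      by measurable
  qed simp
  also have "\<dots> = (\<integral>\<^sup>+ x. ennreal pi * (\<integral>\<^sup>+ b. f (b, pi / 2 + - pi * x) * indicator A (b, pi / 2 + - pi * x) \<partial>lborel) \<partial>lborel)"
  proof -
    have "(\<lambda>x. f x * indicator A x) \<in> borel_measurable (lborel \<Otimes>\<^sub>M lborel)"
      using fm R ps by (simp add: A lborel_prod)
    then have "(\<lambda>x. \<integral>\<^sup>+ b. f (b, pi / 2 + - pi * x) * indicator A (b, pi / 2 + - pi * x) \<partial>lborel) \<in> borel_measurable lborel"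
      by measurable
    then show ?thesis by (simp add: nn_integral_cmult)
  qed
  also have "\<dots> = (\<integral>\<^sup>+ x. ennreal (angle_density x) *
         survival_fraction (d / (2 * pi)) x (t / (2 * sin (pi * x))) \<partial>lborel)"
  proof (rule nn_integral_cong)
    fix x :: real
    define p where "p = pi / 2 + - pi * x"
    have cosp: "cos p = sin (pi * x)" by (simp add: p_def cos_diff)
    show "ennreal pi * (\<integral>\<^sup>+ b. f (b, pi / 2 + - pi * x) * indicator A (b, pi / 2 + - pi * x) \<partial>lborel)
      = ennreal (angle_density x) *
         survival_fraction (d / (2 * pi)) x (t / (2 * sin (pi * x)))"
    proof (cases "0 < x \<and> x < 1")
      case False
      have "f (b, p) * indicator A (b, p) = 0" for b
      proof (cases "x = 0 \<or> x = 1")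
        case True
        then have "cos p = 0" by (auto simp: cosp)
        then show ?thesis by (simp add: f_def)
      next
        case F: False
        have "p \<notin> {- pi / 2..pi / 2}"
        proof
          assume "p \<in> {- pi / 2..pi / 2}"
          then have "pi * x \<ge> 0 \<and> pi * x \<le> pi * 1" by (auto simp: p_def)
          then show False using False F pi_gt_zero by (auto simp: zero_le_mult_iff)
        qed
        then show ?thesis by (simp add: A phase_space_def)
      qed
      then have "(\<integral>\<^sup>+ b. f (b, p) * indicator A (b, p) \<partial>lborel) = 0" by (simp only: nn_integral_const) simp
      then show ?thesis unfolding p_def[symmetric] using False by simp
    next
      case True
      define s where "s = sin (pi * x)"
      have "pi * x < pi * 1" using True by (intro mult_strict_left_mono) auto
      then have s: "s > 0" unfolding s_def using True by (intro sin_gt_zero) auto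
      have pr: "p \<in> {- pi / 2..pi / 2}"
        using True mult_left_mono[of x 1 pi] by (auto simp: p_def)
      define B where "B = {b. (b, p) \<in> A}"
      have Bm: "B \<in> sets borel"
      proof -
        have "A \<in> sets (borel \<Otimes>\<^sub>M borel)" unfolding A borel_prod using R ps by (rule sets.Int)
        then have "(\<lambda>b. (b, p)) -` A \<in> sets borel" by (rule sets_Pair2)
        then show ?thesis by (simp add: B_def vimage_def)
      qed
      have "(\<integral>\<^sup>+ b. f (b, p) * indicator A (b, p) \<partial>lborel) = (\<integral>\<^sup>+ b. ennreal (s / (4 * pi)) * indicator B b \<partial>lborel)"
        by (intro nn_integral_cong) (auto simp: f_def B_def cosp s_def split: split_indicator)
      also have "\<dots> = ennreal (s / (4 * pi)) * (\<integral>\<^sup>+ b. indicator B b \<partial>lborel)"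
        using Bm by (intro nn_integral_cmult) auto
      also have "(\<integral>\<^sup>+ b. indicator B b \<partial>lborel) = ennreal \<bar>2 * pi\<bar> * (\<integral>\<^sup>+ v. indicator B (0 + 2 * pi * v) \<partial>lborel)"
        using Bm by (intro nn_integral_real_affine) auto
      also have "(\<lambda>v. indicator B (0 + 2 * pi * v)) = (indicator (surviving_set (d / (2 * pi)) x (t / (2 * sin (pi * x))) \<inter> {- 1 / 2<..1 / 2}) :: real \<Rightarrow> ennreal)"
      proof
        fix v :: real
        have hits: "hits d (2 * pi * v) p n \<longleftrightarrow> (\<exists>k::int. 0 < v + real n * x + of_int k \<and> v + real n * x + of_int k < d / (2 * pi))" for n
        proof -
          have scale: "0 < 2 * pi * w \<and> 2 * pi * w < d \<longleftrightarrow> 0 < w \<and> w < d / (2 * pi)" for w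
            by (simp add: zero_less_mult_iff pos_less_divide_eq mult_ac)
          have shift: "2 * pi * v + real n * (pi - 2 * p) + 2 * pi * of_int k = 2 * pi * (v + real n * x + of_int k)" for k :: int
            by (simp add: p_def algebra_simps)
          show ?thesis unfolding hits_def shift scale ..
        qed
        have "2 * pi * v \<in> B \<longleftrightarrow> (2 * pi * v \<in> {- pi<..pi} \<and> (\<forall>n. hits d (2 * pi * v) p n \<longrightarrow> t < 2 * s * real n))"
          unfolding B_def A R_def phase_space_def using pr by (auto simp: cosp s_def)
        also have "2 * pi * v \<in> {- pi<..pi} \<longleftrightarrow> v \<in> {- 1 / 2<..1 / 2}"
        proof -
          have "2 * pi * v \<in> {- pi<..pi} \<longleftrightarrow> pi * (- 1) < pi * (2 * v) \<and> pi * (2 * v) \<le> pi * 1" by (auto simp: mult_ac)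
          also have "\<dots> \<longleftrightarrow> v \<in> {- 1 / 2<..1 / 2}" unfolding mult_less_cancel_left_pos[OF pi_gt_zero] mult_le_cancel_left_pos[OF pi_gt_zero] by auto
          finally show ?thesis .
        qed
        also have "(\<forall>n. hits d (2 * pi * v) p n \<longrightarrow> t < 2 * s * real n) \<longleftrightarrow> v \<in> surviving_set (d / (2 * pi)) x (t / (2 * s))"
        proof -
          have "t < 2 * s * real n \<longleftrightarrow> \<not> real n \<le> t / (2 * s)" for n :: nat
            using s by (simp add: field_simps not_le)
          then show ?thesis unfolding surviving_set_def hits by blast
        qed
        finally show "indicator B (0 + 2 * pi * v) = (indicator (surviving_set (d / (2 * pi)) x (t / (2 * sin (pi * x))) \<inter> {- 1 / 2<..1 / 2}) v :: ennreal)"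
          by (auto simp: s_def split: split_indicator)
      qed
      also have "(\<integral>\<^sup>+ v. indicator (surviving_set (d / (2 * pi)) x (t / (2 * sin (pi * x))) \<inter> {- 1 / 2<..1 / 2}) v \<partial>lborel)
        = survival_fraction (d / (2 * pi)) x (t / (2 * sin (pi * x)))"
      proof (rule nn_integral_indicator)
        show "surviving_set (d / (2 * pi)) x (t / (2 * sin (pi * x))) \<inter> {- 1 / 2<..1 / 2} \<in> sets lborel"
          unfolding surviving_set_def by measurable
      qed
      finally have "(\<integral>\<^sup>+ b. f (b, p) * indicator A (b, p) \<partial>lborel) = ennreal (s / (4 * pi)) * (ennreal \<bar>2 * pi\<bar> *
        survival_fraction (d / (2 * pi)) x (t / (2 * sin (pi * x))))" .
      moreover have "ennreal pi * (ennreal (s / (4 * pi)) * ennreal \<bar>2 * pi\<bar>) = ennreal (pi / 2 * s)"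
        using s by (simp add: ennreal_mult[symmetric])
      ultimately show ?thesis
        unfolding p_def[symmetric] s_def[symmetric] using True by (simp add: mult.assoc[symmetric])
    qed
  qed
  finally show ?thesis unfolding A_def .
qed

section \<open>The set of surviving starting points\<close>

text \<open>The complement of \<open>n\<close> equally spaced open arcs of length \<open>l\<close> on the circle
of length 1.\<close>

definition comb :: "real \<Rightarrow> real \<Rightarrow> nat \<Rightarrow> real set" where
  "comb a l n = {v. \<forall>r::int. \<not> (a < v + of_int r / real n \<and> v + of_int r / real n < a + l)}"

lemma comb_measurable [measurable]: "comb a l n \<in> sets borel"
  unfolding comb_def by measurable

lemma emeasure_periodic_shift:
  fixes S :: "real set" and k :: int
  assumes S: "S \<in> sets borel" and per: "\<And>v k::int. v + of_int k \<in> S \<longleftrightarrow> v \<in> S"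
  shows "emeasure lborel (S \<inter> {x + of_int k<..y + of_int k}) = emeasure lborel (S \<inter> {x<..y})"
proof -
  have "emeasure lborel (S \<inter> {x + of_int k<..y + of_int k}) = (\<integral>\<^sup>+ v. indicator (S \<inter> {x + of_int k<..y + of_int k}) v \<partial>lborel)"
    using S by (subst nn_integral_indicator) auto
  also have "\<dots> = ennreal \<bar>1\<bar> * (\<integral>\<^sup>+ v. indicator (S \<inter> {x + of_int k<..y + of_int k}) (of_int k + 1 * v) \<partial>lborel)"
    using S by (intro nn_integral_real_affine) auto
  also have "\<dots> = (\<integral>\<^sup>+ v. indicator (S \<inter> {x<..y}) v \<partial>lborel)"
    using per[of _ k] by (auto intro!: nn_integral_cong simp: add.commute split: split_indicator)
  also have "\<dots> = emeasure lborel (S \<inter> {x<..y})"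
    using S by (subst nn_integral_indicator) auto
  finally show ?thesis .
qed

text \<open>An interval of length 1 is cut at the integer inside it, and the two pieces are moved by integers.\<close>

lemma emeasure_periodic_unit:
  fixes S :: "real set"
  assumes S: "S \<in> sets borel" and per: "\<And>v k::int. v + of_int k \<in> S \<longleftrightarrow> v \<in> S"
  shows "emeasure lborel (S \<inter> {c<..c + 1}) = emeasure lborel (S \<inter> {0<..1})"
proof -
  define m where "m = \<lfloor>c\<rfloor>"
  define f where "f = c - of_int m"
  have f: "0 \<le> f" "f < 1" unfolding f_def m_def by linarith+
  have "S \<inter> {c<..c + 1} = (S \<inter> {f + of_int m<..1 + of_int m}) \<union> (S \<inter> {0 + of_int (m + 1)<..f + of_int (m + 1)})"
    using f by (auto simp: f_def)
  also have "emeasure lborel \<dots> = emeasure lborel (S \<inter> {f + of_int m<..1 + of_int m})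
      + emeasure lborel (S \<inter> {0 + of_int (m + 1)<..f + of_int (m + 1)})"
    using S by (intro plus_emeasure[symmetric]) auto
  also have "\<dots> = emeasure lborel (S \<inter> {f<..1}) + emeasure lborel (S \<inter> {0<..f})"
    by (simp only: emeasure_periodic_shift[OF assms])
  also have "\<dots> = emeasure lborel ((S \<inter> {f<..1}) \<union> (S \<inter> {0<..f}))"
    using S by (intro plus_emeasure) auto
  also have "(S \<inter> {f<..1}) \<union> (S \<inter> {0<..f}) = S \<inter> {0<..1}" using f by auto
  finally show ?thesis .
qed

lemma emeasure_periodic_interval:
  fixes S :: "real set"
  assumes S: "S \<in> sets borel" and per: "\<And>v k::int. v + of_int k \<in> S \<longleftrightarrow> v \<in> S"
  shows "emeasure lborel (S \<inter> {c<..c + real n}) = of_nat n * emeasure lborel (S \<inter> {0<..1})"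
proof (induction n)
  case (Suc n)
  have "S \<inter> {c<..c + real (Suc n)} = (S \<inter> {c<..c + real n}) \<union> (S \<inter> {c + real n<..c + real n + 1})"
    by auto
  also have "emeasure lborel \<dots> = emeasure lborel (S \<inter> {c<..c + real n}) + emeasure lborel (S \<inter> {c + real n<..c + real n + 1})"
    using S by (intro plus_emeasure[symmetric]) auto
  also have "\<dots> = of_nat (Suc n) * emeasure lborel (S \<inter> {0<..1})"
    unfolding emeasure_periodic_unit[OF assms] Suc by (simp add: distrib_right add.commute)
  finally show ?case .
qed simp

lemma comb_periodic: "v + of_int k \<in> comb a l 1 \<longleftrightarrow> v \<in> comb a l 1" for k :: int
proof -
  have shift: "v + of_int k \<in> comb a l 1" if v: "v \<in> comb a l 1" for v and k :: int
    unfolding comb_def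
  proof (intro CollectI allI)
    fix r :: int
    have "\<not> (a < v + of_int (k + r) / real 1 \<and> v + of_int (k + r) / real 1 < a + l)"
      using v unfolding comb_def by blast
    then show "\<not> (a < v + of_int k + of_int r / real 1 \<and> v + of_int k + of_int r / real 1 < a + l)"
      by (simp add: add.assoc)
  qed
  show ?thesis using shift[of v k] shift[of "v + of_int k" "- k"] by auto
qed

lemma emeasure_comb_unit:
  assumes l: "l \<ge> 0"
  shows "emeasure lborel (comb a l 1 \<inter> {0<..1}) = ennreal (max 0 (1 - l))"
proof -
  have "emeasure lborel (comb a l 1 \<inter> {0<..1}) = emeasure lborel (comb a l 1 \<inter> {a<..a + 1})"
    using emeasure_periodic_unit[OF comb_measurable comb_periodic, of a] by simp
  also have "comb a l 1 \<inter> {a<..a + 1} = (if l = 0 then {a<..a + 1} else {a + l..a + 1})"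
  proof (cases "l = 0")
    case True
    then show ?thesis by (auto simp: comb_def)
  next
    case False
    then have l0: "l > 0" using l by simp
    have "comb a l 1 \<inter> {a<..a + 1} = {a + l..a + 1}"
    proof (intro equalityI subsetI)
      fix v assume v: "v \<in> comb a l 1 \<inter> {a<..a + 1}"
      then have "\<not> (a < v + of_int 0 \<and> v + of_int 0 < a + l)" unfolding comb_def by (metis (mono_tags, lifting) Int_iff div_by_1 mem_Collect_eq of_nat_1)
      then show "v \<in> {a + l..a + 1}" using v by auto
    next
      fix v assume v: "v \<in> {a + l..a + 1}"
      have "\<not> (a < v + of_int r \<and> v + of_int r < a + l)" for r :: int
      proof (cases "r \<ge> 0")
        case True
        then have "real_of_int r \<ge> 0" by simp
        then show ?thesis using v by simp
      next
        case False
        then have "real_of_int r \<le> -1" by linarith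
        then show ?thesis using v by simp
      qed
      then show "v \<in> comb a l 1 \<inter> {a<..a + 1}" using v l0 by (simp add: comb_def)
    qed
    then show ?thesis using False by simp
  qed
  also have "emeasure lborel \<dots> = ennreal (max 0 (1 - l))"
    by (auto simp: max_def)
  finally show ?thesis .
qed

text \<open>Scaling by \<open>n\<close> turns the arcs into unit period, and the interval of length 1 into
\<open>n\<close> periods.\<close>

lemma emeasure_comb:
  assumes l: "l \<ge> 0" and n: "n \<ge> 1"
  shows "emeasure lborel (comb a l n \<inter> {- 1 / 2<..1 / 2}) = ennreal (max 0 (1 - real n * l))"
proof -
  have n0: "real n > 0" using n by simp
  define Z where "Z = comb (real n * a) (real n * l) 1"
  have per: "v + of_int k \<in> Z \<longleftrightarrow> v \<in> Z" for v and k :: int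
    unfolding Z_def by (rule comb_periodic)
  have "emeasure lborel (comb a l n \<inter> {- 1 / 2<..1 / 2}) = (\<integral>\<^sup>+ v. indicator (comb a l n \<inter> {- 1 / 2<..1 / 2}) v \<partial>lborel)"
    by (subst nn_integral_indicator) auto
  also have "\<dots> = ennreal \<bar>1 / real n\<bar> * (\<integral>\<^sup>+ u. indicator (comb a l n \<inter> {- 1 / 2<..1 / 2}) (0 + 1 / real n * u) \<partial>lborel)"
    using n0 by (intro nn_integral_real_affine) auto
  also have "(\<lambda>u. indicator (comb a l n \<inter> {- 1 / 2<..1 / 2}) (0 + 1 / real n * u) :: ennreal)
     = indicator (Z \<inter> {- (real n / 2)<..- (real n / 2) + real n})"
  proof
    fix u :: real
    have "a < 0 + 1 / real n * u + of_int r / real n \<and> 0 + 1 / real n * u + of_int r / real n < a + l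
      \<longleftrightarrow> real n * a < u + of_int r \<and> u + of_int r < real n * a + real n * l" for r :: int
      using n0 by (simp add: field_simps)
    then have "0 + 1 / real n * u \<in> comb a l n \<longleftrightarrow> u \<in> Z" unfolding comb_def Z_def
      by (simp only: mem_Collect_eq div_by_1 of_nat_1)
    moreover have "0 + 1 / real n * u \<in> {- 1 / 2<..1 / 2} \<longleftrightarrow> u \<in> {- (real n / 2)<..- (real n / 2) + real n}"
      using n0 by (auto simp: field_simps)
    ultimately show "indicator (comb a l n \<inter> {- 1 / 2<..1 / 2}) (0 + 1 / real n * u)
       = (indicator (Z \<inter> {- (real n / 2)<..- (real n / 2) + real n}) u :: ennreal)"
      by (auto split: split_indicator)
  qed
  also have "(\<integral>\<^sup>+ u. indicator (Z \<inter> {- (real n / 2)<..- (real n / 2) + real n}) u \<partial>lborel)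
     = emeasure lborel (Z \<inter> {- (real n / 2)<..- (real n / 2) + real n})"
    by (subst nn_integral_indicator) (auto simp: Z_def)
  also have "\<dots> = of_nat n * emeasure lborel (Z \<inter> {0<..1})"
    by (rule emeasure_periodic_interval[OF _ per]) (simp add: Z_def)
  also have "emeasure lborel (Z \<inter> {0<..1}) = ennreal (max 0 (1 - real n * l))"
    unfolding Z_def using l by (intro emeasure_comb_unit) auto
  also have "ennreal \<bar>1 / real n\<bar> * (of_nat n * ennreal (max 0 (1 - real n * l))) = ennreal (max 0 (1 - real n * l))"
  proof -
    have "ennreal \<bar>1 / real n\<bar> * (of_nat n * ennreal (max 0 (1 - real n * l)))
      = ennreal (\<bar>1 / real n\<bar> * (real n * max 0 (1 - real n * l)))"
      by (simp only: ennreal_of_nat_eq_real_of_nat ennreal_mult abs_ge_zero of_nat_0_le_iff mult_nonneg_nonneg max.cobounded1)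
    then show ?thesis using n0 by simp
  qed
  finally show ?thesis .
qed

text \<open>Up to collision \<open>\<tau>\<close>, the orbit stays within \<open>\<tau> * \<bar>y\<bar>\<close>
of the orbit of the rotation by \<open>m / n\<close>, always on the same side. So the arc that leads
into the hole grows to length \<open>h + \<tau> * \<bar>y\<bar>\<close> at most.\<close>

lemma comb_subset_surviving:
  fixes m :: int and n :: nat and x \<tau> h :: real
  assumes n: "n \<ge> 1"
  defines "y \<equiv> x - of_int m / real n"
  shows "comb (min 0 (- \<tau> * y)) (h + \<tau> * \<bar>y\<bar>) n \<subseteq> surviving_set h x \<tau>"
proof
  fix v assume v: "v \<in> comb (min 0 (- \<tau> * y)) (h + \<tau> * \<bar>y\<bar>) n"
  show "v \<in> surviving_set h x \<tau>"
    unfolding surviving_set_def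
  proof (intro CollectI allI impI notI)
    fix j :: nat and k :: int
    assume j: "real j \<le> \<tau>" and hit: "0 < v + real j * x + of_int k \<and> v + real j * x + of_int k < h"
    define w where "w = v + of_int (int j * m + k * int n) / real n"
    have w: "w = v + real j * x + of_int k - real j * y"
      using n by (simp add: w_def y_def field_simps)
    have \<tau>: "\<tau> \<ge> 0" using j by linarith
    have "min 0 (- \<tau> * y) < w \<and> w < min 0 (- \<tau> * y) + (h + \<tau> * \<bar>y\<bar>)"
    proof (cases "y \<ge> 0")
      case True
      then have jy: "0 \<le> real j * y" "real j * y \<le> \<tau> * y" using j by (auto intro: mult_right_mono)
      moreover have "\<tau> * y \<ge> 0" using True \<tau> by simp
      then have "min 0 (- \<tau> * y) = - (\<tau> * y)" by simp
      moreover have "\<tau> * \<bar>y\<bar> = \<tau> * y" using True by simp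
      ultimately show ?thesis using w hit by linarith
    next
      case False
      then have "real j * y \<le> 0" "\<tau> * y \<le> real j * y" using j by (auto intro: mult_right_mono_neg simp: mult_nonneg_nonpos)
      moreover have "min 0 (- \<tau> * y) = 0" "\<tau> * \<bar>y\<bar> = - \<tau> * y"
        using False \<tau> by (auto simp: min_def mult_nonneg_nonpos)
      ultimately show ?thesis using w hit by auto
    qed
    then show False using v unfolding comb_def w_def by blast
  qed
qed

text \<open>A point in one of the arcs of the comb is led into the hole as follows. Some number
\<open>r0 < n\<close> of collisions brings it into the hole or to the side of it from which the
drift moves towards the hole. After this, each further \<open>n\<close> collisions move it by
\<open>n * \<bar>y\<bar>\<close>, which is less than the length of the hole, so it cannot jump over
it. Three periods of \<open>n\<close> collisions are lost to rounding.\<close>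

lemma surviving_subset_comb:
  fixes m :: int and n :: nat and x \<tau> h :: real
  assumes n: "n \<ge> 1" and cop: "coprime m (int n)" and \<tau>: "\<tau> \<ge> 3 * real n"
  defines "y \<equiv> x - of_int m / real n"
  assumes small: "real n * \<bar>y\<bar> < h"
  shows "\<exists>a. surviving_set h x \<tau> \<subseteq> comb a (h + (\<tau> - 3 * real n) * \<bar>y\<bar>) n"
proof -
  define a where "a = (if y \<ge> 0 then - ((\<tau> - 2 * real n) * y) else real n * \<bar>y\<bar>)"
  have n0: "real n > 0" using n by simp
  have "v \<in> comb a (h + (\<tau> - 3 * real n) * \<bar>y\<bar>) n" if v: "v \<in> surviving_set h x \<tau>" for v
    unfolding comb_def
  proof (intro CollectI allI notI)
    fix r :: int
    define w where "w = v + of_int r / real n"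
    assume "a < v + of_int r / real n \<and> v + of_int r / real n < a + (h + (\<tau> - 3 * real n) * \<bar>y\<bar>)"
    then have w: "a < w" "w < a + (h + (\<tau> - 3 * real n) * \<bar>y\<bar>)" by (auto simp: w_def)
    obtain m' where "[m * m' = 1] (mod int n)" using cong_solve_coprime_int[OF cop] by blast
    define q where "q = (m' * r) mod int n"
    have q: "0 \<le> q" "q < int n" using n by (auto simp: q_def)
    have "[m * q = m * (m' * r)] (mod int n)" unfolding q_def by (intro cong_mult cong_refl) (simp add: cong_def)
    also have "m * (m' * r) = (m * m') * r" by simp
    also have "[(m * m') * r = 1 * r] (mod int n)" by (intro cong_mult cong_refl) fact
    finally have "int n dvd (r - m * q)" by (simp add: cong_iff_dvd_diff dvd_diff_commute)
    then obtain k where k: "r = m * q + int n * k" by (metis dvdE diff_eq_eq add.commute)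
    define r0 where "r0 = nat q"
    have r0: "int r0 = q" "r0 < n" using q by (auto simp: r0_def)
    \<comment> \<open>Collision \<open>r0 + j * n\<close> in terms of the point \<open>w\<close> and the drift.\<close>
    have pos: "v + real (r0 + j * n) * x + of_int (k - int j * m) = w + real r0 * y + real j * (real n * y)" for j
      using n0 by (simp add: w_def y_def k r0(1)[symmetric] field_simps)
    have nohit: False if "real r0 + real j * real n \<le> \<tau>" "0 < w + real r0 * y + real j * (real n * y)"
      "w + real r0 * y + real j * (real n * y) < h" for j
    proof -
      have "real (r0 + j * n) \<le> \<tau>" using that(1) by simp
      then have "\<not> (0 < v + real (r0 + j * n) * x + of_int (k - int j * m) \<and> v + real (r0 + j * n) * x + of_int (k - int j * m) < h)"
        using v unfolding surviving_set_def by blast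
      then show False using that(2,3) unfolding pos by blast
    qed
    have r0n: "real r0 < real n" using r0(2) by simp
    show False
    proof (cases "y \<ge> 0")
      case True
      have w1: "w + real r0 * y < h"
      proof -
        have "real r0 * y \<le> real n * y" using r0n True by (intro mult_right_mono) auto
        moreover have "w < h - real n * y" using w(2) True by (simp add: a_def algebra_simps)
        ultimately show ?thesis by linarith
      qed
      show False
      proof (cases "w + real r0 * y > 0")
        case pos0: True
        show False by (rule nohit[of 0]) (use r0n \<tau> pos0 w1 in auto)
      next
        case False
        have y0: "y > 0"
        proof (rule ccontr)
          assume "\<not> y > 0"
          then have "y = 0" using True by simp
          then show False using False w(1) by (simp add: a_def)
        qed
        define z where "z = real n * y"
        have z: "z > 0" "z < h" using y0 n0 small by (auto simp: z_def)
        define e where "e = - (w + real r0 * y) / z"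
        have e0: "e \<ge> 0" using False z by (simp add: e_def)
        define j where "j = nat (\<lfloor>e\<rfloor> + 1)"
        have j: "real j > e" "real j \<le> e + 1" using e0 unfolding j_def by linarith+
        have ez: "e * z = - (w + real r0 * y)" using z by (simp add: e_def)
        have "real j * z > e * z" "real j * z \<le> (e + 1) * z"
          using j z by (auto intro: mult_strict_right_mono mult_right_mono)
        then have hit: "0 < w + real r0 * y + real j * z" "w + real r0 * y + real j * z < h"
          using ez z by (auto simp: algebra_simps)
        have "e * z < (\<tau> - 2 * real n) * y - real r0 * y"
          unfolding ez using w(1) True by (simp add: a_def)
        then have "real n * e * y < (\<tau> - 2 * real n - real r0) * y" by (simp add: z_def algebra_simps)
        then have "real n * e < \<tau> - 2 * real n - real r0" using y0 by simp
        moreover have "real j * real n \<le> (e + 1) * real n" using j by (intro mult_right_mono) auto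
        ultimately have "real r0 + real j * real n \<le> \<tau>" using n0 by (simp add: algebra_simps)
        then show False using nohit[of j] hit by (simp add: z_def)
      qed
    next
      case False
      define u where "u = - y"
      have u: "u > 0" "\<bar>y\<bar> = u" "y = - u" using False by (auto simp: u_def)
      define z where "z = real n * u"
      have z: "z > 0" "z < h" using u n0 small by (auto simp: z_def)
      have aw: "z < w" "w < h + (\<tau> - 2 * real n) * u" using w False u by (auto simp: a_def z_def algebra_simps)
      have w0: "w - real r0 * u > 0"
      proof -
        have "real r0 * u \<le> real n * u" using r0n u by (intro mult_right_mono) auto
        then show ?thesis using aw(1) by (simp add: z_def)
      qed
      show False
      proof (cases "w - real r0 * u < h")
        case True
        show False by (rule nohit[of 0]) (use r0n \<tau> True w0 u in auto)
      next
        case ge: False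
        define e where "e = (w - real r0 * u - h) / z"
        have e0: "e \<ge> 0" using ge z by (simp add: e_def)
        define j where "j = nat (\<lfloor>e\<rfloor> + 1)"
        have j: "real j > e" "real j \<le> e + 1" using e0 unfolding j_def by linarith+
        have ez: "e * z = w - real r0 * u - h" using z by (simp add: e_def)
        have "real j * z > e * z" "real j * z \<le> (e + 1) * z"
          using j z by (auto intro: mult_strict_right_mono mult_right_mono)
        then have hit: "0 < w - real r0 * u - real j * z" "w - real r0 * u - real j * z < h"
          using ez z by (auto simp: algebra_simps)
        have "e * z < (\<tau> - 2 * real n) * u - real r0 * u"
          unfolding ez using aw(2) by simp
        then have "real n * e * u < (\<tau> - 2 * real n - real r0) * u" by (simp add: z_def algebra_simps)
        then have "real n * e < \<tau> - 2 * real n - real r0" using u(1) by simp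
        moreover have "real j * real n \<le> (e + 1) * real n" using j by (intro mult_right_mono) auto
        ultimately have "real r0 + real j * real n \<le> \<tau>" using n0 by (simp add: algebra_simps)
        then show False using nohit[of j] hit by (simp add: z_def u(3))
      qed
    qed
  qed
  then show ?thesis by blast
qed

text \<open>The fractions \<open>m / n\<close> whose periodic orbits can avoid the hole.\<close>

definition resonances :: "real \<Rightarrow> (nat \<times> nat) set" where
  "resonances h = {(m, n). 1 \<le> n \<and> m \<le> n \<and> coprime m n \<and> real n * h < 1}"

text \<open>The measure of a comb whose arcs have length \<open>h + \<tau> * \<bar>x - m / n\<bar>\<close>, as a
function of \<open>x\<close>.\<close>

definition peak :: "real \<Rightarrow> nat \<times> nat \<Rightarrow> real \<Rightarrow> real \<Rightarrow> real" where
  "peak h = (\<lambda>(m, n) \<tau> x. max 0 (1 - real n * h - real n * \<tau> * \<bar>x - real m / real n\<bar>))"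

lemma finite_resonances:
  assumes h: "h > 0" shows "finite (resonances h)"
proof (rule finite_subset)
  show "resonances h \<subseteq> {..nat \<lfloor>1 / h\<rfloor>} \<times> {..nat \<lfloor>1 / h\<rfloor>}"
  proof
    fix z assume "z \<in> resonances h"
    then obtain m n where z: "z = (m, n)" "m \<le> n" "real n * h < 1" by (auto simp: resonances_def)
    then have "real n \<le> 1 / h" using h by (simp add: field_simps)
    then have "n \<le> nat \<lfloor>1 / h\<rfloor>" by linarith
    then show "z \<in> {..nat \<lfloor>1 / h\<rfloor>} \<times> {..nat \<lfloor>1 / h\<rfloor>}" using z by auto
  qed
qed simp

lemma surviving_lower:
  assumes mn: "(m, n) \<in> resonances h" and \<tau>: "\<tau> \<ge> 0" and h: "h > 0"
  shows "ennreal (peak h (m, n) \<tau> x) \<le> survival_fraction h x \<tau>"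
proof -
  define y where "y = x - real m / real n"
  have n: "n \<ge> 1" using mn by (simp add: resonances_def)
  have "ennreal (peak h (m, n) \<tau> x) = ennreal (max 0 (1 - real n * (h + \<tau> * \<bar>y\<bar>)))"
    by (simp add: peak_def y_def algebra_simps)
  also have "\<dots> = emeasure lborel (comb (min 0 (- \<tau> * y)) (h + \<tau> * \<bar>y\<bar>) n \<inter> {- 1 / 2<..1 / 2})"
    using h \<tau> by (intro emeasure_comb[symmetric] n) auto
  also have "\<dots> \<le> survival_fraction h x \<tau>"
  proof (rule emeasure_mono)
    show "comb (min 0 (- \<tau> * y)) (h + \<tau> * \<bar>y\<bar>) n \<inter> {- 1 / 2<..1 / 2} \<subseteq> surviving_set h x \<tau> \<inter> {- 1 / 2<..1 / 2}"
      using comb_subset_surviving[OF n, of \<tau> x "int m" h] by (auto simp: y_def)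
    show "surviving_set h x \<tau> \<inter> {- 1 / 2<..1 / 2} \<in> sets lborel"
      unfolding surviving_set_def by measurable
  qed
  finally show ?thesis .
qed

text \<open>By Dirichlet's theorem every \<open>x\<close> is close enough to some fraction with denominator at
most \<open>Q\<close>, so one of the combs applies. If that fraction is not a resonance, the comb is
null.\<close>

lemma surviving_upper:
  assumes h: "h > 0" and x: "0 < x" "x < 1" and Q: "real Q * h \<ge> 1" "Q \<ge> 1" and \<tau>: "\<tau> \<ge> 3 * real Q"
  shows "survival_fraction h x \<tau>
     \<le> ennreal (\<Sum>z\<in>resonances h. peak h z (\<tau> - 3 * real Q) x)"
proof -
  obtain m' n' :: int where mn': "coprime m' n'" "0 < n'" "n' \<le> int Q" "\<bar>of_int n' * x - of_int m'\<bar> < 1 / real Q"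
    using Dirichlet_approx_coprime[of Q x] Q(2) by auto
  have Q1: "1 / real Q \<le> 1" "1 / real Q \<le> h" using Q by (auto simp: field_simps)
  have "of_int n' * x > 0" "of_int n' * x < of_int n' * 1" using x mn'(2) by (auto simp del: mult_1_right)
  then have "real_of_int m' > -1" "real_of_int m' < of_int n' + 1" using mn'(4) Q1 by auto
  then have m': "m' \<ge> 0" "m' \<le> n'" by linarith+
  define m n where "m = nat m'" and "n = nat n'"
  have mn: "m' = int m" "n' = int n" "n \<ge> 1" "n \<le> Q" "m \<le> n" "coprime m n"
    using m' mn' by (auto simp: m_def n_def nat_le_iff coprime_int_iff[symmetric])
  define y where "y = x - real m / real n"
  have n0: "real n > 0" using mn by simp
  have yy: "real n * \<bar>y\<bar> = \<bar>real n * x - real m\<bar>"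
  proof -
    have "real n * x - real m = real n * y" using n0 by (simp add: y_def field_simps)
    then show ?thesis by (simp add: abs_mult)
  qed
  have small: "real n * \<bar>y\<bar> < h" unfolding yy using mn'(4) Q1 by (simp add: mn)
  have nQ: "real n \<le> real Q" using mn by simp
  obtain a where a: "surviving_set h x \<tau> \<subseteq> comb a (h + (\<tau> - 3 * real n) * \<bar>y\<bar>) n"
    using surviving_subset_comb[of n "int m" \<tau> x h] mn \<tau> small nQ by (auto simp: y_def coprime_int_iff)
  have "survival_fraction h x \<tau> \<le> emeasure lborel (comb a (h + (\<tau> - 3 * real n) * \<bar>y\<bar>) n \<inter> {- 1 / 2<..1 / 2})"
    using a by (intro emeasure_mono) auto
  also have "\<dots> = ennreal (max 0 (1 - real n * (h + (\<tau> - 3 * real n) * \<bar>y\<bar>)))"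
    using h \<tau> nQ mn by (intro emeasure_comb) auto
  also have "\<dots> \<le> ennreal (\<Sum>z\<in>resonances h. peak h z (\<tau> - 3 * real Q) x)"
  proof (rule ennreal_leI)
    have nonneg: "peak h z t x \<ge> 0" for z t by (cases z) (simp add: peak_def)
    have ge: "(\<tau> - 3 * real n) * \<bar>y\<bar> \<ge> (\<tau> - 3 * real Q) * \<bar>y\<bar>" using nQ by (intro mult_right_mono) auto
    show "max 0 (1 - real n * (h + (\<tau> - 3 * real n) * \<bar>y\<bar>)) \<le> (\<Sum>z\<in>resonances h. peak h z (\<tau> - 3 * real Q) x)"
    proof (cases "real n * h < 1")
      case True
      then have mem: "(m, n) \<in> resonances h" using mn by (simp add: resonances_def)
      have "real n * (h + (\<tau> - 3 * real Q) * \<bar>y\<bar>) \<le> real n * (h + (\<tau> - 3 * real n) * \<bar>y\<bar>)"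
        using ge by (intro mult_left_mono) auto
      then have "max 0 (1 - real n * (h + (\<tau> - 3 * real n) * \<bar>y\<bar>)) \<le> max 0 (1 - real n * (h + (\<tau> - 3 * real Q) * \<bar>y\<bar>))"
        by (intro max.mono) auto
      also have "\<dots> = peak h (m, n) (\<tau> - 3 * real Q) x"
        by (simp add: peak_def y_def algebra_simps)
      also have "\<dots> \<le> (\<Sum>z\<in>resonances h. peak h z (\<tau> - 3 * real Q) x)"
        using finite_resonances[OF h] mem nonneg by (intro member_le_sum) auto
      finally show ?thesis .
    next
      case False
      have "(\<tau> - 3 * real n) * \<bar>y\<bar> \<ge> 0" using \<tau> nQ by simp
      then have "real n * (h + (\<tau> - 3 * real n) * \<bar>y\<bar>) \<ge> real n * h" by (intro mult_left_mono) auto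
      then have "max 0 (1 - real n * (h + (\<tau> - 3 * real n) * \<bar>y\<bar>)) = 0" using False by simp
      then show ?thesis using nonneg by (simp add: sum_nonneg)
    qed
  qed
  finally show ?thesis .
qed

text \<open>Distinct fractions are at least \<open>1 / (n * n')\<close> apart, while the peaks have width of
order \<open>1 / (n * \<tau>)\<close>.\<close>

lemma peaks_disjoint:
  assumes h: "h > 0" and z: "z \<in> resonances h" "z' \<in> resonances h" "z \<noteq> z'" and \<tau>: "\<tau> * h > 2"
  shows "peak h z \<tau> x = 0 \<or> peak h z' \<tau> x = 0"
proof (rule ccontr)
  assume not: "\<not> ?thesis"
  obtain m n m' n' where mn: "z = (m, n)" "z' = (m', n')" by (cases z, cases z')
  define u where "u = x - real m / real n"
  define u' where "u' = x - real m' / real n'"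
  have n: "n \<ge> 1" "n' \<ge> 1" "coprime m n" "coprime m' n'" "real n * h < 1" "real n' * h < 1"
    using z by (auto simp: mn resonances_def)
  have n0: "real n > 0" "real n' > 0" using n by auto
  have \<tau>0: "\<tau> > 0" using \<tau> h by (metis less_trans zero_less_mult_pos2 zero_less_numeral)
  have nh: "real n * h > 0" "real n' * h > 0" using n0 h by auto
  have 1: "real n * \<tau> * \<bar>u\<bar> < 1" using not nh by (auto simp: peak_def mn u_def max_def split: if_splits)
  have 2: "real n' * \<tau> * \<bar>u'\<bar> < 1" using not nh by (auto simp: peak_def mn u'_def max_def split: if_splits)
  have "m * n' \<noteq> m' * n"
  proof
    assume eq: "m * n' = m' * n"
    then have "n dvd n'" using n(3) by (metis coprime_commute coprime_dvd_mult_right_iff dvd_triv_right)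
    moreover have "n' dvd n" using n(4) eq by (metis coprime_commute coprime_dvd_mult_right_iff dvd_triv_right)
    ultimately have "n = n'" by (rule dvd_antisym)
    then show False using eq n z(3) mn by auto
  qed
  then have "int m * int n' - int m' * int n \<noteq> 0" by (metis eq_iff_diff_eq_0 of_nat_eq_iff of_nat_mult)
  then have "\<bar>int m * int n' - int m' * int n\<bar> \<ge> 1" by linarith
  then have "\<bar>real_of_int (int m * int n' - int m' * int n)\<bar> \<ge> 1" by linarith
  then have ge: "\<bar>real m * real n' - real m' * real n\<bar> \<ge> 1" by simp
  have "real m * real n' - real m' * real n = real n * real n' * (u' - u)"
    using n0 by (simp add: u_def u'_def field_simps)
  then have "1 \<le> real n * real n' * \<bar>u' - u\<bar>" using ge n0 by (simp add: abs_mult)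
  also have "\<dots> \<le> real n * real n' * (\<bar>u'\<bar> + \<bar>u\<bar>)" using n0 by (intro mult_left_mono) auto
  finally have "\<tau> * 1 \<le> \<tau> * (real n * real n' * (\<bar>u'\<bar> + \<bar>u\<bar>))" using \<tau>0 by (intro mult_left_mono) auto
  also have "\<dots> = real n * (real n' * \<tau> * \<bar>u'\<bar>) + real n' * (real n * \<tau> * \<bar>u\<bar>)" by (simp add: algebra_simps)
  also have "\<dots> < real n * 1 + real n' * 1"
    using 1 2 n0 by (intro add_strict_mono mult_strict_left_mono) auto
  finally have "\<tau> * h < (real n + real n') * h" using h by (intro mult_strict_right_mono) auto
  then show False using n \<tau> by (simp add: algebra_simps)
qed

lemma sum_peaks_le:
  assumes h: "h > 0" and \<tau>: "\<tau> * h > 2"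
  shows "ennreal (\<Sum>z\<in>resonances h. peak h z \<tau> x) \<le> survival_fraction h x \<tau>"
proof (cases "\<exists>z\<in>resonances h. peak h z \<tau> x \<noteq> 0")
  case True
  then obtain z where z: "z \<in> resonances h" "peak h z \<tau> x \<noteq> 0" by blast
  have "peak h z' \<tau> x = 0" if "z' \<in> resonances h - {z}" for z'
    using peaks_disjoint[OF h z(1), of z' \<tau> x] that z(2) \<tau> by auto
  then have "(\<Sum>z\<in>resonances h. peak h z \<tau> x) = (\<Sum>z\<in>{z}. peak h z \<tau> x)"
    using z(1) finite_resonances[OF h] by (intro sum.mono_neutral_right) auto
  moreover have "\<tau> \<ge> 0" using \<tau> h by (metis less_eq_real_def less_trans zero_less_mult_pos2 zero_less_numeral)
  ultimately show ?thesis using surviving_lower[of "fst z" "snd z" h \<tau> x] z(1) h by simp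
next
  case False
  then have "(\<Sum>z\<in>resonances h. peak h z \<tau> x) = 0" by (intro sum.neutral) auto
  then show ?thesis by simp
qed

section \<open>The limit of the survival probability for a fixed hole\<close>

lemma tent_integral:
  fixes e b :: real
  assumes e: "e \<ge> 0" and b: "b > 0"
  shows "has_bochner_integral lborel (\<lambda>u::real. max 0 (e - b * \<bar>u\<bar>)) (e\<^sup>2 / b)"
proof -
  define A where "A = e / b"
  have A: "A \<ge> 0" "b * A = e" using e b by (auto simp: A_def)
  have 1: "has_bochner_integral lborel (\<lambda>u. (e - b * u) * indicator {0..A} u) ((e * A - b * A\<^sup>2 / 2) - (e * 0 - b * 0\<^sup>2 / 2))"
    using A by (intro has_bochner_integral_FTC_Icc_real) (auto intro!: derivative_eq_intros)
  have 2: "has_bochner_integral lborel (\<lambda>u. (e + b * u) * indicator {- A..0} u) ((e * 0 + b * 0\<^sup>2 / 2) - (e * (- A) + b * (- A)\<^sup>2 / 2))"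
    using A by (intro has_bochner_integral_FTC_Icc_real) (auto intro!: derivative_eq_intros)
  have s: "has_bochner_integral lborel (\<lambda>u. (e - b * u) * indicator {0..A} u + (e + b * u) * indicator {- A..0} u)
     (((e * A - b * A\<^sup>2 / 2) - (e * 0 - b * 0\<^sup>2 / 2)) + ((e * 0 + b * 0\<^sup>2 / 2) - (e * (- A) + b * (- A)\<^sup>2 / 2)))"
    by (rule has_bochner_integral_add[OF 1 2])
  have val: "((e * A - b * A\<^sup>2 / 2) - (e * 0 - b * 0\<^sup>2 / 2)) + ((e * 0 + b * 0\<^sup>2 / 2) - (e * (- A) + b * (- A)\<^sup>2 / 2)) = e\<^sup>2 / b"
    using b by (simp add: A_def power2_eq_square field_simps)
  have "has_bochner_integral lborel (\<lambda>u. (e - b * u) * indicator {0..A} u + (e + b * u) * indicator {- A..0} u) (e\<^sup>2 / b) \<longleftrightarrow>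
    has_bochner_integral lborel (\<lambda>u. max 0 (e - b * \<bar>u\<bar>)) (e\<^sup>2 / b)"
  proof (rule has_bochner_integral_cong_AE)
    show "AE u in lborel. (e - b * u) * indicator {0..A} u + (e + b * u) * indicator {- A..0} u = max 0 (e - b * \<bar>u\<bar>)"
      using AE_lborel_singleton[of 0]
    proof eventually_elim
      case (elim u)
      have le: "b * w \<le> e \<longleftrightarrow> w \<le> A" for w using b by (simp add: A_def field_simps)
      show ?case
      proof (cases "u > 0")
        case True
        then show ?thesis using le[of u] A(1) by (auto simp: max_def split: split_indicator)
      next
        case False
        then have "u < 0" using elim by simp
        then show ?thesis using le[of "- u"] A(1) by (auto simp: max_def split: split_indicator)
      qed
    qed
  qed measurable
  then show ?thesis using s val by simp
qed

text \<open>The constant \<open>c\<close> is the number of collisions by which the upper and the lower estimate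
differ.\<close>

definition peak_integral :: "real \<Rightarrow> real \<Rightarrow> nat \<times> nat \<Rightarrow> real \<Rightarrow> real" where
  "peak_integral h c z t = (\<integral>x. sin (pi * x) * indicator {0<..<1} x * peak h z (t / (2 * sin (pi * x)) - c) x \<partial>lborel)"

lemma sin_pi_bounds: "0 < x \<Longrightarrow> x < 1 \<Longrightarrow> 0 < sin (pi * x) \<and> sin (pi * x) \<le> 1"
proof -
  assume x: "0 < x" "x < 1"
  then have "pi * x < pi * 1" by (intro mult_strict_left_mono) auto
  then show ?thesis using x by (auto intro!: sin_gt_zero)
qed

lemma collision_rate_ge:
  assumes "0 < x" "x < 1" "t \<ge> 0"
  shows "t / (2 * sin (pi * x)) \<ge> t / 2"
  using sin_pi_bounds[OF assms(1,2)] assms(3) by (auto simp: field_simps mult_left_le)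

lemma peak_bounds:
  assumes "\<tau> \<ge> 0" "h > 0"
  shows "0 \<le> peak h z \<tau> x \<and> peak h z \<tau> x \<le> 1"
proof (cases z)
  case (Pair m n)
  have "real n * h \<ge> 0" "real n * \<tau> * \<bar>x - real m / real n\<bar> \<ge> 0" using assms by auto
  then show ?thesis unfolding Pair peak_def by auto
qed

lemma peak_measurable [measurable]:
  "f \<in> borel_measurable borel \<Longrightarrow> (\<lambda>x. peak h z (f x) x) \<in> borel_measurable borel"
  unfolding peak_def by (cases z) simp

lemma peak_integrable:
  assumes "t \<ge> 2 * c" "t \<ge> 0" "h > 0"
  shows "integrable lborel (\<lambda>x. sin (pi * x) * indicator {0<..<1} x * peak h z (t / (2 * sin (pi * x)) - c) x)"
proof (rule Bochner_Integration.integrable_bound)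
  show "integrable lborel (indicator {0<..<1} :: real \<Rightarrow> real)" by simp
  show "AE x in lborel. norm (sin (pi * x) * indicator {0<..<1} x * peak h z (t / (2 * sin (pi * x)) - c) x)
     \<le> norm (indicator {0<..<1} x :: real)"
  proof (rule AE_I2)
    fix x :: real
    show "norm (sin (pi * x) * indicator {0<..<1} x * peak h z (t / (2 * sin (pi * x)) - c) x) \<le> norm (indicator {0<..<1} x :: real)"
    proof (cases "x \<in> {0<..<1}")
      case True
      have "t / (2 * sin (pi * x)) - c \<ge> 0"
        using collision_rate_ge[of x t] True assms by auto
      from peak_bounds[OF this \<open>h > 0\<close>, of z x] sin_pi_bounds[of x] True
      show ?thesis by (auto simp: abs_mult intro!: mult_le_one)
    qed auto
  qed
qed measurable

text \<open>The substitution \<open>x = m / n + u / t\<close> turns the peak into a tent in \<open>u\<close> of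
fixed width, and the bounded change \<open>c\<close> of the number of collisions disappears in the
limit. At the end points 0 and 1 the sine tends to 0, in agreement with the formula for the limit.\<close>

lemma peak_integral_limit:
  assumes h: "h > 0" and c: "c \<ge> 0" and mn: "(m, n) \<in> resonances h"
  shows "((\<lambda>t. t * peak_integral h c (m, n) t) \<longlongrightarrow> 2 * (sin (pi * real m / real n))\<^sup>2 * (1 - real n * h)\<^sup>2 / real n) at_top"
proof -
  define \<rho> where "\<rho> = real m / real n"
  define e where "e = 1 - real n * h"
  define s where "s = sin (pi * \<rho>)"
  have n: "real n \<ge> 1" "m \<le> n" using mn by (auto simp: resonances_def)
  have e: "0 \<le> e" "e \<le> 1" using mn h by (auto simp: e_def resonances_def)
  have \<rho>: "0 \<le> \<rho>" "\<rho> \<le> 1" using n by (auto simp: \<rho>_def)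
  define S where "S = (\<lambda>t u. sin (pi * (\<rho> + u / t)))"
  define G where "G = (\<lambda>t u. S t u * indicator {0<..<1} (\<rho> + u / t) * max 0 (e - real n * (1 / (2 * S t u) - c / t) * \<bar>u\<bar>))"
  define f where "f = (\<lambda>u. s * max 0 (e - real n / (2 * s) * \<bar>u\<bar>))"
  have subst: "t * peak_integral h c (m, n) t = (\<integral>u. G t u \<partial>lborel)" if t: "t > 0" for t
  proof -
    have "peak_integral h c (m, n) t = \<bar>1 / t\<bar> *\<^sub>R (\<integral>u. sin (pi * (\<rho> + 1 / t * u)) * indicator {0<..<1} (\<rho> + 1 / t * u)
       * peak h (m, n) (t / (2 * sin (pi * (\<rho> + 1 / t * u))) - c) (\<rho> + 1 / t * u) \<partial>lborel)"
      unfolding peak_integral_def using t by (intro lborel_integral_real_affine) auto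
    also have "(\<integral>u. sin (pi * (\<rho> + 1 / t * u)) * indicator {0<..<1} (\<rho> + 1 / t * u)
       * peak h (m, n) (t / (2 * sin (pi * (\<rho> + 1 / t * u))) - c) (\<rho> + 1 / t * u) \<partial>lborel) = (\<integral>u. G t u \<partial>lborel)"
    proof (rule Bochner_Integration.integral_cong[OF refl])
      fix u
      have "real n * (t / (2 * S t u) - c) * \<bar>u / t\<bar> = real n * (1 / (2 * S t u) - c / t) * \<bar>u\<bar>"
      proof -
        have "(t / (2 * S t u) - c) * (\<bar>u\<bar> / t) = (1 / (2 * S t u) - c / t) * \<bar>u\<bar>"
          using t by (simp add: left_diff_distrib diff_divide_distrib)
        then show ?thesis using t by (simp only: abs_divide abs_of_pos mult.assoc)
      qed
      then show "sin (pi * (\<rho> + 1 / t * u)) * indicator {0<..<1} (\<rho> + 1 / t * u)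
       * peak h (m, n) (t / (2 * sin (pi * (\<rho> + 1 / t * u))) - c) (\<rho> + 1 / t * u) = G t u"
        by (simp add: G_def S_def peak_def e_def \<rho>_def[symmetric])
    qed
    finally show ?thesis using t by simp
  qed
  \<comment> \<open>For \<open>t \<ge> 4 * c\<close> the slope of the tent is at least \<open>1 / 4\<close> and its height is at most 1.\<close>
  have Gbound: "norm (G t u) \<le> indicator {-4..4} u" if t: "t > 0" "t \<ge> 4 * c" for t u
  proof (cases "\<rho> + u / t \<in> {0<..<1}")
    case True
    have S: "0 < S t u" "S t u \<le> 1" unfolding S_def using sin_pi_bounds True by auto
    have ct: "c / t \<le> 1 / 4" using t by (simp add: field_simps)
    have "1 / (2 * S t u) \<ge> 1 / 2" using S by (simp add: field_simps)
    then have q: "1 / (2 * S t u) - c / t \<ge> 1 / 4" using ct by linarith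
    have r: "real n * (1 / (2 * S t u) - c / t) \<ge> 1 * (1 / 4)" using n q by (intro mult_mono) auto
    then have r2: "real n * (1 / (2 * S t u) - c / t) * \<bar>u\<bar> \<ge> 1 / 4 * \<bar>u\<bar>" by (intro mult_right_mono) auto
    have G: "G t u = S t u * max 0 (e - real n * (1 / (2 * S t u) - c / t) * \<bar>u\<bar>)" using True by (simp add: G_def)
    show ?thesis
    proof (cases "u \<in> {-4..4}")
      case True
      have "max 0 (e - real n * (1 / (2 * S t u) - c / t) * \<bar>u\<bar>) \<le> 1" using r2 e by auto
      then have "S t u * max 0 (e - real n * (1 / (2 * S t u) - c / t) * \<bar>u\<bar>) \<le> 1 * 1" using S by (intro mult_mono) auto
      then show ?thesis using True S unfolding G by simp
    next
      case False
      then have "\<bar>u\<bar> > 4" by auto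
      then have "max 0 (e - real n * (1 / (2 * S t u) - c / t) * \<bar>u\<bar>) = 0" using r2 e by auto
      then show ?thesis unfolding G by simp
    qed
  qed (simp add: G_def)
  have Slim: "((\<lambda>t. S t u) \<longlongrightarrow> s) at_top" for u
  proof -
    have "((\<lambda>t. u / t) \<longlongrightarrow> 0) at_top" by real_asymp
    then have "((\<lambda>t. sin (pi * (\<rho> + u / t))) \<longlongrightarrow> sin (pi * (\<rho> + 0))) at_top" by (intro tendsto_intros)
    then show ?thesis by (simp add: S_def s_def)
  qed
  have Glim: "((\<lambda>t. G t u) \<longlongrightarrow> f u) at_top" for u
  proof (cases "s = 0")
    case True
    have "((\<lambda>t. G t u) \<longlongrightarrow> 0) at_top"
    proof (rule Lim_null_comparison)
      show "((\<lambda>t. \<bar>S t u\<bar>) \<longlongrightarrow> 0) at_top" using tendsto_rabs[OF Slim[of u]] True by simp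
      show "eventually (\<lambda>t. norm (G t u) \<le> \<bar>S t u\<bar>) at_top"
        using eventually_gt_at_top[of 0] eventually_ge_at_top[of "4 * c"]
      proof eventually_elim
        case (elim t)
        have "max 0 (e - real n * (1 / (2 * S t u) - c / t) * \<bar>u\<bar>) \<le> 1" if T: "\<rho> + u / t \<in> {0<..<1}"
        proof -
          have S: "0 < S t u" "S t u \<le> 1" unfolding S_def using sin_pi_bounds T by auto
          have ct: "c / t \<le> 1 / 4" using elim by (simp add: field_simps)
          have "1 / (2 * S t u) \<ge> 1 / 2" using S by (simp add: field_simps)
          then have "1 / (2 * S t u) - c / t \<ge> 0" using ct by linarith
          then have "real n * (1 / (2 * S t u) - c / t) * \<bar>u\<bar> \<ge> 0" by simp
          then show ?thesis using e by auto
        qed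
        then show ?case by (auto simp: G_def abs_mult mult_left_le split: split_indicator)
      qed
    qed
    then show ?thesis by (simp add: f_def True)
  next
    case False
    have "\<rho> \<noteq> 0" "\<rho> \<noteq> 1" using False by (auto simp: s_def)
    then have \<rho>': "0 < \<rho>" "\<rho> < 1" using \<rho> by auto
    have "((\<lambda>t. u / t) \<longlongrightarrow> 0) at_top" "((\<lambda>t. c / t) \<longlongrightarrow> 0) at_top" by real_asymp+
    then have "((\<lambda>t. \<rho> + u / t) \<longlongrightarrow> \<rho> + 0) at_top" by (intro tendsto_intros)
    then have "eventually (\<lambda>t. \<rho> + u / t \<in> {0<..<1}) at_top"
      using \<rho>' by (auto dest!: topological_tendstoD[of _ _ _ "{0<..<1}"])
    then have "eventually (\<lambda>t. S t u * max 0 (e - real n * (1 / (2 * S t u) - c / t) * \<bar>u\<bar>) = G t u) at_top"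
      by eventually_elim (simp add: G_def)
    moreover have "((\<lambda>t. S t u * max 0 (e - real n * (1 / (2 * S t u) - c / t) * \<bar>u\<bar>)) \<longlongrightarrow> s * max 0 (e - real n * (1 / (2 * s) - 0) * \<bar>u\<bar>)) at_top"
      using False by (intro tendsto_intros Slim \<open>((\<lambda>t. c / t) \<longlongrightarrow> 0) at_top\<close>) auto
    ultimately have "((\<lambda>t. G t u) \<longlongrightarrow> s * max 0 (e - real n * (1 / (2 * s) - 0) * \<bar>u\<bar>)) at_top"
      by (rule Lim_transform_eventually[rotated])
    then show ?thesis by (simp add: f_def)
  qed
  have "((\<lambda>t. \<integral>u. G t u \<partial>lborel) \<longlongrightarrow> (\<integral>u. f u \<partial>lborel)) at_top"
  proof (rule integral_dominated_convergence_at_top[where w = "indicator {-4..4}"])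
    show "eventually (\<lambda>t. AE u in lborel. norm (G t u) \<le> indicator {-4..4} u) at_top"
      using eventually_gt_at_top[of 0] eventually_ge_at_top[of "4 * c"] by eventually_elim (use Gbound in auto)
    show "f \<in> borel_measurable lborel" unfolding f_def by measurable
    show "G t \<in> borel_measurable lborel" for t unfolding G_def S_def by measurable
  qed (use Glim in auto)
  moreover have "(\<integral>u. f u \<partial>lborel) = 2 * s\<^sup>2 * e\<^sup>2 / real n"
  proof (cases "s = 0")
    case False
    have "s \<ge> 0" unfolding s_def using \<rho> by (intro sin_ge_zero) (auto simp: mult_left_le)
    then have s: "s > 0" using False by simp
    have "(\<integral>u. f u \<partial>lborel) = s * (e\<^sup>2 / (real n / (2 * s)))"
      unfolding f_def using has_bochner_integral_integral_eq[OF tent_integral[OF e(1), of "real n / (2 * s)"]] s n by simp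
    then show ?thesis using s n by (simp add: power2_eq_square)
  qed (simp add: f_def)
  ultimately have "((\<lambda>t. \<integral>u. G t u \<partial>lborel) \<longlongrightarrow> 2 * s\<^sup>2 * e\<^sup>2 / real n) at_top" by simp
  then have "((\<lambda>t. t * peak_integral h c (m, n) t) \<longlongrightarrow> 2 * s\<^sup>2 * e\<^sup>2 / real n) at_top"
    by (rule Lim_transform_eventually)
       (rule eventually_mono[OF eventually_gt_at_top[of 0]], simp only: subst)
  then show ?thesis by (simp add: s_def e_def \<rho>_def)
qed

lemma peak_nn_integral:
  assumes t: "t \<ge> 2 * c" "t \<ge> 0" and h: "h > 0"
  shows "(\<integral>\<^sup>+ x. ennreal (angle_density x) *
      ennreal (\<Sum>z\<in>resonances h. peak h z (t / (2 * sin (pi * x)) - c) x) \<partial>lborel)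
    = ennreal (pi / 2 * (\<Sum>z\<in>resonances h. peak_integral h c z t))"
    and "0 \<le> (\<Sum>z\<in>resonances h. peak_integral h c z t)"
proof -
  define g where "g = (\<lambda>z x. sin (pi * x) * indicator {0<..<1} x * peak h z (t / (2 * sin (pi * x)) - c) x)"
  have pint: "peak_integral h c z t = (\<integral>x. g z x \<partial>lborel)" for z
    by (simp add: peak_integral_def g_def)
  have int: "integrable lborel (g z)" for z unfolding g_def by (rule peak_integrable[OF t h])
  have nn: "g z x \<ge> 0" for z x
  proof (cases "x \<in> {0<..<1}")
    case True
    have "t / (2 * sin (pi * x)) - c \<ge> 0" using collision_rate_ge[of x t] True t by auto
    from peak_bounds[OF this h, of z x] sin_pi_bounds[of x] True show ?thesis by (simp add: g_def)
  qed (simp add: g_def)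
  have nn2: "pi / 2 * (\<Sum>z\<in>resonances h. g z x) \<ge> 0" for x using nn by (intro mult_nonneg_nonneg sum_nonneg) auto
  have "(\<integral>\<^sup>+ x. ennreal (angle_density x) *
      ennreal (\<Sum>z\<in>resonances h. peak h z (t / (2 * sin (pi * x)) - c) x) \<partial>lborel)
     = (\<integral>\<^sup>+ x. ennreal (pi / 2 * (\<Sum>z\<in>resonances h. g z x)) \<partial>lborel)"
  proof (rule nn_integral_cong)
    fix x :: real
    have "sin (pi * x) * indicator {0<..<1} x \<ge> 0" using sin_pi_bounds[of x] by (auto split: split_indicator)
    then have "ennreal (angle_density x) * ennreal (\<Sum>z\<in>resonances h. peak h z (t / (2 * sin (pi * x)) - c) x)
      = ennreal (angle_density x * (\<Sum>z\<in>resonances h. peak h z (t / (2 * sin (pi * x)) - c) x))"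
      by (intro ennreal_mult'[symmetric]) auto
    also have "angle_density x * (\<Sum>z\<in>resonances h. peak h z (t / (2 * sin (pi * x)) - c) x)
      = pi / 2 * (\<Sum>z\<in>resonances h. g z x)"
      by (simp add: g_def sum_distrib_left mult.assoc)
    finally show "ennreal (angle_density x) * ennreal (\<Sum>z\<in>resonances h. peak h z (t / (2 * sin (pi * x)) - c) x)
       = ennreal (pi / 2 * (\<Sum>z\<in>resonances h. g z x))" .
  qed
  also have "\<dots> = ennreal (\<integral>x. pi / 2 * (\<Sum>z\<in>resonances h. g z x) \<partial>lborel)"
    using int nn2 by (intro nn_integral_eq_integral integrable_mult_right Bochner_Integration.integrable_sum) auto
  also have "(\<integral>x. pi / 2 * (\<Sum>z\<in>resonances h. g z x) \<partial>lborel) = pi / 2 * (\<Sum>z\<in>resonances h. peak_integral h c z t)"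
    unfolding pint using int by (simp add: Bochner_Integration.integral_sum)
  finally show "(\<integral>\<^sup>+ x. ennreal (angle_density x) *
      ennreal (\<Sum>z\<in>resonances h. peak h z (t / (2 * sin (pi * x)) - c) x) \<partial>lborel)
    = ennreal (pi / 2 * (\<Sum>z\<in>resonances h. peak_integral h c z t))" .
  show "0 \<le> (\<Sum>z\<in>resonances h. peak_integral h c z t)"
    unfolding pint using nn by (intro sum_nonneg Bochner_Integration.integral_nonneg) auto
qed

text \<open>Upper and lower estimates by sums of peaks have the same limit.\<close>

theorem survival_prob_limit:
  assumes d: "d > 0"
  defines "h \<equiv> d / (2 * pi)"
  shows "((\<lambda>t. t * survival_prob t d) \<longlongrightarrow>
    pi * (\<Sum>(m, n)\<in>resonances h. (sin (pi * real m / real n))\<^sup>2 * (1 - real n * h)\<^sup>2 / real n)) at_top"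
proof -
  have h: "h > 0" using d by (simp add: h_def)
  \<comment> \<open>For this \<open>Q\<close> the fractions of Dirichlet's theorem have a drift over one period below the length of the hole.\<close>
  define Q where "Q = nat \<lceil>1 / h\<rceil> + 1"
  have Q: "real Q * h \<ge> 1" "Q \<ge> 1"
  proof -
    have "real Q \<ge> 1 / h" unfolding Q_def by linarith
    then show "real Q * h \<ge> 1" using h by (simp add: field_simps)
  qed (simp add: Q_def)
  define lo up where "lo = (\<lambda>t. pi / 2 * (\<Sum>z\<in>resonances h. peak_integral h 0 z t))"
    and "up = (\<lambda>t. pi / 2 * (\<Sum>z\<in>resonances h. peak_integral h (3 * real Q) z t))"
  define T where "T = max (6 * real Q) (4 / h + 1)"
  have bounds: "lo t \<le> survival_prob t d \<and> survival_prob t d \<le> up t" if t: "t \<ge> T" for t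
  proof -
    have t6: "t \<ge> 6 * real Q" "t \<ge> 0" using t by (auto simp: T_def)
    have th: "t * h > 4"
    proof -
      have "t > 4 / h" using t by (auto simp: T_def)
      then show ?thesis using h by (simp add: field_simps)
    qed
    define E where "E = emeasure billiard_measure {x \<in> phase_space. escape_time d x > ereal t}"
    have E: "E = (\<integral>\<^sup>+ x. ennreal (angle_density x) *
         survival_fraction h x (t / (2 * sin (pi * x))) \<partial>lborel)"
      unfolding E_def h_def by (rule survival_prob_integral[OF t6(2)])
    have "E \<le> (\<integral>\<^sup>+ x. ennreal (angle_density x) *
      ennreal (\<Sum>z\<in>resonances h. peak h z (t / (2 * sin (pi * x)) - 3 * real Q) x) \<partial>lborel)"
      unfolding E
    proof (rule nn_integral_mono)
      fix x :: real
      show "ennreal (angle_density x) *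
         survival_fraction h x (t / (2 * sin (pi * x)))
        \<le> ennreal (angle_density x) *
      ennreal (\<Sum>z\<in>resonances h. peak h z (t / (2 * sin (pi * x)) - 3 * real Q) x)"
      proof (cases "x \<in> {0<..<1}")
        case True
        then show ?thesis using collision_rate_ge[of x t] t6
          by (intro mult_left_mono surviving_upper h Q) auto
      qed simp
    qed
    also have "\<dots> = ennreal (up t)" unfolding up_def using t6 h by (intro peak_nn_integral(1)) auto
    finally have 1: "E \<le> ennreal (up t)" .
    have "ennreal (lo t) = (\<integral>\<^sup>+ x. ennreal (angle_density x) *
      ennreal (\<Sum>z\<in>resonances h. peak h z (t / (2 * sin (pi * x)) - 0) x) \<partial>lborel)"
      unfolding lo_def using t6 h by (intro peak_nn_integral(1)[symmetric]) auto
    also have "\<dots> \<le> E"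
      unfolding E
    proof (rule nn_integral_mono)
      fix x :: real
      show "ennreal (angle_density x) *
        ennreal (\<Sum>z\<in>resonances h. peak h z (t / (2 * sin (pi * x)) - 0) x)
        \<le> ennreal (angle_density x) *
         survival_fraction h x (t / (2 * sin (pi * x)))"
      proof (cases "x \<in> {0<..<1}")
        case True
        then have "t / (2 * sin (pi * x)) \<ge> t / 2" using collision_rate_ge[of x t] t6 by auto
        then have "t / (2 * sin (pi * x)) * h \<ge> t / 2 * h" using h by (intro mult_right_mono) auto
        then have "t / (2 * sin (pi * x)) * h > 2" using th by linarith
        then show ?thesis using sum_peaks_le[OF h, of "t / (2 * sin (pi * x))" x] by (intro mult_left_mono) auto
      qed simp
    qed
    finally have 2: "ennreal (lo t) \<le> E" .
    have nn: "lo t \<ge> 0" "up t \<ge> 0"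
      unfolding lo_def up_def using t6 h by (intro mult_nonneg_nonneg peak_nn_integral(2); simp)+
    have sp: "survival_prob t d = enn2real E" by (simp add: survival_prob_def measure_def E_def)
    have "E \<noteq> \<infinity>" using 1 by (auto simp: top_unique)
    then have "E = ennreal (enn2real E)" by (simp add: less_top)
    then have "ennreal (lo t) \<le> ennreal (enn2real E)" "ennreal (enn2real E) \<le> ennreal (up t)"
      using 1 2 by simp_all
    then show ?thesis unfolding sp using nn by (simp add: ennreal_le_iff)
  qed
  have lim: "((\<lambda>t. t * (pi / 2 * (\<Sum>z\<in>resonances h. peak_integral h c z t))) \<longlongrightarrow>
    pi * (\<Sum>(m, n)\<in>resonances h. (sin (pi * real m / real n))\<^sup>2 * (1 - real n * h)\<^sup>2 / real n)) at_top" if c: "c \<ge> 0" for c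
  proof -
    have "((\<lambda>t. pi / 2 * (\<Sum>z\<in>resonances h. t * peak_integral h c z t)) \<longlongrightarrow>
      pi / 2 * (\<Sum>z\<in>resonances h. case z of (m, n) \<Rightarrow> 2 * (sin (pi * real m / real n))\<^sup>2 * (1 - real n * h)\<^sup>2 / real n)) at_top"
      using peak_integral_limit[OF h c] by (intro tendsto_mult_left tendsto_sum) auto
    moreover have "pi / 2 * (\<Sum>z\<in>resonances h. case z of (m, n) \<Rightarrow> 2 * (sin (pi * real m / real n))\<^sup>2 * (1 - real n * h)\<^sup>2 / real n)
      = pi * (\<Sum>(m, n)\<in>resonances h. (sin (pi * real m / real n))\<^sup>2 * (1 - real n * h)\<^sup>2 / real n)"
      by (simp add: sum_distrib_left case_prod_unfold)
    moreover have "pi / 2 * (\<Sum>z\<in>resonances h. t * peak_integral h c z t) = t * (pi / 2 * (\<Sum>z\<in>resonances h. peak_integral h c z t))" for t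
      by (simp add: sum_distrib_left mult_ac)
    ultimately show ?thesis by (simp only:)
  qed
  show ?thesis
  proof (rule tendsto_sandwich)
    show "eventually (\<lambda>t. t * lo t \<le> t * survival_prob t d) at_top"
      using eventually_ge_at_top[of T] eventually_ge_at_top[of 0]
      by eventually_elim (use bounds in \<open>auto intro: mult_left_mono\<close>)
    show "eventually (\<lambda>t. t * survival_prob t d \<le> t * up t) at_top"
      using eventually_ge_at_top[of T] eventually_ge_at_top[of 0]
      by eventually_elim (use bounds in \<open>auto intro: mult_left_mono\<close>)
  qed (use lim[of 0] lim[of "3 * real Q"] in \<open>auto simp: lo_def up_def\<close>)
qed

section \<open>Letting the hole shrink\<close>

text \<open>The two index sets differ in the denominator \<open>n = X\<close> only, where the summand vanishes.\<close>

lemma sum_resonances: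
  assumes X: "X \<ge> 1"
  shows "(\<Sum>(m, n)\<in>resonances (1 / X). (sin (pi * real m / real n))\<^sup>2 * (1 - real n * (1 / X))\<^sup>2 / real n)
    = (\<Sum>n = 1..nat \<lfloor>X\<rfloor>. \<Sum>m | m \<le> n \<and> coprime m n. (sin (pi * real m / real n))\<^sup>2 * (1 - real n / X)\<^sup>2 / real n)"
proof -
  define f where "f = (\<lambda>m n. (sin (pi * real m / real n))\<^sup>2 * (1 - real n / X)\<^sup>2 / real n)"
  define B where "B = Sigma {1..nat \<lfloor>X\<rfloor>} (\<lambda>n. {m. m \<le> n \<and> coprime m n})"
  have Dx: "real n \<le> X \<longleftrightarrow> n \<le> nat \<lfloor>X\<rfloor>" for n using X by linarith
  have less: "real n * (1 / X) < 1 \<longleftrightarrow> real n < X" for n using X by simp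
  have "(\<Sum>(m, n)\<in>resonances (1 / X). f m n) = (\<Sum>(n, m)\<in>(\<lambda>(m, n). (n, m)) ` resonances (1 / X). f m n)"
    by (subst sum.reindex) (auto simp: inj_on_def case_prod_unfold)
  also have "\<dots> = (\<Sum>(n, m)\<in>B. f m n)"
  proof (rule sum.mono_neutral_left)
    show "finite B" by (auto simp: B_def)
    show "(\<lambda>(m, n). (n, m)) ` resonances (1 / X) \<subseteq> B"
    proof
      fix z assume "z \<in> (\<lambda>(m, n). (n, m)) ` resonances (1 / X)"
      then obtain m n where z: "z = (n, m)" "1 \<le> n" "m \<le> n" "coprime m n" "real n < X"
        unfolding resonances_def less by auto
      then show "z \<in> B" using Dx[of n] by (simp add: B_def)
    qed
    show "\<forall>z\<in>B - (\<lambda>(m, n). (n, m)) ` resonances (1 / X). (case z of (n, m) \<Rightarrow> f m n) = 0"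
    proof
      fix z assume z: "z \<in> B - (\<lambda>(m, n). (n, m)) ` resonances (1 / X)"
      obtain n m where nm: "z = (n, m)" by (cases z)
      have B: "1 \<le> n" "n \<le> nat \<lfloor>X\<rfloor>" "m \<le> n" "coprime m n" using z by (auto simp: B_def nm)
      have "\<not> real n < X"
      proof
        assume "real n < X"
        then have "(m, n) \<in> resonances (1 / X)" unfolding resonances_def less using B by simp
        then show False using z nm by (force simp: image_iff)
      qed
      then have "real n = X" using B(2) Dx[of n] by simp
      then show "(case z of (n, m) \<Rightarrow> f m n) = 0" using X by (simp add: nm f_def)
    qed
  qed
  also have "\<dots> = (\<Sum>n = 1..nat \<lfloor>X\<rfloor>. \<Sum>m | m \<le> n \<and> coprime m n. f m n)"
    unfolding B_def by (subst sum.Sigma) auto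
  finally show ?thesis by (simp add: f_def)
qed

theorem theorem4:
  fixes \<alpha> :: real
  assumes "riemann_hypothesis" and "\<alpha> > 0"
  shows "\<exists>L :: real \<Rightarrow> real.
    (\<forall>\<^sub>F \<Delta> in at_right 0.
       ((\<lambda>t. \<Delta> powr (\<alpha> - 1 / 2) * (t * survival_prob t \<Delta> - 2 / \<Delta>)) \<longlongrightarrow> L \<Delta>) at_top) \<and>
    (L \<longlongrightarrow> 0) (at_right 0)"
proof -
  \<comment> \<open>Any positive exponent below \<open>\<alpha>\<close> and \<open>1 / 2\<close> serves here.\<close>
  define \<eta> where "\<eta> = min (\<alpha> / 2) (1 / 4)"
  have \<eta>: "\<eta> > 0" "\<eta> < 1 / 2" "\<eta> < \<alpha>" using assms(2) by (auto simp: \<eta>_def)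
  obtain C where C: "\<forall>X\<ge>1.
    \<bar>pi * (\<Sum>n = 1..nat \<lfloor>X\<rfloor>. \<Sum>m | m \<le> n \<and> coprime m n.
        (sin (pi * real m / real n))\<^sup>2 * (1 - real n / X)\<^sup>2 / real n) - X / pi\<bar> \<le> C * X powr (\<eta> - 1 / 2)"
    using resonance_estimate[OF assms(1) \<eta>(1,2)] by (elim exE)
  define F where "F = (\<lambda>\<Delta>. pi * (\<Sum>(m, n)\<in>resonances (\<Delta> / (2 * pi)).
      (sin (pi * real m / real n))\<^sup>2 * (1 - real n * (\<Delta> / (2 * pi)))\<^sup>2 / real n))"
  define L where "L = (\<lambda>\<Delta>. \<Delta> powr (\<alpha> - 1 / 2) * (F \<Delta> - 2 / \<Delta>))"
  have "eventually (\<lambda>\<Delta>::real. ((\<lambda>t. \<Delta> powr (\<alpha> - 1 / 2) * (t * survival_prob t \<Delta> - 2 / \<Delta>)) \<longlongrightarrow> L \<Delta>) at_top) (at_right 0)"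
    using eventually_at_right_less[of 0]
  proof eventually_elim
    case (elim \<Delta>)
    show ?case unfolding L_def F_def by (intro tendsto_intros survival_prob_limit elim)
  qed
  moreover have "(L \<longlongrightarrow> 0) (at_right 0)"
  proof (rule Lim_null_comparison)
    have "((\<lambda>\<Delta>::real. \<Delta> powr (\<alpha> - \<eta>)) \<longlongrightarrow> 0) (at_right 0)"
      using \<eta>(3) by real_asymp
    then show "((\<lambda>\<Delta>. C * (2 * pi) powr (\<eta> - 1 / 2) * \<Delta> powr (\<alpha> - \<eta>)) \<longlongrightarrow> 0) (at_right 0)"
      by (rule tendsto_mult_right_zero)
    have "eventually (\<lambda>\<Delta>::real. \<Delta> \<in> {0<..<2 * pi}) (at_right 0)"
      by (rule eventually_at_right_real) simp
    then show "eventually (\<lambda>\<Delta>. norm (L \<Delta>) \<le> C * (2 * pi) powr (\<eta> - 1 / 2) * \<Delta> powr (\<alpha> - \<eta>)) (at_right 0)"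
    proof eventually_elim
      case (elim \<Delta>)
      define X where "X = 2 * pi / \<Delta>"
      have \<Delta>: "\<Delta> > 0" "\<Delta> < 2 * pi" using elim by auto
      have X: "X \<ge> 1" "\<Delta> / (2 * pi) = 1 / X" "2 / \<Delta> = X / pi" using \<Delta> by (auto simp: X_def)
      have "\<bar>F \<Delta> - 2 / \<Delta>\<bar> \<le> C * X powr (\<eta> - 1 / 2)"
        unfolding F_def X(2,3) sum_resonances[OF X(1)] using C X(1) by blast
      then have "\<Delta> powr (\<alpha> - 1 / 2) * \<bar>F \<Delta> - 2 / \<Delta>\<bar> \<le> \<Delta> powr (\<alpha> - 1 / 2) * (C * X powr (\<eta> - 1 / 2))"
        by (intro mult_left_mono) auto
      also have "X powr (\<eta> - 1 / 2) = (2 * pi) powr (\<eta> - 1 / 2) / \<Delta> powr (\<eta> - 1 / 2)"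
        unfolding X_def by (rule powr_divide)
      also have "\<Delta> powr (\<alpha> - 1 / 2) * (C * ((2 * pi) powr (\<eta> - 1 / 2) / \<Delta> powr (\<eta> - 1 / 2)))
        = C * (2 * pi) powr (\<eta> - 1 / 2) * (\<Delta> powr (\<alpha> - 1 / 2) / \<Delta> powr (\<eta> - 1 / 2))" by simp
      also have "\<Delta> powr (\<alpha> - 1 / 2) / \<Delta> powr (\<eta> - 1 / 2) = \<Delta> powr (\<alpha> - \<eta>)"
        using \<Delta> by (simp flip: powr_diff)
      finally show ?case by (simp add: L_def abs_mult)
    qed
  qed
  ultimately show ?thesis by blast
qed

end
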